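(* Let $C_{-1}\in\mathbb{R}$ and let $(\mathbb{R}^2,\tilde g)$, $\tilde g(\omega,\theta)=\Gamma^2(\omega)\,d\theta^2+d\omega^2$, be the complete surface associated with $C_{-1}$ as defined in the context. Then there exists a unique (up to isometries of $\mathbb{H}^3$) biconservative immersion $\Phi:(\mathbb{R}^2,\tilde g)\to\mathbb{H}^3$. Moreover, $\operatorname{grad} f\neq 0$ at any point of $\mathbb{R}^{\ast}\times\mathbb{R}=\{(\omega,\theta)\in\mathbb{R}^2:\omega\neq 0\}$, where $f$ is the mean curvature function of the immersion $\Phi$.
   Context: $\mathbb{H}^3$ is the $3$-dimensional hyperbolic space of constant sectional curvature $-1$. An isometric immersion $\varphi:(M^2,g)\to\mathbb{H}^3$ of an oriented surface is called biconservative if the tangential part of its bitension field vanishes; equivalently, $$A(\operatorname{grad} f)=-\frac{f}{2}\operatorname{grad} f,$$ where $A$ is the shape operator and $f=\operatorname{trace}A$ is the mean curvature function. All biconservative immersions are understood to be isometric immersions. Construction of $(\mathbb{R}^2,\tilde g)$. Fix $C_{-1}\in\mathbb{R}$. Let $T(\xi)=-\xi^{8/3}+C_{-1}\xi^2+3$ for $\xi>0$, and let $\xi_{01}>0$ be the unique positive zero of $T$; one has $T>0$ on $(0,\xi_{01})$. Fix an arbitrary $\xi_{00}\in(0,\xi_{01})$ and define $$\rho:(0,\xi_{01})\to\mathbb{R},\qquad \rho(\xi)=-\int_{\xi_{00}}^{\xi}\sqrt{\frac{3}{\tau^2\left(-\tau^{8/3}+C_{-1}\tau^2+3\right)}}\,d\tau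 .$$ The function $\rho$ is strictly decreasing, $\lim_{\xi\searrow 0}\rho(\xi)=\infty$ and $\lim_{\xi\nearrow\xi_{01}}\rho(\xi)=\rho_1\in(-\infty,0)$. Let $\xi=\xi(\rho)$, $\rho\in(\rho_1,\infty)$, be its inverse function, and put $h(\omega)=1/\xi(\omega+\rho_1)$ for $\omega>0$. Define $\Gamma:\mathbb{R}\to\mathbb{R}$ by $\Gamma(\omega)=h(\omega)$ for $\omega>0$, $\Gamma(0)=1/\xi_{01}$, $\Gamma(\omega)=h(-\omega)$ for $\omega<0$ (it is at least of class $C^3$), and $\tilde g(\omega,\theta)=\Gamma^2(\omega)d\theta^2+d\omega^2$ on $\mathbb{R}^2$. *)

theory Defs
  imports "HOL-Analysis.Analysis"
begin

section \<open>Smooth maps on the coordinate plane\<close>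

definition pd :: "2 \<Rightarrow> (real^2 \<Rightarrow> 'a::real_normed_vector) \<Rightarrow> real^2 \<Rightarrow> 'a" where
  "pd i F p = vector_derivative (\<lambda>t. F (p + t *\<^sub>R axis i 1)) (at 0)"

primrec C_class :: "nat \<Rightarrow> (real^2 \<Rightarrow> 'a::real_normed_vector) \<Rightarrow> bool" where
  "C_class 0 F \<longleftrightarrow> continuous_on UNIV F"
| "C_class (Suc k) F \<longleftrightarrow> (\<forall>p. F differentiable at p) \<and> (\<forall>i. C_class k (pd i F))"

definition smooth :: "(real^2 \<Rightarrow> 'a::real_normed_vector) \<Rightarrow> bool" where
  "smooth F \<longleftrightarrow> (\<forall>k. C_class k F)"


section \<open>Hyperbolic space\<close>

text \<open>Hyperboloid model: the upper sheet of \<open>\<langle>x, x\<rangle> = -1\<close> in Minkowski space, with the induced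
  metric (constant sectional curvature -1). The first component is the time coordinate. Maps into
  \<open>H3\<close> and vector fields along them take values in the ambient linear space.\<close>

type_synonym minkowski = "real \<times> (real^3)"

definition lor :: "minkowski \<Rightarrow> minkowski \<Rightarrow> real" where
  "lor x y = snd x \<bullet> snd y - fst x * fst y"

definition H3 :: "minkowski set" where
  "H3 = {x. lor x x = -1 \<and> fst x > 0}"

definition hdist :: "minkowski \<Rightarrow> minkowski \<Rightarrow> real" where
  "hdist x y = arcosh (- lor x y)"

definition isometry_H3 :: "(minkowski \<Rightarrow> minkowski) \<Rightarrow> bool" where
  "isometry_H3 F \<longleftrightarrow> bij_betw F H3 H3 \<and> (\<forall>x\<in>H3. \<forall>y\<in>H3. hdist (F x) (F y) = hdist x y)"

text \<open>The Riemann tensor \<open>R(X,Y)Z = [\<nabla>\<^sub>X,\<nabla>\<^sub>Y]Z - \<nabla>\<^bsub>[X,Y]\<^esub>Z\<close> of a space of constant sectional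
  curvature -1.\<close>

definition curv_H3 :: "minkowski \<Rightarrow> minkowski \<Rightarrow> minkowski \<Rightarrow> minkowski" where
  "curv_H3 X Y Z = - (lor Y Z *\<^sub>R X - lor X Z *\<^sub>R Y)"

text \<open>The connection induced along \<open>\<Phi>\<close>, in the \<open>i\<close>-th coordinate direction: the flat derivative
  followed by the orthogonal projection \<open>v \<mapsto> v + \<langle>v, x\<rangle> x\<close> onto the tangent space at
  \<open>x = \<Phi> p\<close>, which is the orthogonal complement of \<open>x\<close>.\<close>

definition cov :: "(real^2 \<Rightarrow> minkowski) \<Rightarrow> 2 \<Rightarrow> (real^2 \<Rightarrow> minkowski) \<Rightarrow> real^2 \<Rightarrow> minkowski" where
  "cov \<Phi> i V p = pd i V p + lor (pd i V p) (\<Phi> p) *\<^sub>R \<Phi> p"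


section \<open>Immersions of the plane with a Riemannian metric\<close>

type_synonym metric2 = "real^2 \<Rightarrow> real^2^2"

definition ginv :: "metric2 \<Rightarrow> real^2 \<Rightarrow> 2 \<Rightarrow> 2 \<Rightarrow> real" where
  "ginv g p i j = matrix_inv (g p) $ i $ j"

text \<open>\<open>christoffel g p k i j\<close> has the upper index \<open>k\<close>.\<close>

definition christoffel :: "metric2 \<Rightarrow> real^2 \<Rightarrow> 2 \<Rightarrow> 2 \<Rightarrow> 2 \<Rightarrow> real" where
  "christoffel g p k i j = (\<Sum>l\<in>UNIV. ginv g p k l *
     (pd i (\<lambda>q. g q $ j $ l) p + pd j (\<lambda>q. g q $ i $ l) p - pd l (\<lambda>q. g q $ i $ j) p)) / 2"

definition grad :: "metric2 \<Rightarrow> (real^2 \<Rightarrow> real) \<Rightarrow> real^2 \<Rightarrow> real^2" where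
  "grad g f p = (\<chi> i. \<Sum>j\<in>UNIV. ginv g p i j * pd j f p)"

text \<open>The differential of an isometric immersion is injective because \<open>g\<close> is positive definite.\<close>

definition isometric_immersion :: "metric2 \<Rightarrow> (real^2 \<Rightarrow> minkowski) \<Rightarrow> bool" where
  "isometric_immersion g \<Phi> \<longleftrightarrow> smooth \<Phi> \<and> range \<Phi> \<subseteq> H3 \<and>
     (\<forall>p i j. lor (pd i \<Phi> p) (pd j \<Phi> p) = g p $ i $ j)"

text \<open>The tension field: the trace of the second fundamental form \<open>\<nabla>d\<Phi>\<close>.\<close>

definition tension :: "metric2 \<Rightarrow> (real^2 \<Rightarrow> minkowski) \<Rightarrow> real^2 \<Rightarrow> minkowski" where
  "tension g \<Phi> p = (\<Sum>i\<in>UNIV. \<Sum>j\<in>UNIV. ginv g p i j *\<^sub>R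
     (cov \<Phi> i (pd j \<Phi>) p - (\<Sum>k\<in>UNIV. christoffel g p k i j *\<^sub>R pd k \<Phi> p)))"

text \<open>The rough Laplacian on sections of the pull-back bundle, with the sign convention
  \<open>\<Delta> = - trace (\<nabla>\<nabla> - \<nabla>\<^bsub>\<nabla>\<^esub>)\<close>.\<close>

definition rough_laplacian ::
    "metric2 \<Rightarrow> (real^2 \<Rightarrow> minkowski) \<Rightarrow> (real^2 \<Rightarrow> minkowski) \<Rightarrow> real^2 \<Rightarrow> minkowski" where
  "rough_laplacian g \<Phi> V p = - (\<Sum>i\<in>UNIV. \<Sum>j\<in>UNIV. ginv g p i j *\<^sub>R
     (cov \<Phi> i (cov \<Phi> j V) p - (\<Sum>k\<in>UNIV. christoffel g p k i j *\<^sub>R cov \<Phi> k V p)))"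

text \<open>\<open>\<tau>\<^sub>2(\<Phi>) = - \<Delta> \<tau>(\<Phi>) - trace R(d\<Phi>, \<tau>(\<Phi>)) d\<Phi>\<close>\<close>

definition bitension :: "metric2 \<Rightarrow> (real^2 \<Rightarrow> minkowski) \<Rightarrow> real^2 \<Rightarrow> minkowski" where
  "bitension g \<Phi> p = - rough_laplacian g \<Phi> (tension g \<Phi>) p
     - (\<Sum>i\<in>UNIV. \<Sum>j\<in>UNIV. ginv g p i j *\<^sub>R
          curv_H3 (pd i \<Phi> p) (tension g \<Phi> p) (pd j \<Phi> p))"

definition biconservative_immersion :: "metric2 \<Rightarrow> (real^2 \<Rightarrow> minkowski) \<Rightarrow> bool" where
  "biconservative_immersion g \<Phi> \<longleftrightarrow> isometric_immersion g \<Phi> \<and>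
     (\<forall>p i. lor (bitension g \<Phi> p) (pd i \<Phi> p) = 0)"

definition unit_normal_field :: "(real^2 \<Rightarrow> minkowski) \<Rightarrow> (real^2 \<Rightarrow> minkowski) \<Rightarrow> bool" where
  "unit_normal_field \<Phi> \<eta> \<longleftrightarrow> smooth \<eta> \<and>
     (\<forall>p. lor (\<eta> p) (\<eta> p) = 1 \<and> lor (\<eta> p) (\<Phi> p) = 0 \<and> (\<forall>i. lor (\<eta> p) (pd i \<Phi> p) = 0))"

text \<open>The matrix, in the coordinate frame, of the shape operator \<open>A\<close> given by
  \<open>d\<Phi>(A X) = - \<nabla>\<^sub>X \<eta>\<close>. The mean curvature function is its trace, not half of it.\<close>

definition shape_operator ::
    "metric2 \<Rightarrow> (real^2 \<Rightarrow> minkowski) \<Rightarrow> (real^2 \<Rightarrow> minkowski) \<Rightarrow> real^2 \<Rightarrow> real^2^2" where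
  "shape_operator g \<Phi> \<eta> p =
     (\<chi> k i. - (\<Sum>l\<in>UNIV. ginv g p k l * lor (cov \<Phi> i \<eta> p) (pd l \<Phi> p)))"

definition mean_curvature ::
    "metric2 \<Rightarrow> (real^2 \<Rightarrow> minkowski) \<Rightarrow> (real^2 \<Rightarrow> minkowski) \<Rightarrow> real^2 \<Rightarrow> real" where
  "mean_curvature g \<Phi> \<eta> p = trace (shape_operator g \<Phi> \<eta> p)"


section \<open>The complete surface associated with a constant\<close>

definition T :: "real \<Rightarrow> real \<Rightarrow> real" where
  "T C \<xi> = - (\<xi> powr (8/3)) + C * \<xi>^2 + 3"

definition xi01 :: "real \<Rightarrow> real" where
  "xi01 C = (THE \<xi>. \<xi> > 0 \<and> T C \<xi> = 0)"

definition rho :: "real \<Rightarrow> real \<Rightarrow> real \<Rightarrow> real" where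
  "rho C \<xi>00 \<xi> = - (LBINT \<tau>=ereal \<xi>00..ereal \<xi>. sqrt (3 / (\<tau>^2 * T C \<tau>)))"

definition rho1 :: "real \<Rightarrow> real \<Rightarrow> real" where
  "rho1 C \<xi>00 = Lim (at_left (xi01 C)) (rho C \<xi>00)"

definition xi :: "real \<Rightarrow> real \<Rightarrow> real \<Rightarrow> real" where
  "xi C \<xi>00 = the_inv_into {0<..<xi01 C} (rho C \<xi>00)"

definition h :: "real \<Rightarrow> real \<Rightarrow> real \<Rightarrow> real" where
  "h C \<xi>00 \<omega> = 1 / xi C \<xi>00 (\<omega> + rho1 C \<xi>00)"

definition Gam :: "real \<Rightarrow> real \<Rightarrow> real \<Rightarrow> real" where
  "Gam C \<xi>00 \<omega> =
     (if \<omega> > 0 then h C \<xi>00 \<omega> else if \<omega> = 0 then 1 / xi01 C else h C \<xi>00 (- \<omega>))"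

text \<open>A point \<open>p\<close> of the plane has the coordinates \<open>\<omega> = p $ 1\<close> and \<open>\<theta> = p $ 2\<close>.\<close>

definition g_tilde :: "real \<Rightarrow> real \<Rightarrow> metric2" where
  "g_tilde C \<xi>00 p =
     (\<chi> i j. if i \<noteq> j then 0 else if i = 1 then 1 else (Gam C \<xi>00 (p $ 1))^2)"

end

theory Submission
  imports Defs
begin

text \<open>The function \<open>\<Gamma>\<close> solves \<open>\<Gamma>'' = \<Gamma> + \<Gamma>\<^bsup>-5/3\<^esup> / 9\<close>, \<open>\<Gamma>'(0) = 0\<close>, with first integral
  \<open>\<Gamma>'\<^sup>2 = \<Gamma>\<^sup>2 + C / 3 - \<Gamma>\<^bsup>-2/3\<^esup> / 3\<close>, so it is smooth and \<open>K = -1 - \<Gamma>\<^bsup>-8/3\<^esup> / 9\<close>. Where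
  \<open>grad f \<noteq> 0\<close>, the biconservative equation and the Gauss equation give \<open>f\<^sup>2 = 4/27 \<Gamma>\<^bsup>-8/3\<^esup>\<close> and the
  whole shape operator. On the half-plane \<open>\<omega> > 0\<close> this locus is open and closed; it is not empty, as
  a surface of constant mean curvature there would violate a Ricci-type condition. Hence the second
  fundamental form is determined up to sign, which yields uniqueness. For existence, the structure
  equations make \<open>\<partial>\<^sub>\<theta> e\<^sub>2\<close> independent of \<open>\<omega>\<close>, so they decouple into a linear differential
  equation in \<open>\<omega>\<close> and a one-parameter group in \<open>\<theta>\<close>.\<close>

section \<open>Partial derivatives on the coordinate plane\<close>

text \<open>The biconservative condition is void wherever grad f = 0, so no pointwise argument rules
  out critical points of f; this obstacle forces the open-closed argument and the separate exclusion
  of constant mean curvature. Where grad f \<noteq> 0 it is an eigenvector of A for -f/2, so the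
  other principal curvature is 3f/2 and det A = -3f^2/4. The Gauss equation gives det A = K + 1,
  whence the constant 4/27. The line \<omega> = 0 separates the two half-planes, and grad f does
  vanish on it. Identities cross it by continuity; f itself has no zeros, hence one sign on the
  whole plane, and the choice of the normal absorbs that sign. Fractional powers are avoided by
  carrying z = \<Gamma>^(-1/3) along: the derivatives of \<Gamma>, \<Gamma>' and z are polynomials
  in these three functions. The same data dictate the existence part: the principal curvatures are
  -f/2 and 3f/2 with f = 2/(3 sqrt 3) z^4, and the immersion is obtained by integrating the
  structure equations for them.\<close>

lemma pd_eqI:
  assumes "(F has_derivative F') (at p)"
  shows "pd i F p = F' (axis i 1)"
proof -
  have 1: "((\<lambda>t. p + t *\<^sub>R axis i (1::real)) has_derivative (\<lambda>t. t *\<^sub>R axis i 1)) (at 0)"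
    by (auto intro!: derivative_eq_intros)
  have "((\<lambda>t. F (p + t *\<^sub>R axis i 1)) has_derivative (\<lambda>t. F' (t *\<^sub>R axis i 1))) (at 0)"
    using has_derivative_compose[OF 1, of F F'] assms by simp
  then have "((\<lambda>t. F (p + t *\<^sub>R axis i 1)) has_vector_derivative F' (axis i 1)) (at 0)"
    unfolding has_vector_derivative_def
    using linear_scale[OF has_derivative_linear[OF assms]] by simp
  then show ?thesis
    unfolding pd_def by (rule vector_derivative_at)
qed

lemma has_derivative_pd_sum:
  assumes "F differentiable at p"
  shows "(F has_derivative (\<lambda>v. v $ 1 *\<^sub>R pd 1 F p + v $ 2 *\<^sub>R pd 2 F p)) (at p)"
proof -
  obtain F' where F': "(F has_derivative F') (at p)"
    using assms by (auto simp: differentiable_def)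
  have "F' v = v $ 1 *\<^sub>R pd 1 F p + v $ 2 *\<^sub>R pd 2 F p" for v
  proof -
    have "v = v $ 1 *\<^sub>R axis 1 1 + v $ 2 *\<^sub>R axis 2 1"
      by (simp add: vec_eq_iff forall_2 axis_def)
    then have "F' v = F' (v $ 1 *\<^sub>R axis 1 1 + v $ 2 *\<^sub>R axis 2 1)"
      by simp
    also have "\<dots> = v $ 1 *\<^sub>R F' (axis 1 1) + v $ 2 *\<^sub>R F' (axis 2 1)"
      using has_derivative_linear[OF F'] by (simp add: linear_add linear_scale)
    finally show ?thesis
      by (simp add: pd_eqI[OF F'])
  qed
  then have "F' = (\<lambda>v. v $ 1 *\<^sub>R pd 1 F p + v $ 2 *\<^sub>R pd 2 F p)"
    by (rule ext)
  with F' show ?thesis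
    by simp
qed

section \<open>Differentiation rules for partial derivatives\<close>

lemma pd_const [simp]: "pd i (\<lambda>p. c) = (\<lambda>p. 0)"
  by (rule ext, subst pd_eqI[OF has_derivative_const]) simp

lemma pd_linear:
  assumes "bounded_linear L" "F differentiable at p"
  shows "pd i (\<lambda>p. L (F p)) p = L (pd i F p)"
proof -
  obtain F' where F': "(F has_derivative F') (at p)"
    using assms(2) by (auto simp: differentiable_def)
  show ?thesis
    by (simp add: pd_eqI[OF bounded_linear.has_derivative[OF assms(1) F']] pd_eqI[OF F'])
qed

lemma pd_bilinear:
  assumes "bounded_bilinear B" "F differentiable at p" "G differentiable at p"
  shows "pd i (\<lambda>p. B (F p) (G p)) p = B (pd i F p) (G p) + B (F p) (pd i G p)"
proof -
  obtain F' where F': "(F has_derivative F') (at p)"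
    using assms(2) by (auto simp: differentiable_def)
  obtain G' where G': "(G has_derivative G') (at p)"
    using assms(3) by (auto simp: differentiable_def)
  show ?thesis
    by (simp add: pd_eqI[OF bounded_bilinear.FDERIV[OF assms(1) F' G']] pd_eqI[OF F'] pd_eqI[OF G'])
qed

lemma pd_add:
  assumes "F differentiable at p" "G differentiable at p"
  shows "pd i (\<lambda>p. F p + G p) p = pd i F p + pd i G p"
proof -
  obtain F' where F': "(F has_derivative F') (at p)"
    using assms(1) by (auto simp: differentiable_def)
  obtain G' where G': "(G has_derivative G') (at p)"
    using assms(2) by (auto simp: differentiable_def)
  show ?thesis
    by (simp add: pd_eqI[OF has_derivative_add[OF F' G']] pd_eqI[OF F'] pd_eqI[OF G'])
qed

lemma pd_diff:
  assumes "F differentiable at p" "G differentiable at p"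
  shows "pd i (\<lambda>p. F p - G p) p = pd i F p - pd i G p"
proof -
  obtain F' where F': "(F has_derivative F') (at p)"
    using assms(1) by (auto simp: differentiable_def)
  obtain G' where G': "(G has_derivative G') (at p)"
    using assms(2) by (auto simp: differentiable_def)
  show ?thesis
    by (simp add: pd_eqI[OF has_derivative_diff[OF F' G']] pd_eqI[OF F'] pd_eqI[OF G'])
qed

lemmas pd_mult = pd_bilinear[OF bounded_bilinear_mult]
lemmas pd_scaleR = pd_bilinear[OF bounded_bilinear_scaleR]
lemmas pd_minus = pd_linear[OF bounded_linear_minus[OF bounded_linear_ident]]

lemma has_derivative_coord:
  assumes "(g has_vector_derivative g') (at (p $ j))"
  shows "((\<lambda>p::real^'n. g (p $ j)) has_derivative (\<lambda>v. v $ j *\<^sub>R g')) (at p)"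
proof -
  have "((\<lambda>p::real^'n. p $ j) has_derivative (\<lambda>v. v $ j)) (at p)"
    by (rule bounded_linear_imp_has_derivative[OF bounded_linear_vec_nth])
  from has_derivative_compose[OF this, of g "\<lambda>x. x *\<^sub>R g'"] assms
  show ?thesis
    by (simp add: has_vector_derivative_def)
qed

lemma pd_coord:
  assumes "\<And>x. (g has_vector_derivative g' x) (at x)"
  shows "pd i (\<lambda>p. g (p $ j)) = (\<lambda>p. if i = j then g' (p $ j) else 0)"
  by (rule ext) (auto simp: pd_eqI[OF has_derivative_coord[OF assms]] axis_def)

lemma differentiable_coord:
  assumes "\<And>x. (g has_vector_derivative g' x) (at x)"
  shows "(\<lambda>p::real^2. g (p $ j)) differentiable at p"
  using has_derivative_coord[OF assms] by (auto simp: differentiable_def)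

section \<open>Closure properties of smooth maps\<close>

lemma C_class_Suc_imp: "C_class (Suc k) F \<Longrightarrow> C_class k F"
proof (induction k arbitrary: F)
  case 0
  then show ?case
    by (auto simp: continuous_on_eq_continuous_at differentiable_imp_continuous_within)
next
  case (Suc k)
  then show ?case
    by (metis C_class.simps(2))
qed

lemma C_class_const: "C_class k (\<lambda>p. c)"
  by (induction k arbitrary: c) auto

lemma C_class_linear:
  assumes "bounded_linear L"
  shows "C_class k F \<Longrightarrow> C_class k (\<lambda>p. L (F p))"
proof (induction k arbitrary: F)
  case 0
  then show ?case
    using bounded_linear.continuous_on[OF assms] by auto
next
  case (Suc k)
  then have d: "F differentiable at p" for p
    by simp
  have "pd i (\<lambda>p. L (F p)) = (\<lambda>p. L (pd i F p))" for i
    by (rule ext) (rule pd_linear[OF assms d])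
  moreover have "(\<lambda>p. L (F p)) differentiable at p" for p
    using bounded_linear.has_derivative[OF assms] d[of p] unfolding differentiable_def by blast
  ultimately show ?case
    using Suc by auto
qed

lemma C_class_add:
  "C_class k F \<Longrightarrow> C_class k G \<Longrightarrow> C_class k (\<lambda>p. F p + G p)"
proof (induction k arbitrary: F G)
  case 0
  then show ?case
    by (auto intro: continuous_intros)
next
  case (Suc k)
  then have d: "F differentiable at p" "G differentiable at p" for p
    by auto
  have "pd i (\<lambda>p. F p + G p) = (\<lambda>p. pd i F p + pd i G p)" for i
    by (rule ext) (rule pd_add[OF d])
  then show ?case
    using Suc by (auto intro: differentiable_add)
qed

text \<open>The product rule for a bounded bilinear map reproduces the same map, so a single
  induction serves multiplication, scaling, inner and cross products and \<open>lor\<close>.\<close>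

lemma C_class_bilinear:
  assumes "bounded_bilinear B"
  shows "C_class k F \<Longrightarrow> C_class k G \<Longrightarrow> C_class k (\<lambda>p. B (F p) (G p))"
proof (induction k arbitrary: F G)
  case 0
  then show ?case
    using bounded_bilinear.continuous_on[OF assms] by auto
next
  case (Suc k)
  then have d: "F differentiable at p" "G differentiable at p" for p
    by auto
  have "pd i (\<lambda>p. B (F p) (G p)) = (\<lambda>p. B (pd i F p) (G p) + B (F p) (pd i G p))" for i
    by (rule ext) (rule pd_bilinear[OF assms d])
  moreover have "(\<lambda>p. B (F p) (G p)) differentiable at p" for p
    using bounded_bilinear.FDERIV[OF assms] d[of p] unfolding differentiable_def by blast
  \<comment> \<open>Each term of the product rule keeps one undifferentiated factor, which must be
    lowered to class \<open>k\<close> for the induction hypothesis.\<close>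
  moreover have "C_class k F" "C_class k G"
    using Suc.prems by (auto intro: C_class_Suc_imp)
  ultimately show ?case
    using Suc by (auto intro!: C_class_add)
qed

lemma smooth_pd: "smooth F \<Longrightarrow> smooth (pd i F)"
  unfolding smooth_def by (metis C_class.simps(2))

lemma smooth_differentiable: "smooth F \<Longrightarrow> F differentiable at p"
  unfolding smooth_def by (metis C_class.simps(2))

lemma smooth_continuous_on: "smooth F \<Longrightarrow> continuous_on S F"
  unfolding smooth_def by (metis C_class.simps(1) continuous_on_subset subset_UNIV)

lemma smooth_const: "smooth (\<lambda>p. c)"
  by (simp add: smooth_def C_class_const)

lemma smooth_linear: "bounded_linear L \<Longrightarrow> smooth F \<Longrightarrow> smooth (\<lambda>p. L (F p))"
  by (simp add: smooth_def C_class_linear)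

lemma smooth_bilinear:
  "bounded_bilinear B \<Longrightarrow> smooth F \<Longrightarrow> smooth G \<Longrightarrow> smooth (\<lambda>p. B (F p) (G p))"
  by (simp add: smooth_def C_class_bilinear)

lemma smooth_add: "smooth F \<Longrightarrow> smooth G \<Longrightarrow> smooth (\<lambda>p. F p + G p)"
  by (simp add: smooth_def C_class_add)

lemmas C_class_mult = C_class_bilinear[OF bounded_bilinear_mult]
lemmas C_class_scaleR = C_class_bilinear[OF bounded_bilinear_scaleR]
lemmas C_class_minus = C_class_linear[OF bounded_linear_minus[OF bounded_linear_ident]]
lemmas smooth_mult = smooth_bilinear[OF bounded_bilinear_mult]
lemmas smooth_scaleR = smooth_bilinear[OF bounded_bilinear_scaleR]
lemmas smooth_minus = smooth_linear[OF bounded_linear_minus[OF bounded_linear_ident]]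

lemma C_class_power:
  fixes F :: "real^2 \<Rightarrow> real"
  shows "C_class k F \<Longrightarrow> C_class k (\<lambda>p. F p ^ n)"
  by (induction n) (auto intro: C_class_const C_class_mult)

lemma C_class_diff:
  "C_class k F \<Longrightarrow> C_class k G \<Longrightarrow> C_class k (\<lambda>p. F p - G p)"
  using C_class_add[OF _ C_class_minus, of k F G] by simp

lemma smooth_power:
  fixes F :: "real^2 \<Rightarrow> real"
  shows "smooth F \<Longrightarrow> smooth (\<lambda>p. F p ^ n)"
  by (simp add: smooth_def C_class_power)

lemma smooth_diff: "smooth F \<Longrightarrow> smooth G \<Longrightarrow> smooth (\<lambda>p. F p - G p)"
  by (simp add: smooth_def C_class_diff)

lemma bounded_bilinear_lor: "bounded_bilinear lor"
proof -
  have "bounded_bilinear (\<lambda>(x::minkowski) (y::minkowski). snd x \<bullet> snd y)"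
    by (rule bounded_bilinear.comp[OF bounded_bilinear_inner bounded_linear_snd bounded_linear_snd])
  moreover have "bounded_bilinear (\<lambda>(x::minkowski) (y::minkowski). fst x * fst y)"
    by (rule bounded_bilinear.comp[OF bounded_bilinear_mult bounded_linear_fst bounded_linear_fst])
  ultimately interpret a: bounded_bilinear "\<lambda>(x::minkowski) (y::minkowski). snd x \<bullet> snd y"
    + b: bounded_bilinear "\<lambda>(x::minkowski) (y::minkowski). fst x * fst y" .
  show ?thesis
    unfolding lor_def[abs_def]
  proof
    fix x x' y y' :: minkowski and r :: real
    show "snd (x + x') \<bullet> snd y - fst (x + x') * fst y
      = snd x \<bullet> snd y - fst x * fst y + (snd x' \<bullet> snd y - fst x' * fst y)"
      by (simp add: algebra_simps)
    show "snd x \<bullet> snd (y + y') - fst x * fst (y + y')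
      = snd x \<bullet> snd y - fst x * fst y + (snd x \<bullet> snd y' - fst x * fst y')"
      by (simp add: algebra_simps)
    show "snd (r *\<^sub>R x) \<bullet> snd y - fst (r *\<^sub>R x) * fst y = r *\<^sub>R (snd x \<bullet> snd y - fst x * fst y)"
      by (simp add: algebra_simps)
    show "snd x \<bullet> snd (r *\<^sub>R y) - fst x * fst (r *\<^sub>R y) = r *\<^sub>R (snd x \<bullet> snd y - fst x * fst y)"
      by (simp add: algebra_simps)
    obtain K where K: "\<And>(x::minkowski) (y::minkowski). norm (snd x \<bullet> snd y) \<le> norm x * norm y * K"
      using a.bounded by blast
    obtain M where M: "\<And>(x::minkowski) (y::minkowski). norm (fst x * fst y) \<le> norm x * norm y * M"
      using b.bounded by blast
    show "\<exists>K. \<forall>(x::minkowski) (y::minkowski). norm (snd x \<bullet> snd y - fst x * fst y) \<le> norm x * norm y * K"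
    proof (intro exI allI)
      fix x y :: minkowski
      show "norm (snd x \<bullet> snd y - fst x * fst y) \<le> norm x * norm y * (K + M)"
        using K[of x y] M[of x y] norm_triangle_ineq4[of "snd x \<bullet> snd y" "fst x * fst y"]
        by (simp add: algebra_simps)
    qed
  qed
qed

interpretation lor: bounded_bilinear lor
  by (rule bounded_bilinear_lor)

lemma lor_commute: "lor x y = lor y x"
  by (simp add: lor_def inner_commute mult.commute)

lemmas pd_lor = pd_bilinear[OF bounded_bilinear_lor]
lemmas smooth_lor = smooth_bilinear[OF bounded_bilinear_lor]

section \<open>Symmetry of mixed partial derivatives\<close>

lemma DERIV_pd_line:
  fixes F :: "real^2 \<Rightarrow> real"
  assumes "\<And>p. F differentiable at p"
  shows "((\<lambda>t. F (p + t *\<^sub>R axis i 1)) has_real_derivative pd i F (p + t *\<^sub>R axis i 1)) (at t)"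
proof -
  have 1: "((\<lambda>t. p + t *\<^sub>R axis i (1::real)) has_derivative (\<lambda>t. t *\<^sub>R axis i 1)) (at t)"
    by (auto intro!: derivative_eq_intros)
  have "((\<lambda>t. F (p + t *\<^sub>R axis i 1)) has_derivative
     (\<lambda>s. (s *\<^sub>R axis i 1 :: real^2) $ 1 *\<^sub>R pd 1 F (p + t *\<^sub>R axis i 1)
        + (s *\<^sub>R axis i 1 :: real^2) $ 2 *\<^sub>R pd 2 F (p + t *\<^sub>R axis i 1))) (at t)"
    by (rule has_derivative_compose[OF 1 has_derivative_pd_sum[OF assms]])
  moreover have "(\<lambda>s. (s *\<^sub>R axis i 1 :: real^2) $ 1 *\<^sub>R pd 1 F (p + t *\<^sub>R axis i 1)
        + (s *\<^sub>R axis i 1 :: real^2) $ 2 *\<^sub>R pd 2 F (p + t *\<^sub>R axis i 1))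
     = (\<lambda>s. s * pd i F (p + t *\<^sub>R axis i 1))"
    using exhaust_2[of i] by (auto simp: axis_def fun_eq_iff)
  ultimately show ?thesis
    by (simp add: has_field_derivative_def mult.commute[of _ "pd i F _"])
qed

text \<open>Two applications of the mean value theorem, first in direction \<open>i\<close>, then in
  direction \<open>j\<close>. The second difference is symmetric in \<open>i\<close> and
  \<open>j\<close>, so exchanging them represents the same number by the other mixed
  derivative.\<close>

lemma second_difference_mvt:
  fixes F :: "real^2 \<Rightarrow> real"
  assumes d: "\<And>p. F differentiable at p" and d2: "\<And>p. pd i F differentiable at p" and t: "t > 0"
  shows "\<exists>u v. 0 < u \<and> u < t \<and> 0 < v \<and> v < t \<and>
    F (p + t *\<^sub>R axis i 1 + t *\<^sub>R axis j 1) - F (p + t *\<^sub>R axis i 1) - F (p + t *\<^sub>R axis j 1) + F p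
      = t * t * pd j (pd i F) (p + u *\<^sub>R axis i 1 + v *\<^sub>R axis j 1)"
proof -
  define \<phi> where "\<phi> s = F ((p + t *\<^sub>R axis j 1) + s *\<^sub>R axis i 1) - F (p + s *\<^sub>R axis i 1)" for s
  have "\<exists>u. 0 < u \<and> u < t \<and> \<phi> t - \<phi> 0 =
      (t - 0) * (pd i F ((p + t *\<^sub>R axis j 1) + u *\<^sub>R axis i 1) - pd i F (p + u *\<^sub>R axis i 1))"
    unfolding \<phi>_def
    by (rule MVT2[OF t]) (intro DERIV_diff DERIV_pd_line d)
  then obtain u where u: "0 < u" "u < t" "\<phi> t - \<phi> 0 =
      t * (pd i F ((p + t *\<^sub>R axis j 1) + u *\<^sub>R axis i 1) - pd i F (p + u *\<^sub>R axis i 1))"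
    by auto
  have "\<exists>v. 0 < v \<and> v < t \<and>
    pd i F ((p + u *\<^sub>R axis i 1) + t *\<^sub>R axis j 1) - pd i F ((p + u *\<^sub>R axis i 1) + 0 *\<^sub>R axis j 1)
      = (t - 0) * pd j (pd i F) ((p + u *\<^sub>R axis i 1) + v *\<^sub>R axis j 1)"
    by (rule MVT2[OF t]) (intro DERIV_pd_line d2)
  then obtain v where v: "0 < v" "v < t"
    "pd i F ((p + u *\<^sub>R axis i 1) + t *\<^sub>R axis j 1) - pd i F (p + u *\<^sub>R axis i 1)
      = t * pd j (pd i F) ((p + u *\<^sub>R axis i 1) + v *\<^sub>R axis j 1)"
    by auto
  have "\<phi> t - \<phi> 0 = t * (t * pd j (pd i F) ((p + u *\<^sub>R axis i 1) + v *\<^sub>R axis j 1))"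
    using u(3) v(3) by (simp add: add.assoc add.commute add.left_commute)
  then show ?thesis
    using u v unfolding \<phi>_def
    by (intro exI[of _ u] exI[of _ v]) (simp add: algebra_simps)
qed

lemma pd_commute_real:
  fixes F :: "real^2 \<Rightarrow> real"
  assumes "smooth F"
  shows "pd i (pd j F) p = pd j (pd i F) p"
proof (rule ccontr)
  assume ne: "pd i (pd j F) p \<noteq> pd j (pd i F) p"
  \<comment> \<open>Half the gap: values within \<open>e\<close> of the two distinct derivatives
    cannot coincide.\<close>
  define e where "e = dist (pd i (pd j F) p) (pd j (pd i F) p) / 2"
  have e: "e > 0"
    using ne by (simp add: e_def)
  have c: "\<exists>d>0. \<forall>x. dist x p < d \<longrightarrow> dist (pd k (pd l F) x) (pd k (pd l F) p) < e" for k l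
    using smooth_continuous_on[OF smooth_pd[OF smooth_pd[OF assms]], of UNIV k l] e
    unfolding continuous_on_iff by auto
  obtain d1 where d1: "d1 > 0"
    "\<And>x. dist x p < d1 \<Longrightarrow> dist (pd i (pd j F) x) (pd i (pd j F) p) < e"
    using c by blast
  obtain d2 where d2: "d2 > 0"
    "\<And>x. dist x p < d2 \<Longrightarrow> dist (pd j (pd i F) x) (pd j (pd i F) p) < e"
    using c by blast
  \<comment> \<open>The intermediate points are two axis steps shorter than \<open>t\<close> away
    from \<open>p\<close>, so a distance of \<open>2 * t\<close> has to fit into both balls.\<close>
  define t where "t = min d1 d2 / 3"
  have t: "t > 0" "2 * t < d1" "2 * t < d2"
    using d1(1) d2(1) by (auto simp: t_def)
  have n: "dist (p + u *\<^sub>R axis k 1 + v *\<^sub>R axis l 1) p < 2 * t"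
    if "0 < u" "u < t" "0 < v" "v < t" for u v and k l :: 2
  proof -
    have "norm (u *\<^sub>R axis k (1::real) + v *\<^sub>R axis l 1) \<le> \<bar>u\<bar> + \<bar>v\<bar>"
      using norm_triangle_ineq[of "u *\<^sub>R axis k (1::real)" "v *\<^sub>R axis l 1"] by simp
    then show ?thesis
      using that by (simp add: dist_norm add.assoc)
  qed
  note sd = smooth_differentiable[OF assms] smooth_differentiable[OF smooth_pd[OF assms]]
  obtain u v where 1: "0 < u" "u < t" "0 < v" "v < t"
    "F (p + t *\<^sub>R axis i 1 + t *\<^sub>R axis j 1) - F (p + t *\<^sub>R axis i 1) - F (p + t *\<^sub>R axis j 1) + F p
      = t * t * pd j (pd i F) (p + u *\<^sub>R axis i 1 + v *\<^sub>R axis j 1)"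
    using second_difference_mvt[OF sd t(1), of p i j] by blast
  obtain u' v' where 2: "0 < u'" "u' < t" "0 < v'" "v' < t"
    "F (p + t *\<^sub>R axis j 1 + t *\<^sub>R axis i 1) - F (p + t *\<^sub>R axis j 1) - F (p + t *\<^sub>R axis i 1) + F p
      = t * t * pd i (pd j F) (p + u' *\<^sub>R axis j 1 + v' *\<^sub>R axis i 1)"
    using second_difference_mvt[OF sd t(1), of p j i] by blast
  have "p + t *\<^sub>R axis j 1 + t *\<^sub>R axis i 1 = p + t *\<^sub>R axis i 1 + t *\<^sub>R axis j 1"
    by (simp add: algebra_simps)
  from 2(5)[unfolded this] 1(5) have "t * t * pd i (pd j F) (p + u' *\<^sub>R axis j 1 + v' *\<^sub>R axis i 1)
      = t * t * pd j (pd i F) (p + u *\<^sub>R axis i 1 + v *\<^sub>R axis j 1)"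
    by linarith
  then have eq: "pd i (pd j F) (p + u' *\<^sub>R axis j 1 + v' *\<^sub>R axis i 1)
      = pd j (pd i F) (p + u *\<^sub>R axis i 1 + v *\<^sub>R axis j 1)"
    using t(1) by simp
  have "dist (pd j (pd i F) (p + u *\<^sub>R axis i 1 + v *\<^sub>R axis j 1)) (pd j (pd i F) p) < e"
    by (rule d2(2)) (rule less_trans[OF n[OF 1(1-4)] t(3)])
  moreover have "dist (pd i (pd j F) (p + u' *\<^sub>R axis j 1 + v' *\<^sub>R axis i 1)) (pd i (pd j F) p) < e"
    by (rule d1(2)) (rule less_trans[OF n[OF 2(1-4)] t(2)])
  ultimately show False
    using eq unfolding e_def dist_real_def by (simp add: abs_if split: if_splits)
qed

lemma pd_commute:
  fixes F :: "real^2 \<Rightarrow> 'a::euclidean_space"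
  assumes "smooth F"
  shows "pd i (pd j F) = pd j (pd i F)"
proof (rule ext, rule euclidean_eqI)
  fix p and b :: 'a
  have bl: "bounded_linear (\<lambda>x::'a. x \<bullet> b)"
    by (rule bounded_linear_inner_left)
  note sd = smooth_differentiable[OF assms] smooth_differentiable[OF smooth_pd[OF assms]]
  have 1: "pd k (\<lambda>p. F p \<bullet> b) = (\<lambda>p. pd k F p \<bullet> b)" for k
    by (rule ext) (rule pd_linear[OF bl sd(1)])
  have 2: "pd l (\<lambda>p. pd k F p \<bullet> b) = (\<lambda>p. pd l (pd k F) p \<bullet> b)" for k l
    by (rule ext) (rule pd_linear[OF bl sd(2)])
  from pd_commute_real[OF smooth_linear[OF bl assms], of i j p]
  show "pd i (pd j F) p \<bullet> b = pd j (pd i F) p \<bullet> b"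
    by (simp add: 1 2)
qed

section \<open>Warped metrics and the fundamental equations of a surface\<close>

lemma matrix_inv_eqI:
  fixes A :: "'a::semiring_1^'n^'n"
  assumes "A ** B = mat 1" "B ** A = mat 1"
  shows "matrix_inv A = B"
proof -
  have "A ** matrix_inv A = mat 1 \<and> matrix_inv A ** A = mat 1"
    unfolding matrix_inv_def by (rule someI[of _ B]) (simp add: assms)
  then have "matrix_inv A ** (A ** B) = B"
    by (simp add: matrix_mul_assoc matrix_mul_lid)
  then show ?thesis
    using assms by (simp add: matrix_mul_rid)
qed

text \<open>Here \<open>z\<close> is \<open>G\<close> to the power -1/3, encoded by
  \<open>G_z\<close> and \<open>z_pos\<close> instead of a real power. The derivatives of
  \<open>G\<close>, \<open>G1\<close>, \<open>z\<close> are then polynomials in these functions, and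
  the identities that follow become rational identities in \<open>z\<close> and
  \<open>G1\<close>.\<close>

locale warp_profile =
  fixes C :: real and G G1 z :: "real \<Rightarrow> real"
  assumes DERIV_G: "(G has_real_derivative G1 w) (at w)"
    and DERIV_G1: "(G1 has_real_derivative G w + z w ^ 5 / 9) (at w)"
    and DERIV_z: "(z has_real_derivative - (z w ^ 4 * G1 w / 3)) (at w)"
    and G_z: "G w * z w ^ 3 = 1"
    and z_pos: "0 < z w"
    and G1_sq: "(G1 w)\<^sup>2 = (G w)\<^sup>2 + C / 3 - (z w)\<^sup>2 / 3"
    and G1_0: "G1 0 = 0"
    and G1_sgn: "w \<noteq> 0 \<Longrightarrow> 0 < w * G1 w"
begin

definition warped_metric :: metric2 where
  "warped_metric p = (\<chi> i j. if i \<noteq> j then 0 else if i = 1 then 1 else (G (p $ 1))\<^sup>2)"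

abbreviation "Gp p \<equiv> G ((p::real^2) $ 1)"
abbreviation "G1p p \<equiv> G1 ((p::real^2) $ 1)"
abbreviation "zp p \<equiv> z ((p::real^2) $ 1)"

lemmas vderivs = DERIV_G[THEN has_real_derivative_iff_has_vector_derivative[THEN iffD1]]
  DERIV_G1[THEN has_real_derivative_iff_has_vector_derivative[THEN iffD1]]
  DERIV_z[THEN has_real_derivative_iff_has_vector_derivative[THEN iffD1]]

lemma pd_profile:
  "pd i Gp = (\<lambda>p. if i = 1 then G1p p else 0)"
  "pd i G1p = (\<lambda>p. if i = 1 then Gp p + zp p ^ 5 / 9 else 0)"
  "pd i zp = (\<lambda>p. if i = 1 then - (zp p ^ 4 * G1p p / 3) else 0)"
  by (simp_all add: pd_coord[OF vderivs(1)] pd_coord[OF vderivs(2)] pd_coord[OF vderivs(3)])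

text \<open>Simultaneous induction: the three derivatives are polynomials in the same three
  functions, so each differentiation leads back to the hypothesis. This is why a profile glued at
  \<omega> = 0 is smooth there.\<close>

lemma C_class_profile: "C_class k Gp \<and> C_class k G1p \<and> C_class k zp"
proof (induction k)
  case 0
  have "continuous_on UNIV (\<lambda>p::real^2. f (p $ 1))" if "\<And>w. (f has_vector_derivative f' w) (at w)"
    for f f' :: "real \<Rightarrow> real"
    using differentiable_coord[OF that]
    by (auto simp: continuous_on_eq_continuous_at intro: differentiable_imp_continuous_within)
  from this[OF vderivs(1)] this[OF vderivs(2)] this[OF vderivs(3)] show ?case
    by simp
next
  case (Suc k)
  have c: "C_class k Gp" "C_class k G1p" "C_class k zp"
    using Suc by auto
  have "C_class k (\<lambda>p. Gp p + (1 / 9) * zp p ^ 5)"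
    by (intro C_class_add C_class_mult C_class_power C_class_const c)
  moreover have "C_class k (\<lambda>p. - ((1 / 3) * (zp p ^ 4 * G1p p)))"
    by (intro C_class_minus C_class_mult C_class_power C_class_const c)
  ultimately show ?case
    using differentiable_coord[OF vderivs(1), of 1] differentiable_coord[OF vderivs(2), of 1]
      differentiable_coord[OF vderivs(3), of 1] c C_class_const[of k "0::real"]
    by (auto simp: pd_profile forall_2)
qed

lemma smooth_profile: "smooth Gp" "smooth G1p" "smooth zp"
  using C_class_profile by (auto simp: smooth_def)

lemma z_ne: "z w \<noteq> 0"
  using z_pos[of w] by simp

lemma G_eq: "G w = 1 / z w ^ 3"
  using G_z[of w] z_ne[of w] by (simp add: field_simps)

lemma G_pos: "0 < G w"
  using z_pos[of w] by (simp add: G_eq)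

lemma ginv_warped_metric: "ginv warped_metric p i j = (if i \<noteq> j then 0 else if i = 1 then 1 else zp p ^ 6)"
proof -
  define B :: "real^2^2" where "B = (\<chi> i j. if i \<noteq> j then 0 else if i = 1 then 1 else zp p ^ 6)"
  have s: "(Gp p)\<^sup>2 * zp p ^ 6 = 1"
    using z_ne[of "p $ 1"] by (simp add: G_eq field_simps flip: power_mult)
  have "warped_metric p ** B = mat 1" "B ** warped_metric p = mat 1"
    using s by (simp_all add: matrix_matrix_mult_def warped_metric_def B_def vec_eq_iff forall_2 sum_2 mat_def mult.commute)
  then have "matrix_inv (warped_metric p) = B"
    by (rule matrix_inv_eqI)
  then show ?thesis
    by (simp add: ginv_def B_def)
qed

lemma pd_warped_metric:
  "pd i (\<lambda>q. warped_metric q $ j $ l) p = (if i = 1 \<and> j = 2 \<and> l = 2 then 2 * Gp p * G1p p else 0)"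
proof -
  have 1: "(\<lambda>q. warped_metric q $ j $ l) = (if j = 2 \<and> l = 2 then (\<lambda>q. Gp q * Gp q) else (\<lambda>q. if j = l then 1 else 0))"
    using exhaust_2[of j] exhaust_2[of l] by (auto simp: warped_metric_def fun_eq_iff power2_eq_square)
  have "pd i (\<lambda>q. Gp q * Gp q) p = pd i Gp p * Gp p + Gp p * pd i Gp p"
    by (intro pd_mult smooth_differentiable smooth_profile)
  then show ?thesis
    unfolding 1 by (auto simp: pd_profile forall_2)
qed

text \<open>The nonzero symbols are -\<Gamma> \<Gamma>' and the logarithmic derivative
  \<Gamma>'/\<Gamma>, which reads \<open>zp p ^ 3 * G1p p\<close>.\<close>

lemma christoffel_warped_metric:
  "christoffel warped_metric p 1 1 1 = 0" "christoffel warped_metric p 1 1 2 = 0" "christoffel warped_metric p 1 2 1 = 0"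
  "christoffel warped_metric p 1 2 2 = - Gp p * G1p p" "christoffel warped_metric p 2 1 1 = 0"
  "christoffel warped_metric p 2 1 2 = zp p ^ 3 * G1p p" "christoffel warped_metric p 2 2 1 = zp p ^ 3 * G1p p"
  "christoffel warped_metric p 2 2 2 = 0"
  using z_ne[of "p $ 1"] by (simp_all add: christoffel_def sum_2 ginv_warped_metric pd_warped_metric G_eq field_simps flip: power_add)

end

section \<open>Orthonormal frames of Minkowski space\<close>

lemmas lor_simps = lor.add_left lor.add_right lor.diff_left lor.diff_right lor.minus_left
  lor.minus_right lor.scaleR_left lor.scaleR_right

text \<open>The remainder of \<open>v\<close> is orthogonal to all four vectors. If it were nonzero,
  the five vectors would be independent, since pairing a linear relation with \<open>a\<close>,
  \<open>b\<close>, \<open>c\<close>, \<open>d\<close> kills the first four coefficients; but the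
  space has dimension four.\<close>

lemma lor_frame_expansion:
  assumes "lor a a = -1" "lor b b = 1" "lor c c = 1" "lor d d = 1"
    and "lor a b = 0" "lor a c = 0" "lor a d = 0" "lor b c = 0" "lor b d = 0" "lor c d = 0"
  shows "v = - lor v a *\<^sub>R a + lor v b *\<^sub>R b + lor v c *\<^sub>R c + lor v d *\<^sub>R d"
proof -
  define w where "w = v - (- lor v a *\<^sub>R a + lor v b *\<^sub>R b + lor v c *\<^sub>R c + lor v d *\<^sub>R d)"
  have wo: "lor w a = 0" "lor w b = 0" "lor w c = 0" "lor w d = 0"
    unfolding w_def using assms
    by (simp_all add: lor.add_left lor.diff_left lor.scaleR_left lor.minus_left lor_commute[of b a]
      lor_commute[of c a] lor_commute[of c b] lor_commute[of d a] lor_commute[of d b] lor_commute[of d c])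
  define f :: "real \<times> real \<times> real \<times> real \<times> real \<Rightarrow> minkowski" where
    "f = (\<lambda>(s, t, x, y, u). s *\<^sub>R a + t *\<^sub>R b + x *\<^sub>R c + y *\<^sub>R d + u *\<^sub>R w)"
  have f: "f (s, t, x, y, u) = s *\<^sub>R a + t *\<^sub>R b + x *\<^sub>R c + y *\<^sub>R d + u *\<^sub>R w" for s t x y u
    by (simp add: f_def)
  have lin: "linear f"
    by (rule linearI) (auto simp: f_def algebra_simps split: prod.splits)
  have "w = 0"
  proof (rule ccontr)
    assume w: "w \<noteq> 0"
    have "x = 0" if "f x = 0" for x
    proof -
      obtain s t x1 y u where x: "x = (s, t, x1, y, u)"
        by (cases x) auto
      have 0: "lor (f x) e = 0" for e
        using that by (simp add: lor.zero_left)
      have "s = 0" "t = 0" "x1 = 0" "y = 0"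
        using 0[of a] 0[of b] 0[of c] 0[of d] assms wo
        by (simp_all add: x f lor.add_left lor.scaleR_left lor_commute[of b a]
      lor_commute[of c a] lor_commute[of c b] lor_commute[of d a] lor_commute[of d b] lor_commute[of d c])
      moreover from this have "u = 0"
        using that w by (simp add: x f)
      ultimately show ?thesis
        by (simp add: x zero_prod_def)
    qed
    then have "inj f"
      using lin by (simp add: linear_injective_0)
    then have "dim (f ` UNIV) = dim (UNIV :: (real \<times> real \<times> real \<times> real \<times> real) set)"
      using lin by (intro dim_image_eq) (auto intro: inj_on_subset)
    moreover have "dim (f ` UNIV) \<le> DIM(minkowski)"
      by (rule dim_subset_UNIV)
    ultimately show False
      by simp
  qed
  then show ?thesis
    by (simp add: w_def)
qed

text \<open>Differentiating a known inner product trades a derivative of one factor for a derivative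
  of the other. The structure equations rest on this.\<close>

lemma lor_pd_left:
  assumes "smooth F" "smooth H" "(\<lambda>p. lor (F p) (H p)) = k"
  shows "lor (pd i F p) (H p) = pd i k p - lor (F p) (pd i H p)"
  using pd_lor[OF smooth_differentiable[OF assms(1)] smooth_differentiable[OF assms(2)], of i p] assms(3)
  by simp

section \<open>Structure equations of an immersed surface\<close>

locale immersed_profile = warp_profile +
  fixes \<Phi> \<eta> :: "real^2 \<Rightarrow> minkowski"
  assumes isometric: "isometric_immersion warped_metric \<Phi>"
    and normal: "unit_normal_field \<Phi> \<eta>"
begin

text \<open>The flat second derivative suffices: the corrections in the covariant one are multiples
  of \<open>\<Phi>\<close> and of the \<open>pd k \<Phi>\<close>, all orthogonal to
  \<open>\<eta>\<close>.\<close>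

definition second_form :: "2 \<Rightarrow> 2 \<Rightarrow> real^2 \<Rightarrow> real" where
  "second_form i j p = lor (pd i (pd j \<Phi>) p) (\<eta> p)"

definition mean_curv :: "real^2 \<Rightarrow> real" where
  "mean_curv p = second_form 1 1 p + zp p ^ 6 * second_form 2 2 p"

lemma smooth_\<Phi>: "smooth \<Phi>"
  using isometric by (simp add: isometric_immersion_def)

lemma smooth_\<eta>: "smooth \<eta>"
  using normal by (simp add: unit_normal_field_def)

lemmas smooths = smooth_\<Phi> smooth_\<eta> smooth_pd[OF smooth_\<Phi>] smooth_pd[OF smooth_\<eta>]
  smooth_pd[OF smooth_pd[OF smooth_\<Phi>]] smooth_profile

lemma smooth_second_form: "smooth (second_form i j)"
  unfolding second_form_def[abs_def] by (intro smooth_lor smooths)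

lemma smooth_mean_curv: "smooth mean_curv"
  unfolding mean_curv_def[abs_def] by (intro smooth_add smooth_mult smooth_power smooth_second_form smooths)

lemma pd_21: "pd 2 (pd 1 \<Phi>) = pd 1 (pd 2 \<Phi>)" "pd 2 (pd 1 (pd j \<Phi>)) = pd 1 (pd 2 (pd j \<Phi>))"
  by (rule pd_commute, rule smooths)+

lemma second_form_21: "second_form 2 1 = second_form 1 2"
  by (simp add: second_form_def[abs_def] pd_21)

lemma lor_\<Phi>_\<Phi>: "lor (\<Phi> p) (\<Phi> p) = -1"
  using isometric by (auto simp: isometric_immersion_def H3_def)

lemma lor_pd_pd: "lor (pd i \<Phi> p) (pd j \<Phi> p) = (if i \<noteq> j then 0 else if i = 1 then 1 else (Gp p)\<^sup>2)"
  using isometric by (auto simp: isometric_immersion_def warped_metric_def)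

lemma lor_\<eta>: "lor (\<eta> p) (\<eta> p) = 1" "lor (\<eta> p) (\<Phi> p) = 0" "lor (\<eta> p) (pd i \<Phi> p) = 0"
    "lor (\<Phi> p) (\<eta> p) = 0" "lor (pd i \<Phi> p) (\<eta> p) = 0"
proof -
  show *: "lor (\<eta> p) (\<eta> p) = 1" "lor (\<eta> p) (\<Phi> p) = 0" "lor (\<eta> p) (pd i \<Phi> p) = 0"
    using normal by (simp_all add: unit_normal_field_def)
  show "lor (\<Phi> p) (\<eta> p) = 0" "lor (pd i \<Phi> p) (\<eta> p) = 0"
    using *(2,3) by (simp_all only: lor_commute[of "\<Phi> p" "\<eta> p"] lor_commute[of "pd i \<Phi> p" "\<eta> p"])
qed

lemma lor_\<Phi>_pd: "lor (\<Phi> p) (pd i \<Phi> p) = 0" "lor (pd i \<Phi> p) (\<Phi> p) = 0"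
proof -
  have "lor (pd i \<Phi> p) (\<Phi> p) = 0 - lor (\<Phi> p) (pd i \<Phi> p)"
    using lor_pd_left[OF smooths(1,1) ext[OF lor_\<Phi>_\<Phi>]] by simp
  then show "lor (\<Phi> p) (pd i \<Phi> p) = 0" "lor (pd i \<Phi> p) (\<Phi> p) = 0"
    by (simp_all add: lor_commute[of "pd i \<Phi> p"])
qed

lemma lor_pd2_\<Phi>: "lor (pd i (pd j \<Phi>) p) (\<Phi> p) = - lor (pd j \<Phi> p) (pd i \<Phi> p)"
  using lor_pd_left[OF smooths(3) smooths(1) ext[OF lor_\<Phi>_pd(2)], of i j p] by simp

lemma pd_G_sq: "pd i (\<lambda>p. (Gp p)\<^sup>2) p = (if i = 1 then 2 * Gp p * G1p p else 0)"
  using pd_mult[OF smooth_differentiable[OF smooth_profile(1)] smooth_differentiable[OF smooth_profile(1)]]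
  by (simp add: pd_profile power2_eq_square)

text \<open>Koszul's argument: derivatives of the metric coefficients and the symmetry of second
  derivatives determine every tangential part, whatever the immersion.\<close>

lemma lor_pd2_pd:
  "lor (pd 1 (pd 1 \<Phi>) p) (pd 1 \<Phi> p) = 0" "lor (pd 1 (pd 2 \<Phi>) p) (pd 1 \<Phi> p) = 0"
  "lor (pd 1 (pd 2 \<Phi>) p) (pd 2 \<Phi> p) = Gp p * G1p p" "lor (pd 2 (pd 2 \<Phi>) p) (pd 2 \<Phi> p) = 0"
  "lor (pd 1 (pd 1 \<Phi>) p) (pd 2 \<Phi> p) = 0" "lor (pd 2 (pd 2 \<Phi>) p) (pd 1 \<Phi> p) = - Gp p * G1p p"
proof -
  have 11: "lor (pd i (pd 1 \<Phi>) p) (pd 1 \<Phi> p) = 0 - lor (pd 1 \<Phi> p) (pd i (pd 1 \<Phi>) p)" for i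
    by (subst lor_pd_left[OF smooths(3,3), where k = "\<lambda>p. 1"]) (auto simp: lor_pd_pd)
  have 22: "lor (pd i (pd 2 \<Phi>) p) (pd 2 \<Phi> p)
      = (if i = 1 then 2 * Gp p * G1p p else 0) - lor (pd 2 \<Phi> p) (pd i (pd 2 \<Phi>) p)" for i
    by (subst lor_pd_left[OF smooths(3,3), where k = "\<lambda>p. (Gp p)\<^sup>2"]) (auto simp: lor_pd_pd pd_G_sq)
  have 12: "lor (pd i (pd 1 \<Phi>) p) (pd 2 \<Phi> p) = 0 - lor (pd 1 \<Phi> p) (pd i (pd 2 \<Phi>) p)" for i
    by (subst lor_pd_left[OF smooths(3,3), where k = "\<lambda>p. 0"]) (auto simp: lor_pd_pd)
  show a: "lor (pd 1 (pd 1 \<Phi>) p) (pd 1 \<Phi> p) = 0" "lor (pd 1 (pd 2 \<Phi>) p) (pd 1 \<Phi> p) = 0"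
    using 11[of 1] 11[of 2] by (simp_all add: pd_21 lor_commute[of "pd 1 \<Phi> p"])
  show b: "lor (pd 1 (pd 2 \<Phi>) p) (pd 2 \<Phi> p) = Gp p * G1p p" "lor (pd 2 (pd 2 \<Phi>) p) (pd 2 \<Phi> p) = 0"
    using 22[of 1] 22[of 2] by (simp_all add: pd_21 lor_commute[of "pd 2 \<Phi> p"])
  show "lor (pd 1 (pd 1 \<Phi>) p) (pd 2 \<Phi> p) = 0" "lor (pd 2 (pd 2 \<Phi>) p) (pd 1 \<Phi> p) = - Gp p * G1p p"
    using 12[of 1] 12[of 2] a b by (simp_all add: pd_21 lor_commute[of "pd 1 \<Phi> p"])
qed

lemma frame_expansion:
  "v = - lor v (\<Phi> p) *\<^sub>R \<Phi> p + lor v (pd 1 \<Phi> p) *\<^sub>R pd 1 \<Phi> p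
     + (zp p ^ 6 * lor v (pd 2 \<Phi> p)) *\<^sub>R pd 2 \<Phi> p + lor v (\<eta> p) *\<^sub>R \<eta> p"
proof -
  have "lor (zp p ^ 3 *\<^sub>R pd 2 \<Phi> p) (zp p ^ 3 *\<^sub>R pd 2 \<Phi> p) = (Gp p * zp p ^ 3)\<^sup>2"
    by (simp add: lor.scaleR_left lor.scaleR_right lor_pd_pd power2_eq_square)
  then have 1: "lor (zp p ^ 3 *\<^sub>R pd 2 \<Phi> p) (zp p ^ 3 *\<^sub>R pd 2 \<Phi> p) = 1"
    by (simp only: G_z) simp
  have "v = - lor v (\<Phi> p) *\<^sub>R \<Phi> p + lor v (pd 1 \<Phi> p) *\<^sub>R pd 1 \<Phi> p
     + lor v (zp p ^ 3 *\<^sub>R pd 2 \<Phi> p) *\<^sub>R (zp p ^ 3 *\<^sub>R pd 2 \<Phi> p) + lor v (\<eta> p) *\<^sub>R \<eta> p"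
    by (rule lor_frame_expansion)
      (use 1 in \<open>auto simp: lor_\<Phi>_\<Phi> lor_pd_pd lor_\<eta> lor.scaleR_left lor.scaleR_right lor_\<Phi>_pd\<close>)
  moreover have "lor v (zp p ^ 3 *\<^sub>R pd 2 \<Phi> p) *\<^sub>R (zp p ^ 3 *\<^sub>R pd 2 \<Phi> p)
      = (zp p ^ 6 * lor v (pd 2 \<Phi> p)) *\<^sub>R pd 2 \<Phi> p"
    by (simp add: lor.scaleR_right power_numeral_reduce)
  ultimately show ?thesis
    by metis
qed

lemma G_z_powers: "zp p ^ 6 * (Gp p)\<^sup>2 = 1" "zp p ^ 6 * (Gp p * G1p p) = zp p ^ 3 * G1p p"
  using z_ne[of "p $ 1"] by (simp_all add: G_eq field_simps flip: power_mult power_add)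

text \<open>Gauss formulas. The tangential coefficients are the Christoffel symbols; the multiple of
  \<open>\<Phi>\<close> is the metric coefficient and reflects the position of the hyperboloid in
  flat space.\<close>

lemma pd2_\<Phi>:
  "pd 1 (pd 1 \<Phi>) p = \<Phi> p + second_form 1 1 p *\<^sub>R \<eta> p"
  "pd 1 (pd 2 \<Phi>) p = (zp p ^ 3 * G1p p) *\<^sub>R pd 2 \<Phi> p + second_form 1 2 p *\<^sub>R \<eta> p"
  "pd 2 (pd 2 \<Phi>) p = (Gp p)\<^sup>2 *\<^sub>R \<Phi> p - (Gp p * G1p p) *\<^sub>R pd 1 \<Phi> p + second_form 2 2 p *\<^sub>R \<eta> p"
  by (rule trans[OF frame_expansion[of _ p]],
      simp add: lor_pd2_\<Phi> lor_pd_pd lor_pd2_pd G_z_powers flip: second_form_def)+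

lemma lor_pd_\<eta>:
  "lor (pd i \<eta> p) (\<eta> p) = 0" "lor (\<eta> p) (pd i \<eta> p) = 0"
  "lor (pd i \<eta> p) (\<Phi> p) = 0" "lor (pd i \<eta> p) (pd j \<Phi> p) = - second_form i j p"
proof -
  have "lor (pd i \<eta> p) (\<eta> p) = 0 - lor (\<eta> p) (pd i \<eta> p)"
    using lor_pd_left[OF smooths(2,2) ext[OF lor_\<eta>(1)]] by simp
  then show "lor (pd i \<eta> p) (\<eta> p) = 0" "lor (\<eta> p) (pd i \<eta> p) = 0"
    by (simp_all add: lor_commute[of "pd i \<eta> p"])
  show "lor (pd i \<eta> p) (\<Phi> p) = 0"
    using lor_pd_left[OF smooths(2,1) ext[OF lor_\<eta>(2)], of i p] by (simp add: lor_\<eta>)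
  show "lor (pd i \<eta> p) (pd j \<Phi> p) = - second_form i j p"
    using lor_pd_left[OF smooths(2,3) ext[OF lor_\<eta>(3)], of i p j]
    by (simp add: second_form_def lor_commute[of "\<eta> p"])
qed

lemma pd_\<eta>: "pd i \<eta> p = - second_form i 1 p *\<^sub>R pd 1 \<Phi> p - (zp p ^ 6 * second_form i 2 p) *\<^sub>R pd 2 \<Phi> p"
  by (rule trans[OF frame_expansion[of _ p]]) (simp add: lor_pd_\<eta>)

lemma pd_second_form: "pd k (second_form i j) p = lor (pd k (pd i (pd j \<Phi>)) p) (\<eta> p) + lor (pd i (pd j \<Phi>) p) (pd k \<eta> p)"
  unfolding second_form_def[abs_def] by (intro pd_lor smooth_differentiable smooths)

text \<open>Third derivatives of \<open>\<Phi>\<close> commute and cancel in each difference. What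
  remains pairs second derivatives of \<open>\<Phi>\<close> with derivatives of
  \<open>\<eta>\<close>, known from the Gauss and Weingarten formulas.\<close>

lemma codazzi:
  "pd 2 (second_form 1 1) p - pd 1 (second_form 1 2) p = zp p ^ 3 * G1p p * second_form 1 2 p"
  "pd 1 (second_form 2 2) p - pd 2 (second_form 1 2) p = Gp p * G1p p * second_form 1 1 p + zp p ^ 3 * G1p p * second_form 2 2 p"
  by (simp_all add: pd_second_form pd_21 pd2_\<Phi> lor_simps lor_pd_\<eta> lor_commute[of _ "pd _ \<eta> p"] second_form_21)

lemma pd_G_G1: "pd 1 (\<lambda>p. - Gp p * G1p p) p = - ((G1p p)\<^sup>2 + Gp p * (Gp p + zp p ^ 5 / 9))"
proof -
  have "pd 1 (\<lambda>p. - (Gp p * G1p p)) p = - pd 1 (\<lambda>p. Gp p * G1p p) p"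
    by (intro pd_minus smooth_differentiable smooth_mult smooths)
  moreover have "pd 1 (\<lambda>p. Gp p * G1p p) p = pd 1 Gp p * G1p p + Gp p * pd 1 G1p p"
    by (intro pd_mult smooth_differentiable smooths)
  ultimately show ?thesis
    by (simp add: pd_profile power2_eq_square)
qed

text \<open>The third derivatives of \<open>\<Phi>\<close> in the orders 1,2,2 and 2,1,2 are paired
  with \<open>pd 1 \<Phi>\<close> and equated. The value is \<Gamma>^2 (K + 1): the summand \<Gamma>
  of \<Gamma>'' accounts for the ambient curvature -1, and only the summand \<open>z ^ 5 / 9\<close>
  is left.\<close>

lemma gauss: "second_form 1 1 p * second_form 2 2 p - (second_form 1 2 p)\<^sup>2 = - ((zp p)\<^sup>2 / 9)"
proof -
  have 1: "lor (pd 1 (pd 2 (pd 2 \<Phi>)) p) (pd 1 \<Phi> p)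
      = - ((G1p p)\<^sup>2 + Gp p * (Gp p + zp p ^ 5 / 9)) - lor (pd 2 (pd 2 \<Phi>) p) (pd 1 (pd 1 \<Phi>) p)"
    unfolding pd_G_G1[symmetric]
    by (intro lor_pd_left smooths ext) (simp add: lor_pd2_pd)
  have 2: "lor (pd 2 (pd 1 (pd 2 \<Phi>)) p) (pd 1 \<Phi> p) = 0 - lor (pd 1 (pd 2 \<Phi>) p) (pd 2 (pd 1 \<Phi>) p)"
    by (subst lor_pd_left[where k = "\<lambda>p. 0"]) (auto intro!: smooths simp: lor_pd2_pd)
  have "lor (pd 2 (pd 2 \<Phi>) p) (pd 1 (pd 1 \<Phi>) p) - lor (pd 1 (pd 2 \<Phi>) p) (pd 1 (pd 2 \<Phi>) p)
      = - ((G1p p)\<^sup>2 + Gp p * (Gp p + zp p ^ 5 / 9))"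
    using 1 2 by (simp add: pd_21)
  moreover have "lor (pd 2 (pd 2 \<Phi>) p) (pd 1 (pd 1 \<Phi>) p) = - (Gp p)\<^sup>2 + second_form 1 1 p * second_form 2 2 p"
    by (simp add: pd2_\<Phi> lor_simps lor_\<Phi>_\<Phi> lor_\<eta> lor_\<Phi>_pd)
  moreover have "lor (pd 1 (pd 2 \<Phi>) p) (pd 1 (pd 2 \<Phi>) p) = (G1p p)\<^sup>2 + (second_form 1 2 p)\<^sup>2"
  proof -
    have "(Gp p)\<^sup>2 * (zp p ^ 3 * G1p p * (zp p ^ 3 * G1p p)) = (G1p p)\<^sup>2"
      using z_ne[of "p $ 1"] by (simp add: G_eq field_simps power2_eq_square)
    then show ?thesis
      by (simp add: pd2_\<Phi> lor_simps lor_pd_pd lor_\<eta> algebra_simps power2_eq_square)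
  qed
  moreover have "Gp p * (zp p ^ 5 / 9) = (zp p)\<^sup>2 / 9"
    using z_ne[of "p $ 1"] by (simp add: G_eq field_simps power_numeral_reduce)
  ultimately show ?thesis
    by (simp add: algebra_simps power2_eq_square)
qed

section \<open>Tangential part of the bitension field\<close>

lemma tension_eq: "tension warped_metric \<Phi> = (\<lambda>p. mean_curv p *\<^sub>R \<eta> p)"
proof
  fix p
  have "tension warped_metric \<Phi> p = (pd 1 (pd 1 \<Phi>) p + lor (pd 1 (pd 1 \<Phi>) p) (\<Phi> p) *\<^sub>R \<Phi> p)
    + zp p ^ 6 *\<^sub>R (pd 2 (pd 2 \<Phi>) p + lor (pd 2 (pd 2 \<Phi>) p) (\<Phi> p) *\<^sub>R \<Phi> p + (Gp p * G1p p) *\<^sub>R pd 1 \<Phi> p)"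
    by (simp add: tension_def sum_2 ginv_warped_metric christoffel_warped_metric cov_def)
  also have "\<dots> = mean_curv p *\<^sub>R \<eta> p"
    by (simp add: lor_pd2_\<Phi> lor_pd_pd) (simp add: pd2_\<Phi> mean_curv_def scaleR_add_left)
  finally show "tension warped_metric \<Phi> p = mean_curv p *\<^sub>R \<eta> p" .
qed

lemma mean_curvature_eq: "mean_curvature warped_metric \<Phi> \<eta> = mean_curv"
proof
  fix p
  show "mean_curvature warped_metric \<Phi> \<eta> p = mean_curv p"
    by (simp add: mean_curvature_def trace_def shape_operator_def sum_2 ginv_warped_metric cov_def lor_pd_\<eta>
        mean_curv_def lor_simps lor_\<Phi>_pd)
qed

lemma lor_pd2_\<eta>_pd:
  "lor (pd i (pd j \<eta>) p) (pd m \<Phi> p) = - pd i (second_form j m) p - lor (pd j \<eta> p) (pd i (pd m \<Phi>) p)"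
proof -
  have "pd i (\<lambda>p. - second_form j m p) p = - pd i (second_form j m) p"
    by (intro pd_minus smooth_differentiable smooth_second_form)
  then show ?thesis
    using lor_pd_left[OF smooths(4) smooths(3) ext[OF lor_pd_\<eta>(4)], of i j p m] by simp
qed

lemma cov_tension:
  "cov \<Phi> j (tension warped_metric \<Phi>) = (\<lambda>p. pd j mean_curv p *\<^sub>R \<eta> p + mean_curv p *\<^sub>R pd j \<eta> p)"
proof
  fix p
  have "pd j (\<lambda>p. mean_curv p *\<^sub>R \<eta> p) p = pd j mean_curv p *\<^sub>R \<eta> p + mean_curv p *\<^sub>R pd j \<eta> p"
    by (intro pd_scaleR smooth_differentiable smooth_mean_curv smooths)
  then show "cov \<Phi> j (tension warped_metric \<Phi>) p = pd j mean_curv p *\<^sub>R \<eta> p + mean_curv p *\<^sub>R pd j \<eta> p"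
    by (simp add: tension_eq cov_def lor_simps lor_pd_\<eta> lor_\<eta>)
qed

lemma lor_cov_cov_tension:
  "lor (cov \<Phi> i (cov \<Phi> j (tension warped_metric \<Phi>)) p) (pd m \<Phi> p)
     = - pd j mean_curv p * second_form i m p - pd i mean_curv p * second_form j m p
       - mean_curv p * (pd i (second_form j m) p + lor (pd j \<eta> p) (pd i (pd m \<Phi>) p))"
proof -
  have "pd i (\<lambda>p. pd j mean_curv p *\<^sub>R \<eta> p + mean_curv p *\<^sub>R pd j \<eta> p) p
      = pd i (\<lambda>p. pd j mean_curv p *\<^sub>R \<eta> p) p + pd i (\<lambda>p. mean_curv p *\<^sub>R pd j \<eta> p) p"
    by (intro pd_add smooth_differentiable smooth_scaleR smooth_pd smooth_mean_curv smooths)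
  moreover have "pd i (\<lambda>p. pd j mean_curv p *\<^sub>R \<eta> p) p = pd i (pd j mean_curv) p *\<^sub>R \<eta> p + pd j mean_curv p *\<^sub>R pd i \<eta> p"
    by (intro pd_scaleR smooth_differentiable smooth_pd smooth_mean_curv smooths)
  moreover have "pd i (\<lambda>p. mean_curv p *\<^sub>R pd j \<eta> p) p = pd i mean_curv p *\<^sub>R pd j \<eta> p + mean_curv p *\<^sub>R pd i (pd j \<eta>) p"
    by (intro pd_scaleR smooth_differentiable smooth_pd smooth_mean_curv smooths)
  ultimately show ?thesis
    by (simp add: cov_tension cov_def[of _ i] lor_simps lor_\<eta> lor_\<Phi>_pd lor_pd_\<eta> lor_pd2_\<eta>_pd algebra_simps)
qed

lemma lor_cov_tension: "lor (cov \<Phi> k (tension warped_metric \<Phi>) p) (pd m \<Phi> p) = - mean_curv p * second_form k m p"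
  by (simp add: cov_tension lor_simps lor_\<eta> lor_pd_\<eta>)

text \<open>In a space form the curvature trace of a normal field is again normal, so tangentially
  only the rough Laplacian contributes.\<close>

lemma lor_bitension:
  "lor (bitension warped_metric \<Phi> p) (pd m \<Phi> p) =
     lor (cov \<Phi> 1 (cov \<Phi> 1 (tension warped_metric \<Phi>)) p) (pd m \<Phi> p)
     + zp p ^ 6 * (lor (cov \<Phi> 2 (cov \<Phi> 2 (tension warped_metric \<Phi>)) p) (pd m \<Phi> p) - Gp p * G1p p * mean_curv p * second_form 1 m p)"
proof -
  have "lor (tension warped_metric \<Phi> p) (pd j \<Phi> p) = 0" for j
    by (simp add: tension_eq lor_simps lor_\<eta>)
  then show ?thesis
    by (simp add: bitension_def rough_laplacian_def sum_2 ginv_warped_metric christoffel_warped_metric curv_H3_def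
        lor_simps lor_cov_tension)
qed

lemma pd_mean_curv:
  "pd 1 mean_curv p = pd 1 (second_form 1 1) p + zp p ^ 6 * pd 1 (second_form 2 2) p - 2 * zp p ^ 9 * G1p p * second_form 2 2 p"
  "pd 2 mean_curv p = pd 2 (second_form 1 1) p + zp p ^ 6 * pd 2 (second_form 2 2) p"
proof -
  have "pd i mean_curv p = pd i (second_form 1 1) p + pd i (\<lambda>p. zp p ^ 6 * second_form 2 2 p) p" for i
    unfolding mean_curv_def[abs_def]
    by (intro pd_add smooth_differentiable smooth_mult smooth_power smooth_second_form smooths)
  moreover have "pd i (\<lambda>p. zp p ^ 6 * second_form 2 2 p) p = pd i (\<lambda>p. zp p ^ 6) p * second_form 2 2 p + zp p ^ 6 * pd i (second_form 2 2) p" for i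
    by (intro pd_mult smooth_differentiable smooth_power smooth_second_form smooths)
  moreover have "pd i (\<lambda>p. zp p ^ 6) p = (if i = 1 then - 2 * zp p ^ 9 * G1p p else 0)" for i
  proof -
    have "((\<lambda>w. z w ^ 6) has_vector_derivative - 2 * z x ^ 9 * G1 x) (at x)" for x
      using DERIV_power[OF DERIV_z[of x], of 6]
      by (simp add: has_real_derivative_iff_has_vector_derivative[symmetric] power_numeral_reduce ac_simps)
    then show ?thesis
      by (subst pd_coord) auto
  qed
  ultimately show 
  "pd 1 mean_curv p = pd 1 (second_form 1 1) p + zp p ^ 6 * pd 1 (second_form 2 2) p - 2 * zp p ^ 9 * G1p p * second_form 2 2 p"
  "pd 2 mean_curv p = pd 2 (second_form 1 1) p + zp p ^ 6 * pd 2 (second_form 2 2) p"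
    by simp_all
qed

text \<open>The Codazzi equations turn derivatives of the second form into derivatives of its trace.
  What is left is minus the pairing of 2 A(grad f) + f grad f with \<open>pd 1 \<Phi>\<close>, which
  recovers the equation A(grad f) = -(f/2) grad f in this direction.\<close>

lemma lor_bitension_1:
  "lor (bitension warped_metric \<Phi> p) (pd 1 \<Phi> p) =
     - (2 * pd 1 mean_curv p * second_form 1 1 p + 2 * zp p ^ 6 * pd 2 mean_curv p * second_form 1 2 p + mean_curv p * pd 1 mean_curv p)"
proof -
  have c: "pd 2 (second_form 1 2) p = pd 1 (second_form 2 2) p - Gp p * G1p p * second_form 1 1 p - zp p ^ 3 * G1p p * second_form 2 2 p"
    using codazzi(2)[of p] by simp
  have l: "lor (pd 1 \<eta> p) (pd 1 (pd 1 \<Phi>) p) = 0"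
    "lor (pd 2 \<eta> p) (pd 1 (pd 2 \<Phi>) p) = - (zp p ^ 3 * G1p p * second_form 2 2 p)"
    by (simp_all add: pd2_\<Phi> lor_simps lor_pd_\<eta>)
  have z: "zp p ^ 6 * zp p ^ 3 = zp p ^ 9"
    by (simp flip: power_add)
  show ?thesis
    unfolding lor_bitension lor_cov_cov_tension pd_21 l second_form_21 c pd_mean_curv z[symmetric] by (simp add: l algebra_simps)
qed

lemma lor_bitension_2:
  "lor (bitension warped_metric \<Phi> p) (pd 2 \<Phi> p) =
     - (2 * pd 1 mean_curv p * second_form 1 2 p + 2 * zp p ^ 6 * pd 2 mean_curv p * second_form 2 2 p + mean_curv p * pd 2 mean_curv p)"
proof -
  have c: "pd 1 (second_form 1 2) p = pd 2 (second_form 1 1) p - zp p ^ 3 * G1p p * second_form 1 2 p"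
    using codazzi(1)[of p] by simp
  have l: "lor (pd 1 \<eta> p) (pd 1 (pd 2 \<Phi>) p) = - (zp p ^ 3 * G1p p * second_form 1 2 p)"
    "lor (pd 2 \<eta> p) (pd 2 (pd 2 \<Phi>) p) = Gp p * G1p p * second_form 1 2 p"
    by (simp_all add: pd2_\<Phi> lor_simps lor_pd_\<eta> second_form_21)
  have z: "zp p ^ 3 = zp p ^ 6 * Gp p"
    using z_ne[of "p $ 1"] by (simp add: G_eq field_simps flip: power_add)
  show ?thesis
    unfolding lor_bitension lor_cov_cov_tension pd_21 l second_form_21 c pd_mean_curv(2) z by (simp add: algebra_simps)
qed

end

section \<open>Rigidity of the second fundamental form\<close>

lemma pd_cong_open:
  assumes "open V" "p \<in> V" "\<And>q. q \<in> V \<Longrightarrow> F q = H q" "F differentiable at p"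
  shows "pd i F p = pd i H p"
proof -
  obtain F' where F': "(F has_derivative F') (at p)"
    using assms(4) by (auto simp: differentiable_def)
  then have "(H has_derivative F') (at p)"
    using has_derivative_transform_within_open[OF F' assms(1,2)] assms(3) by auto
  then show ?thesis
    using F' by (simp add: pd_eqI)
qed

text \<open>The line \<omega> = 0 has empty interior, and leaving it horizontally gives the value as
  a limit. Identities obtained where grad f \<noteq> 0 are carried over to that line in this
  way.\<close>

lemma continuous_zero_extension:
  fixes F :: "real^2 \<Rightarrow> real"
  assumes "continuous_on UNIV F" "\<And>p. p $ 1 \<noteq> 0 \<Longrightarrow> F p = 0"
  shows "F p = 0"
proof (cases "p $ 1 = 0")
  case True
  have "((\<lambda>t. F (p + t *\<^sub>R axis 1 1)) \<longlongrightarrow> F (p + 0 *\<^sub>R axis 1 1)) (at 0)"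
  proof (rule isCont_tendsto_compose[of _ F])
    show "isCont F (p + 0 *\<^sub>R axis 1 1)"
      using assms(1) by (simp add: continuous_on_eq_continuous_at)
  qed (intro tendsto_intros)
  moreover have "((\<lambda>t. F (p + t *\<^sub>R axis 1 1)) \<longlongrightarrow> 0) (at 0)"
  proof (rule tendsto_eventually)
    show "\<forall>\<^sub>F t in at 0. F (p + t *\<^sub>R axis 1 1) = 0"
      unfolding eventually_at using assms(2) True
      by (intro exI[of _ 1]) (auto simp: axis_def)
  qed
  ultimately show ?thesis
    using tendsto_unique[of "at (0::real)"] by fastforce
qed (use assms in auto)

locale biconservative_profile = immersed_profile +
  assumes biconservative: "biconservative_immersion warped_metric \<Phi>"
begin

lemma biconservative_eqs:
  "2 * pd 1 mean_curv p * second_form 1 1 p + 2 * zp p ^ 6 * pd 2 mean_curv p * second_form 1 2 p + mean_curv p * pd 1 mean_curv p = 0"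
  "2 * pd 1 mean_curv p * second_form 1 2 p + 2 * zp p ^ 6 * pd 2 mean_curv p * second_form 2 2 p + mean_curv p * pd 2 mean_curv p = 0"
  using biconservative lor_bitension_1[of p] lor_bitension_2[of p]
  by (auto simp: biconservative_immersion_def)

text \<open>A nonzero gradient lies in the kernel of 2A + f, so its determinant 4 det A + 2 f trace
  A + f^2 = 4 det A + 3 f^2 vanishes, and the Gauss equation supplies det A = -z^8/9. The two
  product identities below are Cramer's rule.\<close>

lemma mean_curv_sq_of_grad:
  assumes "pd 1 mean_curv p \<noteq> 0 \<or> pd 2 mean_curv p \<noteq> 0"
  shows "(mean_curv p)\<^sup>2 = 4 / 27 * zp p ^ 8"
proof -
  define x y where "x = pd 1 mean_curv p" and "y = pd 2 mean_curv p"
  define A B D where "A = 2 * second_form 1 1 p + mean_curv p" and "B = 2 * second_form 1 2 p"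
    and "D = 2 * zp p ^ 6 * second_form 2 2 p + mean_curv p"
  have 1: "A * x + zp p ^ 6 * B * y = 0" and 2: "B * x + D * y = 0"
    using biconservative_eqs[of p] by (simp_all add: A_def B_def D_def x_def y_def algebra_simps)
  have "(A * D - zp p ^ 6 * B * B) * x = D * (A * x + zp p ^ 6 * B * y) - zp p ^ 6 * B * (B * x + D * y)"
    by (simp add: algebra_simps)
  moreover have "(A * D - zp p ^ 6 * B * B) * y = A * (B * x + D * y) - B * (A * x + zp p ^ 6 * B * y)"
    by (simp add: algebra_simps)
  ultimately have "A * D - zp p ^ 6 * B * B = 0"
    using assms 1 2 by (auto simp: x_def y_def)
  moreover have "A * D - zp p ^ 6 * B * B
      = 4 * zp p ^ 6 * (second_form 1 1 p * second_form 2 2 p - (second_form 1 2 p)\<^sup>2) + 3 * (mean_curv p)\<^sup>2"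
    by (simp add: A_def B_def D_def mean_curv_def algebra_simps power2_eq_square)
  ultimately have "27 * (mean_curv p)\<^sup>2 = 4 * (zp p ^ 6 * (zp p)\<^sup>2)"
    by (simp add: gauss)
  moreover have "zp p ^ 6 * (zp p)\<^sup>2 = zp p ^ 8"
    by (simp flip: power_add)
  ultimately show ?thesis
    by simp
qed

text \<open>Half the derivative of the squared identity. For \<omega> \<noteq> 0 the first
  right-hand side is nonzero, so the equation is a closed condition that keeps grad f away from
  zero.\<close>

lemma mean_curv_mult_pd_1:
  assumes "open V" "p \<in> V" "\<And>q. q \<in> V \<Longrightarrow> (mean_curv q)\<^sup>2 = 4 / 27 * zp q ^ 8"
  shows "mean_curv p * pd 1 mean_curv p = - (16 / 81 * zp p ^ 11 * G1p p)" "mean_curv p * pd 2 mean_curv p = 0"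
proof -
  have "pd i (\<lambda>q. mean_curv q * mean_curv q) p = pd i (\<lambda>q. 4 / 27 * z (q $ 1) ^ 8) p" for i
    using assms by (intro pd_cong_open[of V] smooth_differentiable smooth_mult smooth_mean_curv)
      (auto simp: power2_eq_square)
  moreover have "pd i (\<lambda>q. mean_curv q * mean_curv q) p = pd i mean_curv p * mean_curv p + mean_curv p * pd i mean_curv p" for i
    by (intro pd_mult smooth_differentiable smooth_mean_curv)
  moreover have "pd i (\<lambda>q. 4 / 27 * z (q $ 1) ^ 8) p = (if i = 1 then - (32 / 81 * zp p ^ 11 * G1p p) else 0)" for i
  proof -
    have "((\<lambda>w. 4 / 27 * z w ^ 8) has_vector_derivative - (32 / 81 * z x ^ 11 * G1 x)) (at x)" for x
      using DERIV_cmult[OF DERIV_power[OF DERIV_z[of x], of 8], of "4 / 27"]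
      by (simp add: has_real_derivative_iff_has_vector_derivative[symmetric] power_numeral_reduce ac_simps)
    then show ?thesis
      by (subst pd_coord) auto
  qed
  ultimately have *: "2 * (mean_curv p * pd i mean_curv p) = (if i = 1 then - (32 / 81 * zp p ^ 11 * G1p p) else 0)" for i
    by (simp add: algebra_simps)
  show "mean_curv p * pd 1 mean_curv p = - (16 / 81 * zp p ^ 11 * G1p p)" "mean_curv p * pd 2 mean_curv p = 0"
    using *[of 1] *[of 2] by simp_all
qed

text \<open>\<open>V\<close> is the part of the half-plane with grad f \<noteq> 0, and
  \<open>N\<close> is the open set on which the formula for f times its \<omega>-derivative fails.
  They are disjoint on the half-plane because the formula holds on \<open>V\<close>, and they cover
  it because at a critical point the formula would equate 0 with a nonzero number. The sign of
  \<open>s\<close> selects the half-plane.\<close>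

lemma half_plane_dichotomy:
  assumes s: "s \<noteq> 0"
  shows "(\<forall>p. 0 < s * p $ 1 \<longrightarrow> pd 1 mean_curv p \<noteq> 0 \<or> pd 2 mean_curv p \<noteq> 0)
    \<or> (\<forall>p. 0 < s * p $ 1 \<longrightarrow> pd 1 mean_curv p = 0 \<and> pd 2 mean_curv p = 0)"
proof -
  define S where "S = {p::real^2. 0 < s * p $ 1}"
  define V where "V = S \<inter> ({p. pd 1 mean_curv p \<noteq> 0} \<union> {p. pd 2 mean_curv p \<noteq> 0})"
  define N where "N = {p. mean_curv p * pd 1 mean_curv p + 16 / 81 * zp p ^ 11 * G1p p \<noteq> 0}"
  have cont: "continuous_on UNIV (pd i mean_curv)" for i
    by (intro smooth_continuous_on smooth_pd smooth_mean_curv)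
  have "open S"
    unfolding S_def by (intro open_Collect_less continuous_intros)
  then have oV: "open V"
    unfolding V_def by (intro open_Int open_Un open_Collect_neq cont continuous_on_const)
  have oN: "open N"
    unfolding N_def
    by (intro open_Collect_neq continuous_on_const smooth_continuous_on smooth_add smooth_mult
        smooth_power smooth_pd smooth_mean_curv smooth_const smooths)
  have V: "mean_curv p * pd 1 mean_curv p = - (16 / 81 * zp p ^ 11 * G1p p)" if "p \<in> V" for p
    by (rule mean_curv_mult_pd_1[OF oV that], rule mean_curv_sq_of_grad) (auto simp: V_def)
  have "S = {p. inner (s *\<^sub>R axis 1 1) p > 0}"
    by (auto simp: S_def inner_axis' )
  then have "connected S"
    by (simp only: convex_connected convex_halfspace_gt)
  moreover have "V \<inter> N \<inter> S = {}"
    using V by (auto simp: N_def)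
  moreover have "S \<subseteq> V \<union> N"
  proof
    fix p
    assume p: "p \<in> S"
    then have "p $ 1 \<noteq> 0"
      by (auto simp: S_def)
    then have "G1p p \<noteq> 0"
      using G1_sgn[of "p $ 1"] by auto
    then have "16 / 81 * zp p ^ 11 * G1p p \<noteq> 0"
      using z_ne by simp
    then show "p \<in> V \<union> N"
      using p by (auto simp: V_def N_def)
  qed
  ultimately have "V \<inter> S = {} \<or> N \<inter> S = {}"
    using connectedD[OF _ oV oN] by blast
  then show ?thesis
  proof
    assume "V \<inter> S = {}"
    then show ?thesis
      by (auto simp: V_def S_def)
  next
    assume "N \<inter> S = {}"
    then have "S \<subseteq> V"
      using \<open>S \<subseteq> V \<union> N\<close> by auto
    then show ?thesis
      by (auto simp: V_def S_def)
  qed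
qed

text \<open>A constant mean curvature \<open>k\<close> on a half-plane would make \<open>P\<close>, \<open>H\<close> below satisfy
  Cauchy-Riemann equations with radial modulus, so that \<open>l = G (P\<^sup>2 + H\<^sup>2)' / (2 (P\<^sup>2 + H\<^sup>2))\<close> would be
  constant there. But \<open>l\<close> vanishes exactly at \<open>0\<close>.\<close>

lemma not_cmc:
  assumes s: "s \<noteq> 0" and cmc: "\<And>p. 0 < s * p $ 1 \<Longrightarrow> pd 1 mean_curv p = 0 \<and> pd 2 mean_curv p = 0"
  shows False
proof -
  define S where "S = {p::real^2. 0 < s * p $ 1}"
  have oS: "open S"
    unfolding S_def by (intro open_Collect_less continuous_intros)
  have "S = {p. inner (s *\<^sub>R axis 1 1) p > 0}"
    by (auto simp: S_def inner_axis' )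
  then have "convex S"
    by (simp only: convex_halfspace_gt)
  have "\<exists>k. \<forall>p\<in>S. mean_curv p = k"
  proof (rule has_derivative_zero_constant[OF \<open>convex S\<close>])
    fix p assume "p \<in> S"
    then have "(mean_curv has_derivative (\<lambda>h. 0)) (at p)"
      using has_derivative_pd_sum[OF smooth_differentiable[OF smooth_mean_curv], of p] cmc[of p]
      by (simp add: S_def)
    then show "(mean_curv has_derivative (\<lambda>h. 0)) (at p within S)"
      by (rule has_derivative_at_withinI)
  qed
  then obtain k where k: "\<And>p. p \<in> S \<Longrightarrow> mean_curv p = k"
    by blast
  \<comment> \<open>Up to a constant factor, P - iH is the coefficient of the Hopf differential in
    the isothermal coordinates (u, \<theta>) with du = d\<omega>/\<Gamma>.\<close>
  define H where "H p = Gp p * second_form 1 2 p" for p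
  define P where "P p = (Gp p)\<^sup>2 * (second_form 1 1 p - k / 2)" for p
  have sH: "smooth H" and sP: "smooth P"
    unfolding H_def[abs_def] P_def[abs_def]
    by (intro smooth_mult smooth_power smooth_diff smooth_const smooth_second_form smooths)+
  note ds = smooth_differentiable[OF sH] smooth_differentiable[OF sP]
  \<comment> \<open>The value of P^2 + H^2 dictated by the Gauss equation. Half its logarithmic
    derivative in u is \<open>l\<close>, written as \<open>G1\<close> times a positive factor so
    that its zero is visible.\<close>
  define R where "R w = G w ^ 4 * k\<^sup>2 / 4 + (G w)\<^sup>2 * (z w)\<^sup>2 / 9" for w
  define m where "m w = (G w ^ 4 * k\<^sup>2 + 4 / 27 * (G w)\<^sup>2 * (z w)\<^sup>2) / (2 * R w)" for w
  define l where "l w = G1 w * m w" for w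
  have R_pos: "R w > 0" and m_pos: "m w > 0" for w
    using G_pos[of w] z_pos[of w] by (auto simp: R_def m_def intro!: add_nonneg_pos divide_pos_pos)
  have DR: "(R has_real_derivative 2 * R w * l w / G w) (at w)" for w
  proof -
    have "(R has_real_derivative (4 * G w ^ 3 * G1 w * k\<^sup>2 / 4
        + (2 * G w * G1 w * (z w)\<^sup>2 + (G w)\<^sup>2 * (2 * z w * (- (z w ^ 4 * G1 w / 3)))) / 9)) (at w)"
      unfolding R_def[abs_def] by (auto intro!: derivative_eq_intros DERIV_G DERIV_z)
    moreover have "4 * G w ^ 3 * G1 w * k\<^sup>2 / 4
        + (2 * G w * G1 w * (z w)\<^sup>2 + (G w)\<^sup>2 * (2 * z w * (- (z w ^ 4 * G1 w / 3)))) / 9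
        = G1 w * (G w ^ 4 * k\<^sup>2 + 4 / 27 * (G w)\<^sup>2 * (z w)\<^sup>2) / G w"
      using z_ne[of w] by (simp add: G_eq field_simps power_numeral_reduce)
    moreover have "2 * R w * l w / G w = G1 w * (G w ^ 4 * k\<^sup>2 + 4 / 27 * (G w)\<^sup>2 * (z w)\<^sup>2) / G w"
      using R_pos[of w] by (simp add: l_def m_def)
    ultimately show ?thesis
      by (simp only:)
  qed
  have rd: "f differentiable at w" if "(f has_real_derivative d) (at w)" for f d and w :: real
    using that by (auto simp: real_differentiable_def)
  have "\<exists>l'. \<forall>w. (l has_real_derivative l' w) (at w)"
  proof (rule choice, rule allI)
    fix w
    have "R w \<noteq> 0"
      using R_pos[of w] by simp
    then have "l differentiable at w"
      unfolding l_def[abs_def] m_def[abs_def]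
      by (intro differentiable_divide differentiable_mult differentiable_add differentiable_power
          differentiable_const rd[OF DR]
          rd[OF DERIV_G]
          rd[OF DERIV_G1]
          rd[OF DERIV_z]) simp
    then show "\<exists>l'. (l has_real_derivative l') (at w)"
      by (simp add: real_differentiable_def)
  qed
  then obtain l' where l': "\<And>w. (l has_real_derivative l' w) (at w)"
    by blast
  have h22: "second_form 2 2 p = (Gp p)\<^sup>2 * (k - second_form 1 1 p)" if "p \<in> S" for p
    using k[OF that] z_ne[of "p $ 1"]
    by (simp add: mean_curv_def G_eq field_simps flip: power_mult)
  have H1: "pd 1 H p = Gp p * pd 2 (second_form 1 1) p" for p
  proof -
    have "pd 1 H p = pd 1 Gp p * second_form 1 2 p + Gp p * pd 1 (second_form 1 2) p"
      unfolding H_def[abs_def] by (intro pd_mult smooth_differentiable smooth_second_form smooths)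
    then have "pd 1 H p = G1p p * second_form 1 2 p + Gp p * pd 1 (second_form 1 2) p"
      by (simp add: pd_profile)
    then show ?thesis
      using codazzi(1)[of p] z_ne[of "p $ 1"] by (simp add: G_eq field_simps)
  qed
  have H2: "pd 2 H p = Gp p * pd 2 (second_form 1 2) p" for p
  proof -
    have "pd 2 H p = pd 2 Gp p * second_form 1 2 p + Gp p * pd 2 (second_form 1 2) p"
      unfolding H_def[abs_def] by (intro pd_mult smooth_differentiable smooth_second_form smooths)
    then show ?thesis
      by (simp add: pd_profile)
  qed
  have Pi: "pd i P p = (if i = 1 then 2 * Gp p * G1p p else 0) * (second_form 1 1 p - k / 2) + (Gp p)\<^sup>2 * pd i (second_form 1 1) p" for i p
  proof -
    have "pd i P p = pd i (\<lambda>p. (Gp p)\<^sup>2) p * (second_form 1 1 p - k / 2) + (Gp p)\<^sup>2 * pd i (\<lambda>p. second_form 1 1 p + (- (k / 2))) p"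
      unfolding P_def[abs_def] using pd_mult[of "\<lambda>p. (Gp p)\<^sup>2" p "\<lambda>p. second_form 1 1 p + (- (k / 2))" i]
      by (simp add: smooth_differentiable smooth_power smooth_diff smooth_second_form smooth_const smooth_profile)
    moreover have "pd i (\<lambda>p. second_form 1 1 p + (- (k / 2))) p = pd i (second_form 1 1) p + pd i (\<lambda>p. - (k / 2)) p"
      by (intro pd_add smooth_differentiable smooth_second_form smooth_const)
    ultimately show ?thesis
      by (simp add: pd_G_sq)
  qed
  \<comment> \<open>Since \<Gamma> times the \<omega>-derivative is the u-derivative, this and
    \<open>CR2\<close> are the Cauchy-Riemann equations in (u, \<theta>). The constant trace enters
    in \<open>CR2\<close>.\<close>
  have CR1: "pd 2 P p = Gp p * pd 1 H p" for p
    by (simp add: Pi H1 power2_eq_square)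
  have CR2: "pd 2 H p = - Gp p * pd 1 P p" if p: "p \<in> S" for p
  proof -
    have "pd 1 (second_form 1 1) p + zp p ^ 6 * pd 1 (second_form 2 2) p - 2 * zp p ^ 9 * G1p p * second_form 2 2 p = 0"
      using cmc[of p] p pd_mean_curv(1)[of p] by (simp add: S_def)
    then have "(Gp p)\<^sup>2 * pd 1 (second_form 1 1) p + pd 1 (second_form 2 2) p = 2 * (zp p ^ 3 * G1p p * second_form 2 2 p)"
      using z_ne[of "p $ 1"] by (simp add: G_eq field_simps flip: power_mult)
    moreover have "zp p ^ 3 * G1p p * second_form 2 2 p = Gp p * G1p p * (k - second_form 1 1 p)"
      using z_ne[of "p $ 1"] by (simp add: h22[OF p] G_eq field_simps flip: power_mult power_add)
    ultimately have "pd 2 (second_form 1 2) p = Gp p * G1p p * (k - 2 * second_form 1 1 p) - (Gp p)\<^sup>2 * pd 1 (second_form 1 1) p"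
      using codazzi(2)[of p] by (simp add: algebra_simps)
    then have "pd 2 (second_form 1 2) p = - pd 1 P p"
      by (simp add: Pi algebra_simps)
    then show ?thesis
      by (simp add: H2)
  qed
  have PH: "(P p)\<^sup>2 + (H p)\<^sup>2 = R (p $ 1)" if p: "p \<in> S" for p
  proof -
    have e: "(second_form 1 2 p)\<^sup>2 = second_form 1 1 p * ((Gp p)\<^sup>2 * (k - second_form 1 1 p)) + (zp p)\<^sup>2 / 9"
      using gauss[of p] h22[OF p] by simp
    have "(P p)\<^sup>2 + (H p)\<^sup>2 = (Gp p)\<^sup>2 * ((Gp p)\<^sup>2 * (second_form 1 1 p - k / 2)\<^sup>2 + (second_form 1 2 p)\<^sup>2)"
      by (simp add: P_def H_def power_mult_distrib algebra_simps power2_eq_square)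
    also have "\<dots> = R (p $ 1)"
      unfolding e by (simp add: R_def algebra_simps power2_eq_square power4_eq_xxxx)
    finally show ?thesis .
  qed
  have PHi: "P p * pd i P p + H p * pd i H p = (if i = 1 then R (p $ 1) * l (p $ 1) / Gp p else 0)"
    if p: "p \<in> S" for p i
  proof -
    have "pd i (\<lambda>q. P q * P q + H q * H q) p = pd i (\<lambda>q. R (q $ 1)) p"
      using PH by (intro pd_cong_open[OF oS p] smooth_differentiable smooth_add smooth_mult sP sH)
        (auto simp: power2_eq_square)
    moreover have "pd i (\<lambda>q. P q * P q + H q * H q) p = pd i (\<lambda>q. P q * P q) p + pd i (\<lambda>q. H q * H q) p"
      by (intro pd_add smooth_differentiable smooth_add smooth_mult sP sH)
    moreover have "pd i (\<lambda>q. P q * P q) p = pd i P p * P p + P p * pd i P p"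
      "pd i (\<lambda>q. H q * H q) p = pd i H p * H p + H p * pd i H p"
      by (intro pd_mult ds)+
    moreover have "pd i (\<lambda>q. R (q $ 1)) p = (if i = 1 then 2 * R (p $ 1) * l (p $ 1) / Gp p else 0)"
      using DR by (subst pd_coord) (auto simp: has_real_derivative_iff_has_vector_derivative)
    ultimately have "2 * (P p * pd i P p + H p * pd i H p) = 2 * (if i = 1 then R (p $ 1) * l (p $ 1) / Gp p else 0)"
      by (auto simp: algebra_simps split: if_splits)
    then show ?thesis
      by simp
  qed
  \<comment> \<open>P^2 + H^2 does not depend on \<theta>, which by Cauchy-Riemann makes the
    \<omega>-derivative of (P, H) parallel to (P, H); the \<omega>-derivative of the modulus then
    gives the factor.\<close>
  have PH1: "pd 1 P p = l (p $ 1) * P p / Gp p" "pd 1 H p = l (p $ 1) * H p / Gp p" if p: "p \<in> S" for p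
  proof -
    have R0: "R (p $ 1) \<noteq> 0"
      using R_pos[of "p $ 1"] by simp
    have "Gp p * (P p * pd 1 H p - H p * pd 1 P p) = 0"
      using PHi[OF p, of 2] by (simp add: CR1 CR2[OF p] algebra_simps)
    then have 0: "P p * pd 1 H p = H p * pd 1 P p"
      using G_pos[of "p $ 1"] by simp
    have 1: "P p * pd 1 P p + H p * pd 1 H p = R (p $ 1) * l (p $ 1) / Gp p"
      using PHi[OF p, of 1] by simp
    have "R (p $ 1) * pd 1 P p = P p * (P p * pd 1 P p) + H p * (H p * pd 1 P p)"
      unfolding PH[OF p, symmetric] by (simp add: algebra_simps power2_eq_square)
    also have "\<dots> = P p * (P p * pd 1 P p + H p * pd 1 H p)"
      unfolding 0[symmetric] by (simp add: algebra_simps)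
    finally have "R (p $ 1) * pd 1 P p = R (p $ 1) * (l (p $ 1) * P p / Gp p)"
      by (simp add: 1)
    then show "pd 1 P p = l (p $ 1) * P p / Gp p"
      by (rule mult_left_cancel[OF R0, THEN iffD1])
    have "R (p $ 1) * pd 1 H p = P p * (P p * pd 1 H p) + H p * (H p * pd 1 H p)"
      unfolding PH[OF p, symmetric] by (simp add: algebra_simps power2_eq_square)
    also have "\<dots> = H p * (P p * pd 1 P p + H p * pd 1 H p)"
      unfolding 0 by (simp add: algebra_simps)
    finally have "R (p $ 1) * pd 1 H p = R (p $ 1) * (l (p $ 1) * H p / Gp p)"
      by (simp add: 1)
    then show "pd 1 H p = l (p $ 1) * H p / Gp p"
      by (rule mult_left_cancel[OF R0, THEN iffD1])
  qed
  have PH2: "pd 2 P p = l (p $ 1) * H p" "pd 2 H p = - l (p $ 1) * P p" if p: "p \<in> S" for p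
    using G_pos[of "p $ 1"] by (auto simp: CR1 CR2[OF p] PH1[OF p])
  have dcoord: "(\<lambda>q::real^2. f (q $ 1)) differentiable at p" "pd i (\<lambda>q. f (q $ 1)) p = (if i = 1 then f' (p $ 1) else 0)"
    if "\<And>w. (f has_real_derivative f' w) (at w)" for f f' p i
    using differentiable_coord[of f f'] pd_coord[of f f'] that
    by (simp_all add: has_real_derivative_iff_has_vector_derivative)
  \<comment> \<open>Comparing mixed derivatives of P and of H leaves only \<open>l'\<close> times H
    and times P, which are not both zero because R > 0. This expresses that the logarithm of the
    modulus of a holomorphic function is harmonic.\<close>
  have l'_0: "l' (p $ 1) = 0" if p: "p \<in> S" for p
  proof -
    define a where "a w = l w / G w" for w
    have "\<exists>a'. \<forall>w. (a has_real_derivative a' w) (at w)"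
    proof (rule choice, rule allI)
      fix w
      show "\<exists>a'. (a has_real_derivative a') (at w)"
        unfolding a_def[abs_def] 
        by (rule exI, rule DERIV_divide[OF l' DERIV_G]) (use G_pos[of w] in simp)
    qed
    then obtain a' where a': "\<And>w. (a has_real_derivative a' w) (at w)"
      by blast
    have "l' (p $ 1) * H p = 0"
    proof -
      have "pd 1 (pd 2 P) p = pd 1 (\<lambda>q. l (q $ 1) * H q) p"
        by (intro pd_cong_open[OF oS p] smooth_differentiable smooth_pd sP PH2)
      also have "\<dots> = l' (p $ 1) * H p + l (p $ 1) * pd 1 H p"
        by (subst pd_mult) (simp_all add: dcoord[OF l'] ds)
      finally have 1: "pd 1 (pd 2 P) p = l' (p $ 1) * H p + l (p $ 1) * pd 1 H p" .
      have "pd 2 (pd 1 P) p = pd 2 (\<lambda>q. a (q $ 1) * P q) p"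
        by (intro pd_cong_open[OF oS p] smooth_differentiable smooth_pd sP) (simp add: PH1 a_def)
      also have "\<dots> = a (p $ 1) * pd 2 P p"
        by (subst pd_mult) (simp_all add: dcoord[OF a'] ds)
      finally show ?thesis
        using 1 pd_commute[OF sP, of 1 2] by (simp add: a_def PH1[OF p] PH2[OF p])
    qed
    moreover have "l' (p $ 1) * P p = 0"
    proof -
      have "pd 1 (pd 2 H) p = pd 1 (\<lambda>q. - (l (q $ 1) * P q)) p"
        by (intro pd_cong_open[OF oS p] smooth_differentiable smooth_pd sH) (simp add: PH2)
      also have "\<dots> = - pd 1 (\<lambda>q. l (q $ 1) * P q) p"
        by (intro pd_minus differentiable_mult dcoord[OF l'] ds)
      also have "\<dots> = - (l' (p $ 1) * P p + l (p $ 1) * pd 1 P p)"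
        by (subst pd_mult) (simp_all add: dcoord[OF l'] ds)
      finally have 1: "pd 1 (pd 2 H) p = - (l' (p $ 1) * P p + l (p $ 1) * pd 1 P p)" .
      have "pd 2 (pd 1 H) p = pd 2 (\<lambda>q. a (q $ 1) * H q) p"
        by (intro pd_cong_open[OF oS p] smooth_differentiable smooth_pd sH) (simp add: PH1 a_def)
      also have "\<dots> = a (p $ 1) * pd 2 H p"
        by (subst pd_mult) (simp_all add: dcoord[OF a'] ds)
      finally show ?thesis
        using 1 pd_commute[OF sH, of 1 2] by (simp add: a_def PH1[OF p] PH2[OF p])
    qed
    ultimately show ?thesis
      using PH[OF p] R_pos[of "p $ 1"] by auto
  qed
  have l'_0': "l' w = 0" if "0 < s * w" for w
    using l'_0[of "w *\<^sub>R axis 1 1"] that by (simp add: S_def axis_def)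
  \<comment> \<open>\<open>l\<close> is constant on the open half-line and continuous up to 0, where
    \<open>G1\<close> vanishes; so it would have to vanish at \<open>s\<close> as well.\<close>
  have "l (s * 1) = l (s * 0)"
  proof (rule DERIV_isconst2[of 0 1])
    have "continuous_on UNIV l"
      using DERIV_isCont[OF l'] by (simp add: continuous_at_imp_continuous_on)
    then show "continuous_on {0..1} (\<lambda>t. l (s * t))"
      by (rule continuous_on_compose2) (auto intro!: continuous_intros)
    fix t :: real
    assume "0 < t" "t < 1"
    then have "l' (s * t) = 0"
      using s by (intro l'_0') (auto simp: zero_less_mult_iff mult_less_0_iff)
    then show "((\<lambda>t. l (s * t)) has_real_derivative 0) (at t)"
      using DERIV_chain2[where f = l and g = "\<lambda>t. s * t", OF l' DERIV_cmult_Id[of s t]] by simp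
  qed auto
  then show False
    using G1_sgn[OF s] m_pos[of s] by (simp add: l_def G1_0)
qed

lemma grad_mean_curv:
  assumes "p $ 1 \<noteq> 0"
  shows "pd 1 mean_curv p \<noteq> 0 \<or> pd 2 mean_curv p \<noteq> 0"
proof -
  define s where "s = p $ 1"
  have "s \<noteq> 0" "0 < s * p $ 1"
    using assms by (auto simp: s_def zero_less_mult_iff)
  then show ?thesis
    using half_plane_dichotomy not_cmc by blast
qed

lemma pd_mean_curv_off_axis:
  assumes "p $ 1 \<noteq> 0"
  shows "pd 1 mean_curv p \<noteq> 0" "pd 2 mean_curv p = 0"
proof -
  have "open {p::real^2. p $ 1 \<noteq> 0}"
    by (intro open_Collect_neq continuous_intros)
  from mean_curv_mult_pd_1[OF this, of p] assms
  have "mean_curv p * pd 2 mean_curv p = 0"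
    using mean_curv_sq_of_grad[OF grad_mean_curv] by auto
  moreover have "mean_curv p \<noteq> 0"
    using mean_curv_sq_of_grad[OF grad_mean_curv[OF assms]] z_ne[of "p $ 1"] by auto
  ultimately show "pd 2 mean_curv p = 0"
    by simp
  then show "pd 1 mean_curv p \<noteq> 0"
    using grad_mean_curv[OF assms] by simp
qed

text \<open>Off the line \<omega> = 0 the gradient is a nonzero multiple of the \<omega>-direction,
  which is therefore principal with curvature -f/2; the trace yields the last entry. Continuity
  settles the line itself.\<close>

lemma second_fundamental_form:
  "(mean_curv p)\<^sup>2 = 4 / 27 * zp p ^ 8" "second_form 1 1 p = - mean_curv p / 2" "second_form 1 2 p = 0" "second_form 2 2 p = 3 / 2 * (Gp p)\<^sup>2 * mean_curv p"
proof -
  have "(mean_curv p)\<^sup>2 - 4 / 27 * zp p ^ 8 = 0"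
    by (rule continuous_zero_extension, intro smooth_continuous_on smooth_diff smooth_mult
        smooth_power smooth_const smooth_mean_curv smooths) (simp add: mean_curv_sq_of_grad[OF grad_mean_curv])
  then show "(mean_curv p)\<^sup>2 = 4 / 27 * zp p ^ 8"
    by simp
  have "2 * second_form 1 1 p + mean_curv p = 0"
  proof (rule continuous_zero_extension[where p = p])
    show "2 * second_form 1 1 p + mean_curv p = 0" if "p $ 1 \<noteq> 0" for p
    proof -
      have "pd 1 mean_curv p * (2 * second_form 1 1 p + mean_curv p) = 0"
        using biconservative_eqs(1)[of p] pd_mean_curv_off_axis[OF that] by (simp add: algebra_simps)
      then show ?thesis
        using pd_mean_curv_off_axis[OF that] by simp
    qed
  qed (intro smooth_continuous_on smooth_add smooth_mult smooth_const smooth_second_form smooth_mean_curv)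
  then show 1: "second_form 1 1 p = - mean_curv p / 2"
    by simp
  show "second_form 1 2 p = 0"
  proof (rule continuous_zero_extension[where p = p])
    show "second_form 1 2 p = 0" if "p $ 1 \<noteq> 0" for p
      using biconservative_eqs(2)[of p] pd_mean_curv_off_axis[OF that] by simp
  qed (intro smooth_continuous_on smooth_second_form)
  have "zp p ^ 6 * second_form 2 2 p = 3 / 2 * mean_curv p"
    using 1 by (simp add: mean_curv_def)
  then show "second_form 2 2 p = 3 / 2 * (Gp p)\<^sup>2 * mean_curv p"
    using z_ne[of "p $ 1"] by (simp add: G_eq field_simps flip: power_mult)
qed

text \<open>The squared mean curvature has no zeros and the plane is connected. Only a global sign
  stays open, and it cannot be fixed here because reversing the normal changes it.\<close>

lemma mean_curv_sign:
  obtains \<epsilon> :: real where "\<epsilon> = 1 \<or> \<epsilon> = -1" "\<And>p. mean_curv p = \<epsilon> * (2 / (3 * sqrt 3) * zp p ^ 4)"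
proof -
  define q where "q p = 2 / (3 * sqrt 3) * zp p ^ 4" for p :: "real^2"
  have q_pos: "q p > 0" for p
    using z_pos[of "p $ 1"] by (simp add: q_def)
  have "(mean_curv p)\<^sup>2 = (q p)\<^sup>2" for p
    unfolding second_fundamental_form q_def by (simp add: power_mult_distrib power_divide flip: power_mult)
  then have e: "mean_curv p = q p \<or> mean_curv p = - q p" for p
    by (simp add: power2_eq_iff)
  have o: "open {p. mean_curv p > 0}" "open {p. mean_curv p < 0}"
    by (intro open_Collect_less continuous_on_const smooth_continuous_on smooth_mean_curv)+
  have "mean_curv p \<noteq> 0" for p
    using e[of p] q_pos[of p] by auto
  then have "UNIV \<subseteq> {p. mean_curv p > 0} \<union> {p. mean_curv p < 0}"
    by (auto simp: not_less less_le)
  then have "{p. mean_curv p > 0} = {} \<or> {p. mean_curv p < 0} = {}"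
    using connectedD[OF connected_UNIV o] by fastforce
  then show ?thesis
  proof
    assume "{p. mean_curv p > 0} = {}"
    then have "\<not> mean_curv p > 0" for p
      by auto
    then have "mean_curv p = -1 * q p" for p
      using e[of p] q_pos[of p] by (metis mult_minus1)
    then show ?thesis
      using that[of "-1"] by (simp add: q_def)
  next
    assume "{p. mean_curv p < 0} = {}"
    then have "\<not> mean_curv p < 0" for p
      by auto
    then have "mean_curv p = 1 * q p" for p
      using e[of p] q_pos[of p] by (metis mult_1 neg_less_0_iff_less)
    then show ?thesis
      using that[of 1] by (simp add: q_def)
  qed
qed

lemma grad_mean_curvature:
  assumes "p $ 1 \<noteq> 0"
  shows "grad warped_metric (mean_curvature warped_metric \<Phi> \<eta>) p \<noteq> 0"
proof
  assume "grad warped_metric (mean_curvature warped_metric \<Phi> \<eta>) p = 0"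
  then have "grad warped_metric mean_curv p $ 1 = 0"
    by (simp add: mean_curvature_eq)
  then show False
    using pd_mean_curv_off_axis[OF assms] by (simp add: grad_def sum_2 ginv_warped_metric)
qed

end

section \<open>Unit normals and congruence\<close>

text \<open>The triple cross product of Minkowski space: \<open>lor (lcross a b c) d\<close> is the
  determinant of \<open>a\<close>, \<open>b\<close>, \<open>c\<close>, \<open>d\<close>.\<close>

definition lcross :: "minkowski \<Rightarrow> minkowski \<Rightarrow> minkowski \<Rightarrow> minkowski" where
  "lcross a b c = (snd a \<bullet> cross3 (snd b) (snd c),
     fst a *\<^sub>R cross3 (snd b) (snd c) + fst b *\<^sub>R cross3 (snd c) (snd a) + fst c *\<^sub>R cross3 (snd a) (snd b))"

lemma lor_lcross:
  "lor (lcross a b c) a = 0" "lor (lcross a b c) b = 0" "lor (lcross a b c) c = 0"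
  by (simp_all add: lcross_def lor_def cross3_simps)

text \<open>Minus the Gram determinant, with the sign of the Lorentz signature. Three orthonormal
  vectors, one of them timelike, have Gram determinant -1, so their product is a spacelike unit
  vector.\<close>

lemma lor_lcross_lcross:
  "lor (lcross a b c) (lcross a b c) =
     - (lor a a * lor b b * lor c c + 2 * lor a b * lor b c * lor a c
        - lor a a * (lor b c)\<^sup>2 - lor b b * (lor a c)\<^sup>2 - lor c c * (lor a b)\<^sup>2)"
proof -
  obtain a0 a' b0 b' c0 c' where abc: "a = (a0, a')" "b = (b0, b')" "c = (c0, c')"
    by (cases a, cases b, cases c) auto
  show ?thesis
    by (simp add: abc lcross_def lor_def cross3_def inner_vec_def sum_3) algebra
qed

lemma bounded_bilinear_cross3: "bounded_bilinear cross3"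
  using bilinear_cross by (simp add: bilinear_conv_bounded_bilinear)

lemma smooth_lcross:
  assumes "smooth F" "smooth H" "smooth K"
  shows "smooth (\<lambda>p. lcross (F p) (H p) (K p))"
proof -
  have fs: "smooth (\<lambda>p. fst (X p))" "smooth (\<lambda>p. snd (X p))" if "smooth X" for X :: "real^2 \<Rightarrow> minkowski"
    using that by (auto intro: smooth_linear bounded_linear_fst bounded_linear_snd)
  have "smooth (\<lambda>p. (0::real, x p)::minkowski)" if "smooth x" for x
    by (rule smooth_linear[OF _ that]) (intro bounded_linear_Pair bounded_linear_zero bounded_linear_ident)
  moreover have "smooth (\<lambda>p. (x p, 0)::minkowski)" if "smooth x" for x
    by (rule smooth_linear[OF _ that]) (intro bounded_linear_Pair bounded_linear_zero bounded_linear_ident)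
  ultimately have "smooth (\<lambda>p. (x p, 0) + (0, y p) :: minkowski)" if "smooth x" "smooth y" for x y
    using that by (intro smooth_add)
  then have pair: "smooth (\<lambda>p. (x p, y p) :: minkowski)" if "smooth x" "smooth y" for x y
    using that by simp
  show ?thesis
    unfolding lcross_def
    by (intro pair smooth_add smooth_scaleR smooth_bilinear[OF bounded_bilinear_inner]
        smooth_bilinear[OF bounded_bilinear_cross3] fs assms)
qed

text \<open>The coordinate frame is global, so one triple product gives a normal on the whole plane;
  the factor z^3 = 1/\<Gamma> normalises the second tangent vector.\<close>

lemma (in warp_profile) unit_normal_field_exists:
  assumes "isometric_immersion warped_metric \<Phi>"
  shows "\<exists>\<eta>. unit_normal_field \<Phi> \<eta>"
proof
  define \<eta> where "\<eta> p = lcross (\<Phi> p) (pd 1 \<Phi> p) (zp p ^ 3 *\<^sub>R pd 2 \<Phi> p)" for p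
  have sm: "smooth \<Phi>"
    using assms by (simp add: isometric_immersion_def)
  have l\<Phi>: "lor (\<Phi> p) (\<Phi> p) = -1" for p
    using assms by (auto simp: isometric_immersion_def H3_def)
  have lg: "lor (pd i \<Phi> p) (pd j \<Phi> p) = warped_metric p $ i $ j" for i j p
    using assms by (simp add: isometric_immersion_def)
  have "lor (pd i \<Phi> p) (\<Phi> p) = 0 - lor (\<Phi> p) (pd i \<Phi> p)" for i p
    using lor_pd_left[OF sm sm ext[OF l\<Phi>]] by simp
  then have l\<Phi>i: "lor (\<Phi> p) (pd i \<Phi> p) = 0" for i p
    using lor_commute[of "pd i \<Phi> p" "\<Phi> p"] by simp
  have "(zp p ^ 3) * (zp p ^ 3 * (Gp p)\<^sup>2) = 1" for p
    using z_ne[of "p $ 1"] by (simp add: G_eq field_simps power2_eq_square)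
  then have "lor (\<eta> p) (\<eta> p) = 1" for p
    unfolding \<eta>_def lor_lcross_lcross by (simp add: l\<Phi> l\<Phi>i lg warped_metric_def lor.scaleR_left lor.scaleR_right)
  moreover have "lor (\<eta> p) (\<Phi> p) = 0" "lor (\<eta> p) (pd 1 \<Phi> p) = 0" for p
    by (simp_all add: \<eta>_def lor_lcross)
  moreover have "lor (\<eta> p) (pd 2 \<Phi> p) = 0" for p
  proof -
    have "lor (\<eta> p) (zp p ^ 3 *\<^sub>R pd 2 \<Phi> p) = 0"
      by (simp only: \<eta>_def lor_lcross)
    then show ?thesis
      using z_ne[of "p $ 1"] by (simp add: lor.scaleR_right)
  qed
  moreover have "smooth \<eta>"
    unfolding \<eta>_def[abs_def] by (intro smooth_lcross smooth_scaleR smooth_power smooth_profile smooth_pd sm)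
  ultimately show "unit_normal_field \<Phi> \<eta>"
    by (simp add: unit_normal_field_def forall_2)
qed

section \<open>The two sheets of the hyperboloid\<close>

lemma lor_nondegenerate:
  assumes "\<And>w. lor v w = 0"
  shows "v = 0"
  \<comment> \<open>Flipping the time component turns the Lorentz form into the Euclidean
    one.\<close>
  using assms[of "(- fst v, snd v)"]
  by (simp add: lor_def power2_eq_square[symmetric] prod_eq_iff add_nonneg_eq_0_iff flip: power2_norm_eq_inner)

lemma norm_snd_less_abs_fst:
  assumes "lor x x = -1"
  shows "norm (snd x) < \<bar>fst x\<bar>"
proof -
  have "(norm (snd x))\<^sup>2 < \<bar>fst x\<bar>\<^sup>2"
    using assms by (simp add: lor_def power2_norm_eq_inner flip: power2_eq_square)
  then show ?thesis
    by (rule power_less_imp_less_base) simp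
qed

text \<open>On the hyperboloid the time component exceeds the spatial norm, so by Cauchy-Schwarz it
  decides the sign of \<open>lor x y\<close>. A single inner product thus tells whether a Lorentz
  map preserves the upper sheet.\<close>

lemma H3_iff_lor_neg:
  assumes x: "lor x x = -1" and y: "y \<in> H3"
  shows "x \<in> H3 \<longleftrightarrow> lor x y < 0"
proof -
  have ny: "norm (snd y) < fst y"
    using norm_snd_less_abs_fst[of y] y by (simp add: H3_def)
  have "norm (snd x) * norm (snd y) < \<bar>fst x\<bar> * fst y"
    using norm_snd_less_abs_fst[OF x] ny by (intro mult_strict_mono) (auto intro: le_less_trans[OF norm_ge_zero])
  then have i: "\<bar>snd x \<bullet> snd y\<bar> < \<bar>fst x\<bar> * fst y"
    using Cauchy_Schwarz_ineq2[of "snd x" "snd y"] by linarith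
  show ?thesis
  proof (cases "fst x > 0")
    case True
    then show ?thesis
      using i x by (simp add: lor_def H3_def)
  next
    case False
    then have "\<bar>fst x\<bar> * fst y = - (fst x * fst y)"
      by simp
    then show ?thesis
      using i False by (simp add: lor_def H3_def)
  qed
qed

section \<open>Congruence of immersions with equal second forms\<close>

locale congruent_profiles =
  A: immersed_profile C G G1 z \<Phi> \<eta> + B: immersed_profile C G G1 z \<Psi> \<nu>
  for C G G1 z \<Phi> \<eta> \<Psi> \<nu> +
  assumes second_form_eq: "A.second_form i j p = B.second_form i j p"
begin

text \<open>The linear map that takes the adapted frame of \<open>\<Phi>\<close> at \<open>p\<close>
  to that of \<open>\<Psi>\<close> at \<open>p\<close>, with the coefficients of
  \<open>frame_expansion\<close>.\<close>

definition transport :: "real^2 \<Rightarrow> minkowski \<Rightarrow> minkowski" where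
  "transport p v = - lor v (\<Phi> p) *\<^sub>R \<Psi> p + lor v (pd 1 \<Phi> p) *\<^sub>R pd 1 \<Psi> p
     + (z (p $ 1) ^ 6 * lor v (pd 2 \<Phi> p)) *\<^sub>R pd 2 \<Psi> p + lor v (\<eta> p) *\<^sub>R \<nu> p"

lemma lor_transport_transport: "lor (transport p v) (transport p w) = lor v w"
proof -
  have "lor v w = lor (- lor v (\<Phi> p) *\<^sub>R \<Phi> p + lor v (pd 1 \<Phi> p) *\<^sub>R pd 1 \<Phi> p
     + (z (p $ 1) ^ 6 * lor v (pd 2 \<Phi> p)) *\<^sub>R pd 2 \<Phi> p + lor v (\<eta> p) *\<^sub>R \<eta> p) w"
    by (rule arg_cong[where f = "\<lambda>u. lor u w"]) (rule A.frame_expansion)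
  moreover have "z (p $ 1) ^ 6 * (z (p $ 1) ^ 6 * (G (p $ 1))\<^sup>2) = z (p $ 1) ^ 6"
    by (simp add: A.G_z_powers)
  ultimately show ?thesis
    by (simp add: transport_def lor_simps B.lor_\<Phi>_\<Phi> B.lor_\<Phi>_pd B.lor_\<eta> B.lor_pd_pd
        lor_commute[of "\<Phi> p" w] lor_commute[of "\<eta> p" w] lor_commute[of "pd _ \<Phi> p" w] algebra_simps)
qed

lemma transport_\<Phi>: "transport p (\<Phi> p) = \<Psi> p"
  by (simp add: transport_def A.lor_\<Phi>_\<Phi> A.lor_\<Phi>_pd A.lor_\<eta>)

text \<open>Both frames obey the same linear first-order system, since the metric and the second
  forms agree; hence the frame change has zero derivative. Pairing with a fixed \<open>w\<close>
  reduces this to a real function, and nondegeneracy of \<open>lor\<close> returns to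
  vectors.\<close>

lemma transport_constant: "transport p v = transport 0 v"
proof -
  have "lor (transport p v) w = lor (transport 0 v) w" for w
  proof -
    define k where "k p = lor (transport p v) w" for p
    have k: "k = (\<lambda>p. - (lor v (\<Phi> p) * lor (\<Psi> p) w) + lor v (pd 1 \<Phi> p) * lor (pd 1 \<Psi> p) w
      + z (p $ 1) ^ 6 * (lor v (pd 2 \<Phi> p) * lor (pd 2 \<Psi> p) w) + lor v (\<eta> p) * lor (\<nu> p) w)"
      by (simp add: k_def transport_def lor.add_left lor.minus_left lor.diff_left lor.scaleR_left fun_eq_iff)
    have sl: "smooth (\<lambda>p. lor v (F p))" "smooth (\<lambda>p. lor (F p) w)" if "smooth F" for F
      using that by (auto intro: smooth_lor smooth_const)
    have pl: "pd i (\<lambda>p. lor v (F p)) p = lor v (pd i F p)" "pd i (\<lambda>p. lor (F p) w) p = lor (pd i F p) w"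
      if "smooth F" for F i p
      using smooth_differentiable[OF that]
      by (auto intro: pd_linear lor.bounded_linear_left lor.bounded_linear_right)
    have pp: "pd i (\<lambda>p. lor v (F p) * lor (H p) w) p = lor v (pd i F p) * lor (H p) w + lor v (F p) * lor (pd i H p) w"
      if "smooth F" "smooth H" for F H i p
      using that by (subst pd_mult) (auto intro: smooth_differentiable sl simp: pl)
    have sp: "smooth (\<lambda>p. lor v (F p) * lor (H p) w)" if "smooth F" "smooth H" for F H
      using that by (intro smooth_mult sl)
    have pz: "pd i (\<lambda>p. z (p $ 1) ^ 6) p = (if i = 1 then - 2 * z (p $ 1) ^ 9 * G1 (p $ 1) else 0)" for i p
    proof -
      have "((\<lambda>w. z w ^ 6) has_vector_derivative - 2 * z x ^ 9 * G1 x) (at x)" for x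
        using DERIV_power[OF A.DERIV_z[of x], of 6]
        by (simp add: has_real_derivative_iff_has_vector_derivative[symmetric] power_numeral_reduce ac_simps)
      then show ?thesis
        by (subst pd_coord) auto
    qed
    note sms = sp A.smooths B.smooths smooth_minus smooth_add smooth_diff smooth_mult smooth_power
    have smk: "smooth k"
      unfolding k by (intro sms)
    have pdk: "pd i k p = - (lor v (pd i \<Phi> p) * lor (\<Psi> p) w + lor v (\<Phi> p) * lor (pd i \<Psi> p) w)
      + (lor v (pd i (pd 1 \<Phi>) p) * lor (pd 1 \<Psi> p) w + lor v (pd 1 \<Phi> p) * lor (pd i (pd 1 \<Psi>) p) w)
      + ((if i = 1 then - 2 * z (p $ 1) ^ 9 * G1 (p $ 1) else 0) * (lor v (pd 2 \<Phi> p) * lor (pd 2 \<Psi> p) w)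
         + z (p $ 1) ^ 6 * (lor v (pd i (pd 2 \<Phi>) p) * lor (pd 2 \<Psi> p) w + lor v (pd 2 \<Phi> p) * lor (pd i (pd 2 \<Psi>) p) w))
      + (lor v (pd i \<eta> p) * lor (\<nu> p) w + lor v (\<eta> p) * lor (pd i \<nu> p) w)" for i p
      unfolding k
      by (simp add: pd_add pd_diff pd_minus pd_mult[of "\<lambda>p. z (p $ 1) ^ 6"] pz pp sms smooth_differentiable)
    have z9: "z (p $ 1) ^ 9 = z (p $ 1) ^ 6 * z (p $ 1) ^ 3" for p :: "real^2"
      by (simp flip: power_add)
    have z6: "z (p $ 1) ^ 3 = z (p $ 1) ^ 6 * G (p $ 1)" for p :: "real^2"
      using A.z_ne[of "p $ 1"] by (simp add: A.G_eq field_simps flip: power_add)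
    have z66: "z (p $ 1) ^ 6 * (G (p $ 1))\<^sup>2 = 1" for p :: "real^2"
      by (rule A.G_z_powers)
    have "pd 1 k p = 0" for p
      unfolding pdk z9
      by (simp add: A.pd2_\<Phi> B.pd2_\<Phi> A.pd_\<eta> B.pd_\<eta> second_form_eq lor_simps)
        (simp add: algebra_simps)
    moreover have "pd 2 k p = 0" for p
    proof -
      have e: "(G (p $ 1))\<^sup>2 * z (p $ 1) ^ 6 = 1"
        using z66[of p] by (simp add: mult.commute)
      show ?thesis
        unfolding pdk A.pd_21 B.pd_21
        by (simp add: A.pd2_\<Phi> B.pd2_\<Phi> A.pd_\<eta> B.pd_\<eta> second_form_eq A.second_form_21 B.second_form_21 lor_simps z6)
          (simp add: algebra_simps e)
    qed
    ultimately have "(k has_derivative (\<lambda>h. 0)) (at p)" for p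
      using has_derivative_pd_sum[OF smooth_differentiable[OF smk], of p] by simp
    then have "\<exists>c. \<forall>p\<in>UNIV. k p = c"
      by (intro has_derivative_zero_constant) (auto)
    then show ?thesis
      by (auto simp: k_def)
  qed
  then have "transport p v - transport 0 v = 0"
    by (intro lor_nondegenerate) (simp add: lor.diff_left)
  then show ?thesis
    by simp
qed

lemma transport_H3: "x \<in> H3 \<Longrightarrow> transport 0 x \<in> H3"
proof -
  assume x: "x \<in> H3"
  have \<Phi>: "\<Phi> 0 \<in> H3" and \<Psi>: "\<Psi> 0 \<in> H3"
    using A.isometric B.isometric by (auto simp: isometric_immersion_def)
  have "lor x (\<Phi> 0) < 0"
    using H3_iff_lor_neg[OF _ \<Phi>, of x] x by (simp add: H3_def)
  then have "lor (transport 0 x) (\<Psi> 0) < 0"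
    using lor_transport_transport[of 0 x "\<Phi> 0"] by (simp add: transport_\<Phi>)
  then show "transport 0 x \<in> H3"
    using H3_iff_lor_neg[OF _ \<Psi>, of "transport 0 x"] x by (simp add: H3_def lor_transport_transport)
qed

end

text \<open>The constant frame change is the isometry; exchanging the two immersions provides its
  inverse.\<close>

lemma (in congruent_profiles) congruent:
  "\<exists>F. isometry_H3 F \<and> (\<forall>p. \<Psi> p = F (\<Phi> p))"
proof (intro exI conjI allI)
  interpret R: congruent_profiles C G G1 z \<Psi> \<nu> \<Phi> \<eta>
    by unfold_locales (simp add: second_form_eq)
  have z0: "z 0 ^ 6 * (G 0)\<^sup>2 = 1"
    using A.G_z_powers(1)[of 0] by simp
  have 1: "R.transport 0 (transport 0 v) = v" for v
    by (rule trans[OF _ A.frame_expansion[of v 0, symmetric]])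
      (simp add: R.transport_def transport_def lor_simps B.lor_\<Phi>_\<Phi> B.lor_\<Phi>_pd B.lor_\<eta> B.lor_pd_pd
        z0)
  have 2: "transport 0 (R.transport 0 v) = v" for v
    by (rule trans[OF _ B.frame_expansion[of v 0, symmetric]])
      (simp add: R.transport_def transport_def lor_simps A.lor_\<Phi>_\<Phi> A.lor_\<Phi>_pd A.lor_\<eta> A.lor_pd_pd
        z0)
  have "bij_betw (transport 0) H3 H3"
    by (rule bij_betw_byWitness[where f' = "R.transport 0"])
      (auto simp: 1 2 intro: transport_H3 R.transport_H3)
  then show "isometry_H3 (transport 0)"
    by (simp add: isometry_H3_def hdist_def lor_transport_transport)
  show "\<Psi> p = transport 0 (\<Phi> p)" for p
    using transport_\<Phi>[of p] transport_constant[of p] by simp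
qed

section \<open>Linear differential equations\<close>

lemma antiderivative_exists:
  fixes g :: "real \<Rightarrow> 'a::euclidean_space"
  assumes "continuous_on UNIV g"
  shows "\<exists>F. F 0 = 0 \<and> (\<forall>t. (F has_vector_derivative g t) (at t))"
proof (rule exI[of _ "\<lambda>u. LBINT y=ereal 0..ereal u. g y"], intro conjI allI)
  show "(LBINT y=ereal 0..ereal 0. g y) = 0"
    by (rule interval_integral_endpoints_same)
  fix t :: real
  \<comment> \<open>A symmetric interval with 0 and \<open>t\<close> in its interior treats both
    signs of \<open>t\<close> at once.\<close>
  have "((\<lambda>u. LBINT y=ereal 0..ereal u. g y) has_vector_derivative g t) (at t within {- \<bar>t\<bar> - 1..\<bar>t\<bar> + 1})"
    by (rule interval_integral_FTC2) (auto intro: continuous_on_subset[OF assms])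
  then show "((\<lambda>u. LBINT y=ereal 0..ereal u. g y) has_vector_derivative g t) (at t)"
    by (subst (asm) at_within_interior) (auto simp: interior_atLeastAtMost_real)
qed

text \<open>Each integration raises the power by one and divides by the new exponent; iterated, this
  produces the factorials of the Picard series. Negative \<open>t\<close> are reduced to positive
  ones by reflection.\<close>

lemma antiderivative_power_bound:
  fixes f :: "real \<Rightarrow> 'a::real_normed_vector"
  assumes "\<And>s. (f has_vector_derivative f' s) (at s)" "f 0 = 0"
    and "\<And>s. \<bar>s\<bar> \<le> N \<Longrightarrow> norm (f' s) \<le> c * \<bar>s\<bar> ^ n" and t: "\<bar>t\<bar> \<le> N"
  shows "norm (f t) \<le> c * \<bar>t\<bar> ^ Suc n / Suc n"
proof -
  have pos: "norm (f t) \<le> c * \<bar>t\<bar> ^ Suc n / Suc n"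
    if d: "\<And>s. (f has_vector_derivative f' s) (at s)" and 0: "f 0 = 0"
      and b: "\<And>s. \<bar>s\<bar> \<le> N \<Longrightarrow> norm (f' s) \<le> c * \<bar>s\<bar> ^ n" and t: "0 < t" "t \<le> N"
    for f f' :: "real \<Rightarrow> 'a" and t
  proof -
    have "norm (f t - f 0) \<le> c * t ^ Suc n / Suc n - c * 0 ^ Suc n / Suc n"
    proof (rule differentiable_bound_general[OF t(1), where f' = f' and \<phi>' = "\<lambda>s. c * s ^ n"])
      show "continuous_on {0..t} f"
        using d by (meson continuous_at_imp_continuous_on has_vector_derivative_continuous)
      show "continuous_on {0..t} (\<lambda>s. c * s ^ Suc n / Suc n)"
        by (intro continuous_intros) auto
      fix s assume s: "0 < s" "s < t"
      show "(f has_vector_derivative f' s) (at s)"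
        by (rule d)
      show "norm (f' s) \<le> c * s ^ n"
        using b[of s] s t by simp
      have "((\<lambda>s. c * s ^ Suc n / Suc n) has_real_derivative c * s ^ n) (at s)"
        using DERIV_cmult[OF DERIV_pow[of "Suc n" s], of "c / Suc n"] by simp
      then show "((\<lambda>s. c * s ^ Suc n / Suc n) has_vector_derivative c * s ^ n) (at s)"
        by (simp only: has_real_derivative_iff_has_vector_derivative)
    qed
    then show ?thesis
      using 0 t by simp
  qed
  show ?thesis
  proof (cases "t > 0")
    case True
    then show ?thesis
      using pos[OF assms(1-3), of t] t by simp
  next
    case False
    have d: "((\<lambda>s. f (- s)) has_vector_derivative - f' (- s)) (at s)" for s
      using vector_diff_chain_at[of uminus "-1" s f "f' (- s)"] assms(1)[of "- s"]
      by (simp add: o_def has_vector_derivative_minus[OF has_vector_derivative_id, simplified])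
    have b: "norm (- f' (- s)) \<le> c * \<bar>s\<bar> ^ n" if "\<bar>s\<bar> \<le> N" for s
      using assms(3)[of "- s"] that by simp
    have "norm (f (- (- t))) \<le> c * \<bar>- t\<bar> ^ Suc n / Suc n" if "t \<noteq> 0"
      by (rule pos[OF d _ b]) (use assms(2) t False that in auto)
    then show ?thesis
      using assms(2) by (cases "t = 0") auto
  qed
qed

text \<open>Picard iteration written as a series: each term integrates \<open>B (a t)\<close>
  applied to the previous one. On a bounded interval the \<open>n\<close>-th term is at most a
  constant times \<open>(K * N) ^ n / fact n\<close>, so the series may be differentiated termwise;
  linearity makes the solution global.\<close>

lemma linear_ode_exists:
  fixes B :: "'b::real_normed_vector \<Rightarrow> 'a::euclidean_space \<Rightarrow> 'a"
  assumes B: "bounded_bilinear B" and a: "continuous_on UNIV a"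
  shows "\<exists>x. x 0 = x0 \<and> (\<forall>t. (x has_vector_derivative B (a t) (x t)) (at t))"
proof -
  interpret B: bounded_bilinear B
    by (rule B)
  define I where "I g = (SOME F. F 0 = 0 \<and> (\<forall>t. (F has_vector_derivative g t) (at t)))"
    for g :: "real \<Rightarrow> 'a"
  have I: "I g 0 = 0" "(I g has_vector_derivative g t) (at t)" if "continuous_on UNIV g" for g t
    using someI_ex[OF antiderivative_exists[OF that]] unfolding I_def by auto
  define X where "X = rec_nat (\<lambda>t. x0) (\<lambda>n F. I (\<lambda>t. B (a t) (F t)))"
  have X0: "X 0 = (\<lambda>t. x0)" and XS: "X (Suc n) = I (\<lambda>t. B (a t) (X n t))" for n
    by (simp_all add: X_def)
  have contX: "continuous_on UNIV (X n)" for n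
  proof (induction n)
    case (Suc n)
    then have "continuous_on UNIV (\<lambda>t. B (a t) (X n t))"
      by (intro B.continuous_on a)
    from I(2)[OF this] show ?case
      unfolding XS by (meson continuous_at_imp_continuous_on has_vector_derivative_continuous)
  qed (simp add: X0)
  have contBX: "continuous_on UNIV (\<lambda>t. B (a t) (X n t))" for n
    by (intro B.continuous_on a contX)
  note dX = I(2)[OF contBX, folded XS] and X_at_0 = I(1)[OF contBX, folded XS]
  define X' where "X' n t = (case n of 0 \<Rightarrow> 0 | Suc m \<Rightarrow> B (a t) (X m t))" for n t
  have dX': "(X n has_vector_derivative X' n t) (at t)" for n t
    by (cases n) (simp_all add: X'_def dX X0)
  have local: "\<exists>K \<ge> 0. (\<forall>s. \<bar>s\<bar> \<le> N \<longrightarrow> (\<forall>v. norm (B (a s) v) \<le> K * norm v))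
      \<and> (\<forall>n s. \<bar>s\<bar> \<le> N \<longrightarrow> norm (X n s) \<le> norm x0 * ((K * N) ^ n / fact n))" if "N \<ge> 0" for N
  proof -
    have "compact (a ` {-N..N})"
      by (intro compact_continuous_image continuous_on_subset[OF a]) auto
    then obtain M where M: "\<And>s. s \<in> {-N..N} \<Longrightarrow> norm (a s) \<le> M"
      using compact_imp_bounded by (fastforce simp: bounded_iff)
    obtain L where L: "L \<ge> 0" "\<And>b v. norm (B b v) \<le> norm b * norm v * L"
      using B.nonneg_bounded by blast
    define K where "K = \<bar>M\<bar> * L"
    have K: "norm (B (a s) v) \<le> K * norm v" if "\<bar>s\<bar> \<le> N" for s v
    proof -
      have "norm (a s) \<le> \<bar>M\<bar>"
        using M[of s] that by (auto simp: abs_le_iff)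
      then have "norm (a s) * norm v * L \<le> \<bar>M\<bar> * norm v * L"
        using L(1) by (intro mult_right_mono) auto
      then show ?thesis
        using L(2)[of "a s" v] by (simp add: K_def mult.commute mult.left_commute)
    qed
    have K0: "K \<ge> 0"
      using L(1) by (simp add: K_def)
    have b: "norm (X n s) \<le> norm x0 * K ^ n / fact n * \<bar>s\<bar> ^ n" if "\<bar>s\<bar> \<le> N" for n s
      using that
    proof (induction n arbitrary: s)
      case (Suc n)
      have "norm (X (Suc n) s) \<le> (K * (norm x0 * K ^ n / fact n)) * \<bar>s\<bar> ^ Suc n / Suc n"
      proof (rule antiderivative_power_bound[OF dX X_at_0 _ Suc.prems])
        fix r :: real assume "\<bar>r\<bar> \<le> N"
        then show "norm (B (a r) (X n r)) \<le> (K * (norm x0 * K ^ n / fact n)) * \<bar>r\<bar> ^ n"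
          using order_trans[OF K mult_left_mono[OF Suc.IH K0]] by (simp add: mult.assoc)
      qed
      then show ?case
        by (simp add: field_simps)
    qed (simp add: X0)
    have "norm (X n s) \<le> norm x0 * ((K * N) ^ n / fact n)" if "\<bar>s\<bar> \<le> N" for n s
    proof -
      have "norm x0 * K ^ n / fact n * \<bar>s\<bar> ^ n \<le> norm x0 * K ^ n / fact n * N ^ n"
        using K0 that by (intro mult_left_mono power_mono) auto
      then show ?thesis
        using b[OF that, of n] by (simp add: power_mult_distrib mult.assoc)
    qed
    with K K0 show ?thesis
      by blast
  qed
  have summ: "summable (\<lambda>n. norm x0 * ((K * N) ^ n / fact n))" for K N :: real
    using summable_exp[of "K * N"] by (intro summable_mult) (simp add: divide_inverse mult.commute)
  define x where "x t = (\<Sum>n. X n t)" for t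
  have sumX: "(\<lambda>n. X n t) sums x t" for t
  proof -
    obtain K where "\<forall>n s. \<bar>s\<bar> \<le> \<bar>t\<bar> \<longrightarrow> norm (X n s) \<le> norm x0 * ((K * \<bar>t\<bar>) ^ n / fact n)"
      using local[of "\<bar>t\<bar>"] by auto
    then have "summable (\<lambda>n. X n t)"
      by (intro summable_comparison_test'[OF summ, where N = 0]) auto
    then show ?thesis
      by (simp add: x_def summable_sums)
  qed
  have "(x has_vector_derivative B (a t) (x t)) (at t)" for t
  proof -
    define N where "N = \<bar>t\<bar> + 1"
    define S where "S = {-N<..<N}"
    have N: "N \<ge> 0" and tS: "t \<in> S"
      by (auto simp: N_def S_def)
    obtain K where K: "K \<ge> 0" "\<And>s v. \<bar>s\<bar> \<le> N \<Longrightarrow> norm (B (a s) v) \<le> K * norm v"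
      "\<And>n s. \<bar>s\<bar> \<le> N \<Longrightarrow> norm (X n s) \<le> norm x0 * ((K * N) ^ n / fact n)"
      using local[OF N] by blast
    have ul: "uniform_limit S (\<lambda>n s. \<Sum>i<n. X i s) (\<lambda>s. \<Sum>i. X i s) sequentially"
      by (rule Weierstrass_m_test[OF K(3) summ]) (auto simp: S_def)
    have "\<exists>g. \<forall>s\<in>S. (\<lambda>n. X n s) sums g s \<and> (g has_derivative (\<lambda>h. h *\<^sub>R B (a s) (x s))) (at s within S)"
    proof (rule has_derivative_series[OF _ _ _ tS sumX])
      show "convex S"
        by (simp add: S_def)
      show "(X n has_derivative (\<lambda>h. h *\<^sub>R X' n s)) (at s within S)" for n s
        using dX'[of n s] by (auto simp: has_vector_derivative_def intro: has_derivative_at_withinI)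
      fix e :: real assume e: "e > 0"
      have "\<forall>\<^sub>F n in sequentially. \<forall>s\<in>S. dist (\<Sum>i<n. X i s) (\<Sum>i. X i s) < e / (K + 1)"
        using ul e K(1) by (intro uniform_limitD) auto
      \<comment> \<open>The zeroth term is constant, so the derivative of the partial sum up to
        \<open>n\<close> is \<open>B\<close> applied to the partial sum up to
        \<open>n - 1\<close>.\<close>
      then have "\<forall>\<^sub>F n in sequentially. \<forall>s\<in>S. dist (\<Sum>i<n - 1. X i s) (\<Sum>i. X i s) < e / (K + 1)"
        by (rule eventually_compose_filterlim) (rule filterlim_minus_const_nat_at_top)
      then show "\<forall>\<^sub>F n in sequentially. \<forall>s\<in>S. \<forall>h. norm ((\<Sum>i<n. h *\<^sub>R X' i s) - h *\<^sub>R B (a s) (x s)) \<le> e * norm h"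
        using eventually_gt_at_top[of 0]
      proof eventually_elim
        case (elim n)
        show ?case
        proof (intro ballI allI)
          fix s h assume s: "s \<in> S"
          obtain m where n: "n = Suc m"
            using elim(2) gr0_conv_Suc by blast
          have "(\<Sum>i<n. h *\<^sub>R X' i s) = h *\<^sub>R B (a s) (\<Sum>i<m. X i s)"
            unfolding n sum.lessThan_Suc_shift
            by (simp add: X'_def B.sum_right scaleR_sum_right)
          then have "norm ((\<Sum>i<n. h *\<^sub>R X' i s) - h *\<^sub>R B (a s) (x s))
              = norm h * norm (B (a s) ((\<Sum>i<m. X i s) - x s))"
            by (simp add: B.diff_right flip: scaleR_diff_right)
          also have "\<dots> \<le> norm h * (K * norm ((\<Sum>i<m. X i s) - x s))"
            using s by (intro mult_left_mono K(2)) (auto simp: S_def)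
          also have "\<dots> \<le> norm h * (K * (e / (K + 1)))"
            using elim(1) s K(1)
            by (intro mult_left_mono) (auto simp: n x_def dist_norm intro: less_imp_le)
          also have "\<dots> \<le> norm h * e"
            using K(1) e by (intro mult_left_mono) (auto simp: field_simps)
          finally show "norm ((\<Sum>i<n. h *\<^sub>R X' i s) - h *\<^sub>R B (a s) (x s)) \<le> e * norm h"
            by (simp add: mult.commute)
        qed
      qed
    qed
    then obtain g where g: "\<And>s. s \<in> S \<Longrightarrow> (\<lambda>n. X n s) sums g s"
      "\<And>s. s \<in> S \<Longrightarrow> (g has_derivative (\<lambda>h. h *\<^sub>R B (a s) (x s))) (at s within S)"
      by blast
    have gx: "g s = x s" if "s \<in> S" for s
      using g(1)[OF that] sumX sums_unique2 by blast
    have "open S"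
      by (simp add: S_def)
    then have "(g has_derivative (\<lambda>h. h *\<^sub>R B (a t) (x t))) (at t)"
      using g(2)[OF tS] at_within_open[OF tS] by simp
    then have "(x has_derivative (\<lambda>h. h *\<^sub>R B (a t) (x t))) (at t)"
      using has_derivative_transform_within_open[OF _ \<open>open S\<close> tS] gx by blast
    then show ?thesis
      by (simp add: has_vector_derivative_def)
  qed
  moreover have "x 0 = x0"
  proof -
    have "X n 0 = (if n = 0 then x0 else 0)" for n
      by (cases n) (simp_all add: X0 X_at_0)
    then have "(\<lambda>n. X n 0) = (\<lambda>n. if n = 0 then x0 else 0)"
      by (rule ext)
    then have "(\<lambda>n. X n 0) sums x0"
      using sums_single[of 0 "\<lambda>n. x0"] by simp
    then show ?thesis
      using sumX sums_unique2 by blast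
  qed
  ultimately show ?thesis
    by blast
qed

section \<open>Existence\<close>

text \<open>A right inverse of a square matrix is a left inverse. The row products are conserved by
  the frame equation outright, whereas the column products, which the frame needs, satisfy only a
  coupled system whose solution would call for a uniqueness argument.\<close>

lemma lorentz_rows_imp_columns:
  fixes u v w :: "3 \<Rightarrow> real"
  assumes "\<And>i j. - u i * u j + v i * v j + w i * w j = (if i \<noteq> j then 0 else if i = 1 then -1 else 1)"
  shows "- u 1 * u 1 + u 2 * u 2 + u 3 * u 3 = -1" "- v 1 * v 1 + v 2 * v 2 + v 3 * v 3 = 1"
    "- w 1 * w 1 + w 2 * w 2 + w 3 * w 3 = 1" "- u 1 * v 1 + u 2 * v 2 + u 3 * v 3 = 0"
    "- u 1 * w 1 + u 2 * w 2 + u 3 * w 3 = 0" "- v 1 * w 1 + v 2 * w 2 + v 3 * w 3 = 0"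
proof -
  define X :: "real^3^3" where "X = (\<chi> i. vector [u i, v i, w i])"
  define \<epsilon> :: "3 \<Rightarrow> real" where "\<epsilon> i = (if i = 1 then -1 else 1)" for i
  define Y :: "real^3^3" where "Y = (\<chi> i j. \<epsilon> i * X $ j $ i * \<epsilon> j)"
  have "X ** Y = mat 1"
  proof -
    have "(\<Sum>k\<in>UNIV. X $ i $ k * Y $ k $ j) = \<epsilon> j * (- u i * u j + v i * v j + w i * w j)" for i j
      by (simp add: X_def Y_def \<epsilon>_def sum_3 algebra_simps)
    then have "(\<Sum>k\<in>UNIV. X $ i $ k * Y $ k $ j) = (if i = j then 1 else 0)" for i j
      unfolding assms by (simp add: \<epsilon>_def)
    then show ?thesis
      by (simp add: matrix_matrix_mult_def vec_eq_iff mat_def)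
  qed
  then have "Y ** X = mat 1"
    by (simp add: matrix_left_right_inverse)
  then have "(\<Sum>k\<in>UNIV. Y $ i $ k * X $ k $ j) = (if i = j then 1 else 0)" for i j
    by (simp add: matrix_matrix_mult_def vec_eq_iff mat_def)
  from this[of 1 1] this[of 2 2] this[of 3 3] this[of 2 1] this[of 3 1] this[of 3 2]
  show "- u 1 * u 1 + u 2 * u 2 + u 3 * u 3 = -1" "- v 1 * v 1 + v 2 * v 2 + v 3 * v 3 = 1"
    "- w 1 * w 1 + w 2 * w 2 + w 3 * w 3 = 1" "- u 1 * v 1 + u 2 * v 2 + u 3 * v 3 = 0"
    "- u 1 * w 1 + u 2 * w 2 + u 3 * w 3 = 0" "- v 1 * w 1 + v 2 * w 2 + v 3 * w 3 = 0"
    by (simp_all add: X_def Y_def \<epsilon>_def sum_3 mult.commute)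
qed

text \<open>The profile curve \<open>\<gamma>\<close> with curvature function \<open>\<mu>\<close> in the totally geodesic plane orthogonal to
  the last axis, together with its Frenet frame.\<close>

lemma hyperbolic_plane_curve_exists:
  fixes \<mu> :: "real \<Rightarrow> real"
  assumes "continuous_on UNIV \<mu>"
  obtains \<gamma> e n :: "real \<Rightarrow> minkowski" where
    "\<And>t. (\<gamma> has_vector_derivative e t) (at t)"
    "\<And>t. (e has_vector_derivative \<gamma> t + \<mu> t *\<^sub>R n t) (at t)"
    "\<And>t. (n has_vector_derivative - \<mu> t *\<^sub>R e t) (at t)"
    "\<And>t. lor (\<gamma> t) (\<gamma> t) = -1" "\<And>t. lor (e t) (e t) = 1" "\<And>t. lor (n t) (n t) = 1"
    "\<And>t. lor (\<gamma> t) (e t) = 0" "\<And>t. lor (\<gamma> t) (n t) = 0" "\<And>t. lor (e t) (n t) = 0"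
    "\<And>t. lor (0, axis 3 1) (\<gamma> t) = 0" "\<And>t. lor (0, axis 3 1) (e t) = 0"
    "\<And>t. lor (0, axis 3 1) (n t) = 0" "fst (\<gamma> 0) > 0"
proof -
  define B :: "real \<times> real \<Rightarrow> real \<times> real \<times> real \<Rightarrow> real \<times> real \<times> real" where
    "B = (\<lambda>(c, l) (u, v, w). (c * v, c * u + l * w, - l * v))"
  have "bilinear B"
    unfolding bilinear_def by (intro conjI allI linearI) (auto simp: B_def algebra_simps)
  then have B: "bounded_bilinear B"
    by (simp add: bilinear_conv_bounded_bilinear)
  \<comment> \<open>The index \<open>i\<close> is an ambient coordinate: the \<open>i\<close>-th
    components of the curve, its tangent and its normal solve one system, starting from the standard
    basis.\<close>
  have "\<exists>x. x 0 = (if i = 1 then (1, 0, 0) else if i = 2 then (0, 1, 0) else (0, 0, 1))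
      \<and> (\<forall>t. (x has_vector_derivative B (1, \<mu> t) (x t)) (at t))" for i :: 3
    by (rule linear_ode_exists[OF B]) (intro continuous_intros assms)
  then obtain x where x0: "\<And>i::3. x i 0 = (if i = 1 then (1, 0, 0) else if i = 2 then (0, 1, 0) else (0, 0, 1))"
    and dx: "\<And>i t. (x i has_vector_derivative B (1, \<mu> t) (x i t)) (at t)"
    by metis
  define u where "u i t = fst (x i t)" for i t
  define v where "v i t = fst (snd (x i t))" for i t
  define w where "w i t = snd (snd (x i t))" for i t
  note bl = bounded_linear_fst bounded_linear_compose[OF bounded_linear_fst bounded_linear_snd]
    bounded_linear_compose[OF bounded_linear_snd bounded_linear_snd]
  have du: "(u i has_real_derivative v i t) (at t)" for i t
    using bounded_linear.has_vector_derivative[OF bl(1) dx[of i t]]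
    by (simp add: has_real_derivative_iff_has_vector_derivative B_def u_def[abs_def] v_def split: prod.splits)
  have dv: "(v i has_real_derivative u i t + \<mu> t * w i t) (at t)" for i t
    using bounded_linear.has_vector_derivative[OF bl(2) dx[of i t]]
    by (simp add: has_real_derivative_iff_has_vector_derivative B_def v_def[abs_def] u_def w_def split: prod.splits)
  have dw: "(w i has_real_derivative - \<mu> t * v i t) (at t)" for i t
    using bounded_linear.has_vector_derivative[OF bl(3) dx[of i t]]
    by (simp add: has_real_derivative_iff_has_vector_derivative B_def v_def w_def[abs_def] split: prod.splits)
  \<comment> \<open>Conserved because the coefficient matrix is skew with respect to diag(-1, 1,
    1).\<close>
  have rows: "- u i t * u j t + v i t * v j t + w i t * w j t = (if i \<noteq> j then 0 else if i = 1 then -1 else 1)" for i j t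
  proof -
    have "((\<lambda>t. - u i t * u j t + v i t * v j t + w i t * w j t) has_real_derivative 0) (at t)" for t
      by (rule derivative_eq_intros du dv dw refl)+ (simp add: algebra_simps)
    then have "- u i t * u j t + v i t * v j t + w i t * w j t = - u i 0 * u j 0 + v i 0 * v j 0 + w i 0 * w j 0"
      by (rule DERIV_isconst_all[rule_format])
    also have "\<dots> = (if i \<noteq> j then 0 else if i = 1 then -1 else 1)"
      using exhaust_3[of i] exhaust_3[of j] by (auto simp: u_def v_def w_def x0)
    finally show ?thesis .
  qed
  note columns = lorentz_rows_imp_columns[where u = "\<lambda>i. u i t" and v = "\<lambda>i. v i t" and w = "\<lambda>i. w i t" for t, OF rows]
  \<comment> \<open>The third spatial axis is left free; it becomes the direction in which the
    orbits leave the plane of the curve.\<close>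
  define E :: "(3 \<Rightarrow> real \<Rightarrow> real) \<Rightarrow> real \<Rightarrow> minkowski" where
    "E f t = f 1 t *\<^sub>R (1, 0) + f 2 t *\<^sub>R (0, axis 1 1) + f 3 t *\<^sub>R (0, axis 2 1)" for f t
  have lorE: "lor (E f t) (E f' t) = - f 1 t * f' 1 t + f 2 t * f' 2 t + f 3 t * f' 3 t" for f f' t
    by (simp add: E_def lor_def inner_vec_def sum_3 axis_def)
  have dE: "(E f has_vector_derivative E f' t) (at t)" if "\<And>i. (f i has_real_derivative f' i t) (at t)" for f f' t
    unfolding E_def[abs_def]
    by (intro has_vector_derivative_add)
      (use that in \<open>auto intro!: derivative_eq_intros simp: has_real_derivative_iff_has_vector_derivative\<close>)
  show ?thesis
  proof
    show "(E u has_vector_derivative E v t) (at t)" for t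
      by (rule dE) (rule du)
    show "(E v has_vector_derivative E u t + \<mu> t *\<^sub>R E w t) (at t)" for t
      using dE[of v "\<lambda>i t. u i t + \<mu> t * w i t", OF dv] by (simp add: E_def algebra_simps)
    show "(E w has_vector_derivative - \<mu> t *\<^sub>R E v t) (at t)" for t
      using dE[of w "\<lambda>i t. - \<mu> t * v i t", OF dw] by (simp add: E_def algebra_simps)
    show "lor (0, axis 3 1) (E u t) = 0" "lor (0, axis 3 1) (E v t) = 0" "lor (0, axis 3 1) (E w t) = 0" for t
      by (simp_all add: E_def lor_def inner_vec_def sum_3 axis_def)
    show "fst (E u 0) > 0"
      by (simp add: E_def u_def x0)
  qed (use columns in \<open>auto simp: lorE\<close>)
qed

text \<open>\<open>sn\<close>, \<open>cs\<close> are the sine and cosine of the space form of curvature \<open>\<kappa>\<close>; \<open>vr\<close> is the primitive of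
  \<open>sn\<close>, equal to \<open>(1 - cs) / \<kappa>\<close> when \<open>\<kappa> \<noteq> 0\<close>.\<close>

lemma generalised_trigonometry_exists:
  fixes \<kappa> :: real
  obtains sn cs vr :: "real \<Rightarrow> real" where
    "\<And>t. (sn has_real_derivative cs t) (at t)" "\<And>t. (cs has_real_derivative - \<kappa> * sn t) (at t)"
    "\<And>t. (vr has_real_derivative sn t) (at t)" "\<And>t. cs t = 1 - \<kappa> * vr t"
    "\<And>t. (sn t)\<^sup>2 = 2 * vr t - \<kappa> * (vr t)\<^sup>2" "sn 0 = 0" "vr 0 = 0"
proof -
  define B :: "real \<Rightarrow> real \<times> real \<times> real \<Rightarrow> real \<times> real \<times> real" where
    "B = (\<lambda>r (s, c, v). (r * c, - r * \<kappa> * s, r * s))"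
  have "bilinear B"
    unfolding bilinear_def by (intro conjI allI linearI) (auto simp: B_def algebra_simps)
  then have B: "bounded_bilinear B"
    by (simp add: bilinear_conv_bounded_bilinear)
  have "\<exists>x. x 0 = (0, 1, 0) \<and> (\<forall>t. (x has_vector_derivative B 1 (x t)) (at t))"
    by (rule linear_ode_exists[OF B, of "\<lambda>t. 1"]) (intro continuous_intros)
  then obtain x where x0: "x 0 = (0, 1, 0)" and dx: "\<And>t. (x has_vector_derivative B 1 (x t)) (at t)"
    by metis
  define s where "s t = fst (x t)" for t
  define c where "c t = fst (snd (x t))" for t
  define v where "v t = snd (snd (x t))" for t
  note bl = bounded_linear_fst bounded_linear_compose[OF bounded_linear_fst bounded_linear_snd]
    bounded_linear_compose[OF bounded_linear_snd bounded_linear_snd]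
  have ds: "(s has_real_derivative c t) (at t)" for t
    using bounded_linear.has_vector_derivative[OF bl(1) dx[of t]]
    by (simp add: has_real_derivative_iff_has_vector_derivative B_def s_def[abs_def] c_def split: prod.splits)
  have dc: "(c has_real_derivative - \<kappa> * s t) (at t)" for t
    using bounded_linear.has_vector_derivative[OF bl(2) dx[of t]]
    by (simp add: has_real_derivative_iff_has_vector_derivative B_def c_def[abs_def] s_def split: prod.splits)
  have dv: "(v has_real_derivative s t) (at t)" for t
    using bounded_linear.has_vector_derivative[OF bl(3) dx[of t]]
    by (simp add: has_real_derivative_iff_has_vector_derivative B_def v_def[abs_def] s_def split: prod.splits)
  have "((\<lambda>t. c t + \<kappa> * v t) has_real_derivative 0) (at t)" for t
    by (rule derivative_eq_intros dc dv refl)+ simp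
  then have "c t + \<kappa> * v t = c 0 + \<kappa> * v 0" for t
    by (rule DERIV_isconst_all[rule_format])
  then have c: "c t = 1 - \<kappa> * v t" for t
    by (simp add: c_def v_def x0 algebra_simps)
  \<comment> \<open>The counterpart of \<kappa> sn^2 + cs^2 = 1, phrased through \<open>v\<close> so
    that it stays informative for \<kappa> = 0.\<close>
  have "((\<lambda>t. s t * s t - 2 * v t + \<kappa> * (v t * v t)) has_real_derivative 0) (at t)" for t
    by (rule derivative_eq_intros ds dv refl)+ (simp add: c algebra_simps)
  then have "s t * s t - 2 * v t + \<kappa> * (v t * v t) = s 0 * s 0 - 2 * v 0 + \<kappa> * (v 0 * v 0)" for t
    by (rule DERIV_isconst_all[rule_format])
  then have "(s t)\<^sup>2 = 2 * v t - \<kappa> * (v t)\<^sup>2" for t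
    by (simp add: s_def v_def x0 power2_eq_square algebra_simps)
  then show ?thesis
    using that[OF ds dc dv c] by (simp add: s_def v_def x0)
qed

context warp_profile
begin

text \<open>The surface is the orbit of a plane curve under a one-parameter group fixing the vector \<open>W\<close>,
  which is rotational, parabolic or hyperbolic according to the sign of \<open>\<langle>W, W\<rangle> = C / 3\<close>.\<close>

lemma biconservative_immersion_exists:
  obtains \<Phi> \<eta> where "biconservative_profile C G G1 z \<Phi> \<eta>"
    "\<And>p. immersed_profile.mean_curv z \<Phi> \<eta> p = 2 / (3 * sqrt 3) * zp p ^ 4"
proof -
  \<comment> \<open>The positive root of 4/27: the mean curvature to be realised is c z^4.\<close>
  define c :: real where "c = 2 / (3 * sqrt 3)"
  have c_sq: "c * c = 4 / 27"
    by (simp add: c_def)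
  \<comment> \<open>\<open>\<mu>\<close> is the principal curvature -f/2 along \<omega>, and
    \<open>b\<close> is \<Gamma> times the other one, 3f/2. Then \<open>Db\<close> is the Codazzi
    equation, and \<open>\<mu>b\<close> turns the equation for \<Gamma>'' into \<Gamma>'' = \<Gamma>
    - \<mu> b.\<close>
  define \<mu> where "\<mu> t = - (c / 2 * z t ^ 4)" for t
  define b where "b t = 3 * c / 2 * z t" for t
  have b_sq: "b t * b t = (z t)\<^sup>2 / 3" for t
  proof -
    have "b t * b t = 9 / 4 * (c * c) * (z t)\<^sup>2"
      by (simp add: b_def power2_eq_square)
    then show ?thesis
      by (simp add: c_sq)
  qed
  have \<mu>b: "\<mu> t * b t = - (z t ^ 5 / 9)" for t
  proof -
    have "\<mu> t * b t = - (3 / 4 * (c * c) * z t ^ 5)"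
      by (simp add: \<mu>_def b_def power_numeral_reduce)
    then show ?thesis
      by (simp add: c_sq)
  qed
  have Db: "(b has_real_derivative \<mu> t * G1 t) (at t)" for t
    unfolding b_def[abs_def] \<mu>_def by (rule derivative_eq_intros DERIV_z refl)+ (simp add: algebra_simps)
  have "continuous_on UNIV z"
    using DERIV_isCont[OF DERIV_z] by (simp add: continuous_at_imp_continuous_on)
  then have "continuous_on UNIV \<mu>"
    unfolding \<mu>_def[abs_def] by (intro continuous_intros)
  then obtain \<gamma> e n where d\<gamma>: "\<And>t. (\<gamma> has_vector_derivative e t) (at t)"
    and de: "\<And>t. (e has_vector_derivative \<gamma> t + \<mu> t *\<^sub>R n t) (at t)"
    and dn: "\<And>t. (n has_vector_derivative - \<mu> t *\<^sub>R e t) (at t)"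
    and gram: "\<And>t. lor (\<gamma> t) (\<gamma> t) = -1" "\<And>t. lor (e t) (e t) = 1" "\<And>t. lor (n t) (n t) = 1"
      "\<And>t. lor (\<gamma> t) (e t) = 0" "\<And>t. lor (\<gamma> t) (n t) = 0" "\<And>t. lor (e t) (n t) = 0"
    and gram3: "\<And>t. lor (0, axis 3 1) (\<gamma> t) = 0" "\<And>t. lor (0, axis 3 1) (e t) = 0"
      "\<And>t. lor (0, axis 3 1) (n t) = 0" and fst0: "fst (\<gamma> 0) > 0"
    using hyperbolic_plane_curve_exists by metis
  define E :: minkowski where "E = (0, axis 3 1)"
  note gramE = gram3[folded E_def]
  have EE: "lor E E = 1"
    by (simp add: E_def lor_def)
  \<comment> \<open>The \<theta>-derivative of the unit vector \<open>e2\<close>, read off along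
    \<theta> = 0 from the Gauss formula for the second \<theta>-derivative of the immersion, divided
    by \<Gamma>.\<close>
  define W where "W = G 0 *\<^sub>R \<gamma> 0 - G1 0 *\<^sub>R e 0 + b 0 *\<^sub>R n 0"
  have W: "W = G t *\<^sub>R \<gamma> t - G1 t *\<^sub>R e t + b t *\<^sub>R n t" for t
  proof -
    have "((\<lambda>t. G t *\<^sub>R \<gamma> t - G1 t *\<^sub>R e t + b t *\<^sub>R n t) has_vector_derivative
        (G t *\<^sub>R e t + G1 t *\<^sub>R \<gamma> t) - (G1 t *\<^sub>R (\<gamma> t + \<mu> t *\<^sub>R n t) + (G t + z t ^ 5 / 9) *\<^sub>R e t)
        + (b t *\<^sub>R (- \<mu> t *\<^sub>R e t) + (\<mu> t * G1 t) *\<^sub>R n t)) (at t)" for t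
      by (intro has_vector_derivative_add has_vector_derivative_diff has_vector_derivative_scaleR
          d\<gamma> de dn Db DERIV_G DERIV_G1)
    moreover have "(G t *\<^sub>R e t + G1 t *\<^sub>R \<gamma> t) - (G1 t *\<^sub>R (\<gamma> t + \<mu> t *\<^sub>R n t) + (G t + z t ^ 5 / 9) *\<^sub>R e t)
        + (b t *\<^sub>R (- \<mu> t *\<^sub>R e t) + (\<mu> t * G1 t) *\<^sub>R n t) = - (\<mu> t * b t + z t ^ 5 / 9) *\<^sub>R e t" for t
      by (simp add: algebra_simps)
    ultimately have "((\<lambda>t. G t *\<^sub>R \<gamma> t - G1 t *\<^sub>R e t + b t *\<^sub>R n t) has_vector_derivative 0) (at t)" for t
      by (simp add: \<mu>b)
    then have "\<exists>k. \<forall>t\<in>UNIV. G t *\<^sub>R \<gamma> t - G1 t *\<^sub>R e t + b t *\<^sub>R n t = k"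
      by (intro has_derivative_zero_constant) (simp_all add: has_vector_derivative_def)
    then show ?thesis
      by (auto simp: W_def)
  qed
  define \<kappa> where "\<kappa> = C / 3"
  have lW: "lor (\<gamma> t) W = - G t" "lor (e t) W = - G1 t" "lor (n t) W = b t" for t
    unfolding W[of t]
    by (simp_all add: lor_simps gram lor_commute[of "n t" "\<gamma> t"] lor_commute[of "n t" "e t"] lor_commute[of "e t" "\<gamma> t"])
  \<comment> \<open>The first integral enters here: the square of \<open>b\<close> cancels its term
    in \<open>z\<close>.\<close>
  have WW: "lor W W = \<kappa>"
  proof -
    have "lor W W = lor (G 0 *\<^sub>R \<gamma> 0 - G1 0 *\<^sub>R e 0 + b 0 *\<^sub>R n 0) W"
      by (simp add: W_def)
    also have "\<dots> = - (G 0)\<^sup>2 + (G1 0)\<^sup>2 + b 0 * b 0"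
      by (simp add: lor_simps lW power2_eq_square)
    also have "\<dots> = \<kappa>"
      by (simp add: G1_sq b_sq \<kappa>_def)
    finally show ?thesis .
  qed
  have EW: "lor E W = 0"
    by (simp add: W_def lor_simps gramE)
  obtain sn cs vr where dsn: "\<And>t. (sn has_real_derivative cs t) (at t)"
    and dcs: "\<And>t. (cs has_real_derivative - \<kappa> * sn t) (at t)"
    and dvr: "\<And>t. (vr has_real_derivative sn t) (at t)" and cs: "\<And>t. cs t = 1 - \<kappa> * vr t"
    and sn: "\<And>t. (sn t)\<^sup>2 = 2 * vr t - \<kappa> * (vr t)\<^sup>2" and at0: "sn 0 = 0" "vr 0 = 0"
    using generalised_trigonometry_exists by metis
  note dvs = dsn[THEN has_real_derivative_iff_has_vector_derivative[THEN iffD1]]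
    dcs[THEN has_real_derivative_iff_has_vector_derivative[THEN iffD1]]
    dvr[THEN has_real_derivative_iff_has_vector_derivative[THEN iffD1]]
  have D\<mu>: "smooth (\<lambda>p. \<mu> (p $ 1))" and Dbp: "smooth (\<lambda>p. b (p $ 1))"
    unfolding \<mu>_def b_def by (intro smooth_mult smooth_minus smooth_power smooth_const smooth_profile)+
  have "C_class k (\<lambda>p. \<gamma> (p $ 1)) \<and> C_class k (\<lambda>p. e (p $ 1)) \<and> C_class k (\<lambda>p. n (p $ 1))" for k
  proof (induction k)
    case 0
    show ?case
      using differentiable_coord[OF d\<gamma>] differentiable_coord[OF de] differentiable_coord[OF dn]
      by (auto simp: continuous_on_eq_continuous_at intro: differentiable_imp_continuous_within)
  next
    case (Suc k)
    have "C_class k (\<lambda>p. \<gamma> (p $ 1) + \<mu> (p $ 1) *\<^sub>R n (p $ 1))" "C_class k (\<lambda>p. - \<mu> (p $ 1) *\<^sub>R e (p $ 1))"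
      using Suc D\<mu> by (auto intro!: C_class_add C_class_scaleR C_class_minus simp: smooth_def)
    then show ?case
      using Suc C_class_const[of k "0::minkowski"]
      by (auto simp: forall_2 pd_coord[OF d\<gamma>] pd_coord[OF de] pd_coord[OF dn]
          intro: differentiable_coord[OF d\<gamma>] differentiable_coord[OF de] differentiable_coord[OF dn])
  qed
  then have sm1: "smooth (\<lambda>p. \<gamma> (p $ 1))" "smooth (\<lambda>p. e (p $ 1))" "smooth (\<lambda>p. n (p $ 1))"
    by (auto simp: smooth_def)
  have "C_class k (\<lambda>p. sn (p $ 2)) \<and> C_class k (\<lambda>p. cs (p $ 2)) \<and> C_class k (\<lambda>p. vr (p $ 2))" for k
  proof (induction k)
    case 0
    show ?case
      using differentiable_coord[OF dvs(1)] differentiable_coord[OF dvs(2)] differentiable_coord[OF dvs(3)]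
      by (auto simp: continuous_on_eq_continuous_at intro: differentiable_imp_continuous_within)
  next
    case (Suc k)
    have "C_class k (\<lambda>p. - \<kappa> * sn (p $ 2))"
      using Suc by (intro C_class_mult C_class_const) auto
    then show ?case
      using Suc C_class_const[of k "0::real"]
      by (auto simp: forall_2 pd_coord[OF dvs(1)] pd_coord[OF dvs(2)] pd_coord[OF dvs(3)]
          intro: differentiable_coord[OF dvs(1)] differentiable_coord[OF dvs(2)] differentiable_coord[OF dvs(3)])
  qed
  then have sm2: "smooth (\<lambda>p. sn (p $ 2))" "smooth (\<lambda>p. cs (p $ 2))" "smooth (\<lambda>p. vr (p $ 2))"
    by (auto simp: smooth_def)
  \<comment> \<open>\<open>D\<close> is the primitive of \<open>e2\<close> in \<theta> that vanishes
    at \<theta> = 0. The \<theta>-derivatives of \<open>\<Phi>\<close>, \<open>e1\<close>,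
    \<open>\<eta>\<close> have to be \<Gamma> e2, \<Gamma>' e2 and -b e2, so each is its value on
    the curve plus a multiple of \<open>D\<close>.\<close>
  define D where "D p = sn (p $ 2) *\<^sub>R E + vr (p $ 2) *\<^sub>R W" for p :: "real^2"
  define e2 where "e2 p = cs (p $ 2) *\<^sub>R E + sn (p $ 2) *\<^sub>R W" for p :: "real^2"
  define \<Phi> where "\<Phi> p = \<gamma> (p $ 1) + Gp p *\<^sub>R D p" for p
  define e1 where "e1 p = e (p $ 1) + G1p p *\<^sub>R D p" for p
  define \<eta> where "\<eta> p = n (p $ 1) - b (p $ 1) *\<^sub>R D p" for p
  have sD: "smooth D" and se2: "smooth e2"
    unfolding D_def[abs_def] e2_def[abs_def] by (intro smooth_add smooth_scaleR smooth_const sm2)+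
  have s\<Phi>: "smooth \<Phi>" and s\<eta>: "smooth \<eta>"
    unfolding \<Phi>_def[abs_def] \<eta>_def[abs_def]
    by (intro smooth_add smooth_diff smooth_scaleR sm1 sD smooth_profile Dbp)+
  note sds = smooth_differentiable[OF sD] smooth_differentiable[OF se2]
    smooth_differentiable[OF sm1(1)] smooth_differentiable[OF sm1(2)] smooth_differentiable[OF sm1(3)]
    smooth_differentiable[OF sm2(1)] smooth_differentiable[OF sm2(2)] smooth_differentiable[OF sm2(3)]
    smooth_differentiable[OF smooth_profile(1)] smooth_differentiable[OF smooth_profile(2)]
    smooth_differentiable[OF Dbp] smooth_differentiable[OF smooth_scaleR[OF smooth_profile(1) sD]]
    smooth_differentiable[OF smooth_scaleR[OF smooth_profile(2) sD]]
    smooth_differentiable[OF smooth_scaleR[OF Dbp sD]]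
    smooth_differentiable[OF smooth_scaleR[OF sm2(1) smooth_const]]
    smooth_differentiable[OF smooth_scaleR[OF sm2(2) smooth_const]]
    smooth_differentiable[OF smooth_scaleR[OF sm2(3) smooth_const]]
    smooth_differentiable[OF smooth_const]
  have pD: "pd i D p = (if i = 2 then e2 p else 0)" for i p
    unfolding D_def[abs_def] by (simp add: pd_add pd_scaleR sds pd_coord[OF dvs(1)] pd_coord[OF dvs(3)] e2_def)
  have pe2: "pd i e2 p = (if i = 2 then (- \<kappa> * sn (p $ 2)) *\<^sub>R E + cs (p $ 2) *\<^sub>R W else 0)" for i p
    unfolding e2_def[abs_def] by (simp add: pd_add pd_scaleR sds pd_coord[OF dvs(1)] pd_coord[OF dvs(2)])
  have p\<Phi>: "pd i \<Phi> = (\<lambda>p. if i = 1 then e1 p else Gp p *\<^sub>R e2 p)" for i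
    using exhaust_2[of i] unfolding \<Phi>_def[abs_def]
    by (auto simp: fun_eq_iff pd_add pd_scaleR sds pd_coord[OF d\<gamma>] pd_profile pD e1_def)
  have pe1: "pd i e1 p = (if i = 1 then \<Phi> p + \<mu> (p $ 1) *\<^sub>R \<eta> p else G1p p *\<^sub>R e2 p)" for i p
  proof (cases "i = 1")
    case True
    have "pd 1 e1 p = \<gamma> (p $ 1) + \<mu> (p $ 1) *\<^sub>R n (p $ 1) + (Gp p + zp p ^ 5 / 9) *\<^sub>R D p"
      unfolding e1_def[abs_def] by (simp add: pd_add pd_scaleR sds pd_coord[OF de] pd_profile pD)
    also have "\<dots> = \<gamma> (p $ 1) + \<mu> (p $ 1) *\<^sub>R n (p $ 1) + (Gp p - \<mu> (p $ 1) * b (p $ 1)) *\<^sub>R D p"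
      by (simp add: \<mu>b)
    also have "\<dots> = \<Phi> p + \<mu> (p $ 1) *\<^sub>R \<eta> p"
      by (simp add: \<Phi>_def \<eta>_def algebra_simps)
    finally show ?thesis
      using True by simp
  next
    case False
    then show ?thesis
      using exhaust_2[of i] unfolding e1_def[abs_def]
      by (auto simp: pd_add pd_scaleR sds pd_coord[OF de] pd_profile pD)
  qed
  have lE: "lor (\<gamma> t) E = 0" "lor (e t) E = 0" "lor (n t) E = 0" "lor W E = 0" for t
    using gramE[of t] EW lor_commute[of E] by simp_all
  have lW': "lor W (\<gamma> t) = - G t" "lor W (e t) = - G1 t" "lor W (n t) = b t" for t
    using lW[of t] lor_commute[of W] by simp_all
  have gram': "lor (e t) (\<gamma> t) = 0" "lor (n t) (\<gamma> t) = 0" "lor (n t) (e t) = 0" for t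
    using gram[of t] lor_commute[of "e t" "\<gamma> t"] lor_commute[of "n t" "\<gamma> t"] lor_commute[of "n t" "e t"]
    by simp_all
  note ls = lor_simps gram gram' gramE lE lW lW' EE EW WW
  have snsn: "sn t * sn t = 2 * vr t - \<kappa> * (vr t * vr t)" for t
    using sn[of t] by (simp add: power2_eq_square)
  have DD: "lor (D p) (D p) = 2 * vr (p $ 2)" "lor (D p) (e2 p) = sn (p $ 2)" "lor (e2 p) (D p) = sn (p $ 2)"
    "lor (e2 p) (e2 p) = 1" for p
    by (simp_all add: D_def e2_def ls cs snsn algebra_simps)
  have lD: "lor (\<gamma> t) (D p) = - G t * vr (p $ 2)" "lor (e t) (D p) = - G1 t * vr (p $ 2)"
    "lor (n t) (D p) = b t * vr (p $ 2)" "lor (D p) (\<gamma> t) = - G t * vr (p $ 2)"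
    "lor (D p) (e t) = - G1 t * vr (p $ 2)" "lor (D p) (n t) = b t * vr (p $ 2)" for p t
    by (simp_all add: D_def ls)
  have le2: "lor (\<gamma> t) (e2 p) = - G t * sn (p $ 2)" "lor (e t) (e2 p) = - G1 t * sn (p $ 2)"
    "lor (n t) (e2 p) = b t * sn (p $ 2)" "lor (e2 p) (\<gamma> t) = - G t * sn (p $ 2)"
    "lor (e2 p) (e t) = - G1 t * sn (p $ 2)" "lor (e2 p) (n t) = b t * sn (p $ 2)" for p t
    by (simp_all add: e2_def ls)
  have frame: "lor (\<Phi> p) (\<Phi> p) = -1" "lor (e1 p) (e1 p) = 1" "lor (e1 p) (e2 p) = 0" "lor (e2 p) (e1 p) = 0"
    "lor (\<eta> p) (\<eta> p) = 1" "lor (\<eta> p) (\<Phi> p) = 0" "lor (\<Phi> p) (\<eta> p) = 0" "lor (\<eta> p) (e1 p) = 0" "lor (\<eta> p) (e2 p) = 0"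
    "lor (e2 p) (\<eta> p) = 0" for p
    by (simp_all add: \<Phi>_def e1_def \<eta>_def ls DD lD le2 algebra_simps)
  \<comment> \<open>The time coordinate has no zeros on the hyperboloid, so by connectedness it
    keeps its sign at the origin.\<close>
  have "fst (\<Phi> p) > 0" for p
  proof -
    have o: "open {p. fst (\<Phi> p) > 0}" "open {p. fst (\<Phi> p) < 0}"
      by (intro open_Collect_less continuous_on_const continuous_on_fst smooth_continuous_on s\<Phi>)+
    have nz: "fst (\<Phi> p) \<noteq> 0" for p
    proof
      assume "fst (\<Phi> p) = 0"
      then show False
        using norm_snd_less_abs_fst[OF frame(1)[of p]] by simp
    qed
    then have "UNIV \<subseteq> {p. fst (\<Phi> p) > 0} \<union> {p. fst (\<Phi> p) < 0}"
      by (auto simp: not_less less_le)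
    then have "{p. fst (\<Phi> p) > 0} = {} \<or> {p. fst (\<Phi> p) < 0} = {}"
      using connectedD[OF connected_UNIV o] by fastforce
    moreover have "fst (\<Phi> 0) > 0"
      using fst0 by (simp add: \<Phi>_def D_def at0)
    ultimately have "\<not> fst (\<Phi> p) < 0"
      by blast
    then show ?thesis
      using nz[of p] by (simp add: not_less less_le)
  qed
  then have H3: "range \<Phi> \<subseteq> H3"
    by (auto simp: H3_def frame)
  have iso: "isometric_immersion warped_metric \<Phi>"
  proof -
    have "lor (pd i \<Phi> p) (pd j \<Phi> p) = warped_metric p $ i $ j" for i j p
      using exhaust_2[of i] exhaust_2[of j]
      by (auto simp: p\<Phi> warped_metric_def lor_simps frame DD power2_eq_square)
    then show ?thesis
      by (simp add: isometric_immersion_def s\<Phi> H3)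
  qed
  have nor: "unit_normal_field \<Phi> \<eta>"
    by (auto simp: unit_normal_field_def s\<eta> p\<Phi> lor_simps frame)
  interpret I: immersed_profile C G G1 z \<Phi> \<eta>
    by unfold_locales (fact iso nor)+
  have "I.second_form 1 1 p = \<mu> (p $ 1)" for p
    by (simp add: I.second_form_def p\<Phi> pe1 lor_simps frame)
  moreover have "I.second_form 1 2 p = 0" for p
    using I.second_form_21 by (simp add: I.second_form_def[of 2 1] p\<Phi> pe1 lor_simps frame flip: I.second_form_21)
  moreover have "I.second_form 2 2 p = Gp p * b (p $ 1)" for p
  proof -
    have e: "pd 2 (\<lambda>p. Gp p *\<^sub>R e2 p) p = Gp p *\<^sub>R ((- \<kappa> * sn (p $ 2)) *\<^sub>R E + cs (p $ 2) *\<^sub>R W)"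
      by (simp add: pd_scaleR sds pd_profile pe2)
    have "lor E (\<eta> p) = - b (p $ 1) * sn (p $ 2)" "lor W (\<eta> p) = b (p $ 1) * cs (p $ 2)"
      by (simp_all add: \<eta>_def D_def ls cs algebra_simps)
    then have "I.second_form 2 2 p = Gp p * b (p $ 1) * (\<kappa> * (sn (p $ 2) * sn (p $ 2)) + cs (p $ 2) * cs (p $ 2))"
      by (simp add: I.second_form_def p\<Phi> e lor_simps algebra_simps)
    also have "\<kappa> * (sn (p $ 2) * sn (p $ 2)) + cs (p $ 2) * cs (p $ 2) = 1"
      by (simp add: cs snsn algebra_simps)
    finally show ?thesis
      by simp
  qed
  ultimately have second_form: "I.second_form 1 1 = (\<lambda>p. \<mu> (p $ 1))" "I.second_form 1 2 = (\<lambda>p. 0)" "I.second_form 2 2 = (\<lambda>p. Gp p * b (p $ 1))"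
    by auto
  have mean_curv: "I.mean_curv = (\<lambda>p. c * zp p ^ 4)"
    unfolding I.mean_curv_def[abs_def] second_form \<mu>_def b_def
    using z_ne by (auto simp: fun_eq_iff G_eq field_simps power_numeral_reduce)
  have "((\<lambda>t. c * z t ^ 4) has_vector_derivative c * (4 * (z t ^ 3 * - (z t ^ 4 * G1 t / 3)))) (at t)" for t
    unfolding has_real_derivative_iff_has_vector_derivative[symmetric]
    by (rule derivative_eq_intros DERIV_z refl)+ simp
  then have mean_curv2: "pd 2 I.mean_curv p = 0" for p
    unfolding mean_curv by (subst pd_coord) auto
  have "biconservative_immersion warped_metric \<Phi>"
  proof -
    have "lor (bitension warped_metric \<Phi> p) (pd 1 \<Phi> p) = 0" "lor (bitension warped_metric \<Phi> p) (pd 2 \<Phi> p) = 0" for p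
      by (simp_all add: I.lor_bitension_1 I.lor_bitension_2 mean_curv2 second_form) (simp add: mean_curv \<mu>_def)
    then show ?thesis
      by (simp add: biconservative_immersion_def iso forall_2)
  qed
  then have "biconservative_profile C G G1 z \<Phi> \<eta>"
    by unfold_locales
  then show ?thesis
    by (rule that) (simp add: mean_curv c_def)
qed

lemma unit_normal_field_scale:
  assumes "unit_normal_field \<Phi> \<eta>" "\<epsilon> * \<epsilon> = 1"
  shows "unit_normal_field \<Phi> (\<lambda>p. \<epsilon> *\<^sub>R \<eta> p)"
  using assms by (auto simp: unit_normal_field_def lor_simps smooth_scaleR smooth_const)

lemma biconservative_profileI:
  "biconservative_immersion warped_metric \<Phi> \<Longrightarrow> unit_normal_field \<Phi> \<eta> \<Longrightarrow> biconservative_profile C G G1 z \<Phi> \<eta>"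
  by unfold_locales (auto simp: biconservative_immersion_def)

text \<open>The mean curvature depends on the normal up to sign, so the gradient claim ranges over
  all unit normals, and the existence of one keeps it from being vacuous.\<close>

theorem biconservative_immersion_unique_exists:
  "(\<exists>\<Phi>. biconservative_immersion warped_metric \<Phi> \<and>
      (\<forall>\<Psi>. biconservative_immersion warped_metric \<Psi> \<longrightarrow> (\<exists>F. isometry_H3 F \<and> (\<forall>p. \<Psi> p = F (\<Phi> p)))))
    \<and> (\<forall>\<Phi>. biconservative_immersion warped_metric \<Phi> \<longrightarrow> (\<exists>\<eta>. unit_normal_field \<Phi> \<eta>) \<and>
      (\<forall>\<eta> p. unit_normal_field \<Phi> \<eta> \<and> p $ 1 \<noteq> 0 \<longrightarrow> grad warped_metric (mean_curvature warped_metric \<Phi> \<eta>) p \<noteq> 0))"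
proof (intro conjI allI impI)
  obtain \<Phi> \<eta> where A: "biconservative_profile C G G1 z \<Phi> \<eta>"
    and mcA: "\<And>p. immersed_profile.mean_curv z \<Phi> \<eta> p = 2 / (3 * sqrt 3) * zp p ^ 4"
    using biconservative_immersion_exists by blast
  interpret A: biconservative_profile C G G1 z \<Phi> \<eta>
    by (rule A)
  show "\<exists>\<Phi>. biconservative_immersion warped_metric \<Phi> \<and>
      (\<forall>\<Psi>. biconservative_immersion warped_metric \<Psi> \<longrightarrow> (\<exists>F. isometry_H3 F \<and> (\<forall>p. \<Psi> p = F (\<Phi> p))))"
  proof (intro exI[of _ \<Phi>] conjI allI impI)
    show "biconservative_immersion warped_metric \<Phi>"
      by (rule A.biconservative)
    fix \<Psi>
    assume \<Psi>: "biconservative_immersion warped_metric \<Psi>"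
    then obtain \<nu> where \<nu>: "unit_normal_field \<Psi> \<nu>"
      using unit_normal_field_exists unfolding biconservative_immersion_def by blast
    interpret B: biconservative_profile C G G1 z \<Psi> \<nu>
      by (rule biconservative_profileI[OF \<Psi> \<nu>])
    obtain \<epsilon> :: real where \<epsilon>: "\<epsilon> = 1 \<or> \<epsilon> = -1" "\<And>p. B.mean_curv p = \<epsilon> * (2 / (3 * sqrt 3) * zp p ^ 4)"
      using B.mean_curv_sign by blast
    have \<epsilon>2: "\<epsilon> * \<epsilon> = 1"
      using \<epsilon>(1) by auto
    \<comment> \<open>Multiplying the normal by the sign of the mean curvature matches it with the
      model, and the mean curvature determines all entries of the second form.\<close>
    interpret B': biconservative_profile C G G1 z \<Psi> "\<lambda>p. \<epsilon> *\<^sub>R \<nu> p"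
      by (rule biconservative_profileI[OF \<Psi> unit_normal_field_scale[OF \<nu> \<epsilon>2]])
    have "B'.mean_curv p = \<epsilon> * B.mean_curv p" for p
      by (simp add: B'.mean_curv_def B.mean_curv_def B'.second_form_def B.second_form_def lor_simps algebra_simps)
    then have mean_curv: "B'.mean_curv p = A.mean_curv p" for p
      using \<epsilon>2 by (simp add: \<epsilon>(2) mcA flip: mult.assoc)
    have "A.second_form i j p = B'.second_form i j p" for i j p
      using exhaust_2[of i] exhaust_2[of j]
      by (auto simp: A.second_form_21 B'.second_form_21 A.second_fundamental_form B'.second_fundamental_form mean_curv)
    then interpret congruent_profiles C G G1 z \<Phi> \<eta> \<Psi> "\<lambda>p. \<epsilon> *\<^sub>R \<nu> p"
      by unfold_locales
    show "\<exists>F. isometry_H3 F \<and> (\<forall>p. \<Psi> p = F (\<Phi> p))"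
      by (rule congruent)
  qed
next
  fix \<Phi>
  assume \<Phi>: "biconservative_immersion warped_metric \<Phi>"
  then show "\<exists>\<eta>. unit_normal_field \<Phi> \<eta>"
    using unit_normal_field_exists by (auto simp: biconservative_immersion_def)
  fix \<eta> and p :: "real^2"
  assume a: "unit_normal_field \<Phi> \<eta> \<and> p $ 1 \<noteq> 0"
  then interpret biconservative_profile C G G1 z \<Phi> \<eta>
    using \<Phi> biconservative_profileI by blast
  show "grad warped_metric (mean_curvature warped_metric \<Phi> \<eta>) p \<noteq> 0"
    using a grad_mean_curvature by blast
qed

end

section \<open>The profile of the complete surface\<close>

text \<open>By the mean value theorem, difference quotients at 0 are values of \<open>f'\<close> at
  nearby points, which converge by continuity. This handles the gluing point of the even
  extension.\<close>

lemma DERIV_at_0_extension: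
  fixes f f' :: "real \<Rightarrow> real"
  assumes "isCont f 0" "isCont f' 0" and d: "\<And>x. x \<noteq> 0 \<Longrightarrow> (f has_real_derivative f' x) (at x)"
  shows "(f has_real_derivative f' x) (at x)"
proof (cases "x = 0")
  case True
  have cont: "isCont f x" for x
    using assms(1) DERIV_isCont[OF d, of x] by (cases "x = 0") auto
  have "((\<lambda>y. (f y - f 0) / (y - 0)) \<longlongrightarrow> f' 0) (at 0)"
  proof (rule LIM_I)
    fix e :: real assume "e > 0"
    then obtain \<delta> where \<delta>: "\<delta> > 0" "\<And>y. \<bar>y\<bar> < \<delta> \<Longrightarrow> \<bar>f' y - f' 0\<bar> < e"
      using assms(2) by (auto simp: continuous_at_eps_delta dist_real_def)
    show "\<exists>s>0. \<forall>y. y \<noteq> 0 \<and> norm (y - 0) < s \<longrightarrow> norm ((f y - f 0) / (y - 0) - f' 0) < e"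
    proof (intro exI[of _ \<delta>] conjI allI impI \<delta>(1))
      fix y :: real assume y: "y \<noteq> 0 \<and> norm (y - 0) < \<delta>"
      have mvt: "\<exists>u. a < u \<and> u < b \<and> f b - f a = (b - a) * f' u" if "a < b" "a = 0 \<or> b = 0" for a b
      proof -
        have "\<exists>l u. a < u \<and> u < b \<and> (f has_real_derivative l) (at u) \<and> f b - f a = (b - a) * l"
        proof (rule MVT[OF that(1)])
          show "continuous_on {a..b} f"
            using cont by (simp add: continuous_at_imp_continuous_on)
          show "f differentiable (at u)" if "a < u" "u < b" for u
            using d[of u] \<open>a = 0 \<or> b = 0\<close> that by (auto simp: real_differentiable_def)
        qed
        then obtain l u where u: "a < u" "u < b" "(f has_real_derivative l) (at u)" "f b - f a = (b - a) * l"
          by blast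
        moreover have "l = f' u"
          using u that(2) by (intro DERIV_unique[OF u(3) d]) auto
        ultimately show ?thesis
          by blast
      qed
      have "\<exists>u. \<bar>u\<bar> < \<delta> \<and> (f y - f 0) / y = f' u"
      proof (cases "y > 0")
        case True
        then obtain u where "0 < u" "u < y" "f y - f 0 = (y - 0) * f' u"
          using mvt[of 0 y] by auto
        then show ?thesis
          using True y by (intro exI[of _ u]) (auto simp: field_simps)
      next
        case False
        then obtain u where "y < u" "u < 0" "f 0 - f y = (0 - y) * f' u"
          using mvt[of y 0] y by auto
        then show ?thesis
          using False y by (intro exI[of _ u]) (auto simp: field_simps)
      qed
      then show "norm ((f y - f 0) / (y - 0) - f' 0) < e"
        using \<delta>(2) by auto
    qed
  qed
  then show ?thesis
    using True by (simp add: has_field_derivative_iff)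
qed (use d in auto)

section \<open>The zero of T and the range of \<rho>\<close>

locale profile_parameters =
  fixes C \<xi>00 :: real
  assumes \<xi>00_pos: "0 < \<xi>00" and \<xi>00_less: "\<xi>00 < xi01 C"
begin

text \<open>T(y)/y^2. Unlike T in general, it is strictly decreasing, and at y = 1/\<Gamma> it
  equals 3 \<Gamma>'^2.\<close>

definition S :: "real \<Rightarrow> real" where
  "S y = C - y powr (2/3) + 3 / y\<^sup>2"

lemma T_eq: "0 < y \<Longrightarrow> T C y = y\<^sup>2 * S y"
proof -
  assume y: "0 < y"
  have "y powr (8/3) = y powr (2 + 2/3)"
    by simp
  also have "\<dots> = y\<^sup>2 * y powr (2/3)"
    using y unfolding powr_add by (simp add: powr_numeral)
  finally show ?thesis
    using y by (simp add: T_def S_def field_simps)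
qed

text \<open>The increasing power term only helps. Besides monotonicity, this bounds \<open>S\<close>
  from below near its zero, which the boundedness of \<rho> needs.\<close>

lemma S_diff:
  assumes "0 < x" "x \<le> y"
  shows "3 / x\<^sup>2 - 3 / y\<^sup>2 \<le> S x - S y"
  using powr_mono2[of "2/3" x y] assms by (simp add: S_def)

lemma S_less:
  assumes "0 < x" "x < y"
  shows "S y < S x"
proof -
  have "3 / y\<^sup>2 < 3 / x\<^sup>2"
    using assms by (intro divide_strict_left_mono power_strict_mono) auto
  then show ?thesis
    using S_diff[of x y] assms by simp
qed

lemma T_zero_exists: "\<exists>y>0. T C y = 0"
proof -
  \<comment> \<open>At \<open>a\<close> both the power and the term with \<open>C\<close> are at
    most 1 in modulus, so T is at least 1; at \<open>b\<close> the power 2/3 outweighs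
    \<open>C\<close> and the remaining summand 3/b^2, which is at most 3.\<close>
  define a where "a = 1 / (\<bar>C\<bar> + 1)"
  define b where "b = (\<bar>C\<bar> + 4) powr (3/2)"
  have a: "0 < a" "a \<le> 1" "\<bar>C\<bar> * a \<le> 1"
    by (auto simp: a_def field_simps)
  have b: "1 \<le> b" "b powr (2/3) = \<bar>C\<bar> + 4"
    by (auto simp: b_def powr_powr ge_one_powr_ge_zero)
  have Ta: "T C a > 0"
  proof -
    have "a powr (8/3) \<le> 1"
      using a by (intro powr_le1) auto
    moreover have "- 1 \<le> C * a\<^sup>2"
    proof -
      have "\<bar>C * a\<^sup>2\<bar> = (\<bar>C\<bar> * a) * a"
        using a by (simp add: abs_mult power2_eq_square)
      also have "\<dots> \<le> 1 * 1"
        using a by (intro mult_mono) auto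
      finally show ?thesis
        by linarith
    qed
    ultimately show ?thesis
      by (simp add: T_def)
  qed
  have Tb: "T C b < 0"
  proof -
    have b0: "b > 0"
      using b by simp
    have "3 / b\<^sup>2 \<le> 3"
      using b(1) by (simp add: field_simps power2_eq_square) (metis mult_mono' mult_1 zero_le_one)
    then have "S b < 0"
      using b(2) by (simp add: S_def)
    then show ?thesis
      using b0 by (simp add: T_eq mult_pos_neg)
  qed
  have "a < b \<or> a = b"
    using a b by linarith
  then have ab: "a \<le> b"
    by auto
  have "continuous_on {a..b} (T C)"
    unfolding T_def[abs_def] using a by (intro continuous_intros) auto
  then have "\<exists>x\<ge>a. x \<le> b \<and> T C x = 0"
    using Ta Tb ab by (intro IVT2') auto
  then show ?thesis
    using a(1) by (meson less_le_trans)
qed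

abbreviation "x1 \<equiv> xi01 C"

lemma x1: "0 < x1" "S x1 = 0"
proof -
  have "\<exists>!y. y > 0 \<and> T C y = 0"
  proof (rule ex_ex1I)
    show "\<exists>y>0. T C y = 0"
      by (rule T_zero_exists)
    show "x = y" if "0 < x \<and> T C x = 0" "0 < y \<and> T C y = 0" for x y
      using that S_less[of x y] S_less[of y x] by (cases x y rule: linorder_cases) (auto simp: T_eq)
  qed
  from theI'[OF this] show "0 < x1" "S x1 = 0"
    unfolding xi01_def[symmetric] by (auto simp: T_eq)
qed

lemma S_pos: "0 < y \<Longrightarrow> y < x1 \<Longrightarrow> 0 < S y"
  using S_less[of y x1] x1 by simp

definition f :: "real \<Rightarrow> real" where
  "f y = sqrt (3 / (y\<^sup>2 * T C y))"

lemma T_pos: "0 < y \<Longrightarrow> y < x1 \<Longrightarrow> 0 < T C y"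
  by (simp add: T_eq S_pos)

lemma f_pos: "0 < y \<Longrightarrow> y < x1 \<Longrightarrow> 0 < f y"
  using T_pos[of y] by (simp add: f_def)

lemma DERIV_rho:
  assumes "0 < y" "y < x1"
  shows "(rho C \<xi>00 has_real_derivative - f y) (at y)"
proof -
  \<comment> \<open>A compact interval inside the domain that contains the base point and has
    \<open>y\<close> in its interior.\<close>
  define a where "a = min y \<xi>00 / 2"
  define b where "b = (max y \<xi>00 + x1) / 2"
  have ab: "0 < a" "a < y" "a \<le> \<xi>00" "y < b" "\<xi>00 \<le> b" "b < x1"
    using assms \<xi>00_pos \<xi>00_less by (auto simp: a_def b_def)
  have cont: "continuous_on {a..b} f"
    unfolding f_def[abs_def]
  proof (intro continuous_intros ballI)
    fix t assume "t \<in> {a..b}"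
    then show "t\<^sup>2 * T C t \<noteq> 0"
      using T_pos[of t] ab by auto
  qed (use ab in \<open>auto simp: T_def[abs_def] intro!: continuous_intros\<close>)
  have "((\<lambda>u. LBINT t=ereal \<xi>00..ereal u. f t) has_vector_derivative f y) (at y within {a..b})"
    using ab cont by (intro interval_integral_FTC2) auto
  then have "((\<lambda>u. LBINT t=ereal \<xi>00..ereal u. f t) has_vector_derivative f y) (at y)"
    using ab by (subst (asm) at_within_interior) (auto simp: interior_atLeastAtMost_real)
  then show ?thesis
    unfolding rho_def[abs_def] f_def[symmetric] has_real_derivative_iff_has_vector_derivative
    by (rule has_vector_derivative_minus)
qed

lemma rho_less:
  assumes "0 < x" "x < y" "y < x1"
  shows "rho C \<xi>00 y < rho C \<xi>00 x"
proof (rule DERIV_neg_imp_decreasing[OF assms(2)])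
  fix t assume "x \<le> t" "t \<le> y"
  then show "\<exists>d. (rho C \<xi>00 has_real_derivative d) (at t) \<and> d < 0"
    using assms f_pos[of t] by (intro exI[of _ "- f t"]) (auto intro: DERIV_rho)
qed

text \<open>T decreases to its zero \<open>x1\<close> at least linearly, T \<ge> 3 (x1 - y)/x1, so
  the integrand is at most \<open>K / sqrt (x1 - y)\<close>, whose primitive
  \<open>- 2 * K * sqrt (x1 - y)\<close> is bounded. The comparison is made through monotonicity of
  a difference.\<close>

lemma rho_lower_bound: "\<exists>m. \<forall>y. 0 < y \<and> y < x1 \<longrightarrow> m \<le> rho C \<xi>00 y"
proof -
  define K where "K = sqrt x1 / \<xi>00"
  have K: "K \<ge> 0"
    using x1 \<xi>00_pos by (simp add: K_def)
  have f_le: "f y \<le> K / sqrt (x1 - y)" if "\<xi>00 \<le> y" "y < x1" for y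
  proof -
    have y: "y > 0"
      using that \<xi>00_pos by simp
    have "3 / y\<^sup>2 - 3 / x1\<^sup>2 \<le> S y"
      using S_diff[of y x1] y that x1 by simp
    then have "y\<^sup>2 * (3 / y\<^sup>2 - 3 / x1\<^sup>2) \<le> T C y"
      using y by (simp add: T_eq)
    moreover have "3 * (x1 - y) / x1 \<le> y\<^sup>2 * (3 / y\<^sup>2 - 3 / x1\<^sup>2)"
    proof -
      have "y\<^sup>2 * (3 / y\<^sup>2 - 3 / x1\<^sup>2) - 3 * (x1 - y) / x1 = 3 * y * (x1 - y) / x1\<^sup>2"
        using y x1 by (simp add: field_simps power2_eq_square)
      moreover have "\<dots> \<ge> 0"
        using y that x1 by simp
      ultimately show ?thesis
        by linarith
    qed
    ultimately have T: "3 * (x1 - y) / x1 \<le> T C y"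
      by simp
    have p: "0 < 3 * (x1 - y) / x1"
      using that x1 by simp
    have "\<xi>00\<^sup>2 * (3 * (x1 - y) / x1) \<le> y\<^sup>2 * T C y"
      using that \<xi>00_pos p T by (intro mult_mono power_mono) auto
    moreover have "0 < \<xi>00\<^sup>2 * (3 * (x1 - y) / x1)"
      using \<xi>00_pos p by (intro mult_pos_pos) auto
    ultimately have "3 / (y\<^sup>2 * T C y) \<le> 3 / (\<xi>00\<^sup>2 * (3 * (x1 - y) / x1))"
      by (intro frac_le) auto
    also have "\<dots> = x1 / (\<xi>00\<^sup>2 * (x1 - y))"
    proof -
      have "3 / (a * (3 * b / x1)) = x1 / (a * b)" for a b
        using x1 by (cases "a = 0 \<or> b = 0") (auto simp: field_simps)
      then show ?thesis .
    qed
    finally have "f y \<le> sqrt (x1 / (\<xi>00\<^sup>2 * (x1 - y)))"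
      unfolding f_def by (rule real_sqrt_le_mono)
    also have "\<dots> = K / sqrt (x1 - y)"
      using \<xi>00_pos by (simp add: K_def real_sqrt_divide real_sqrt_mult)
    finally show ?thesis .
  qed
  have b: "rho C \<xi>00 \<xi>00 - 2 * K * sqrt (x1 - \<xi>00) \<le> rho C \<xi>00 y" if "\<xi>00 \<le> y" "y < x1" for y
  proof -
    have "rho C \<xi>00 \<xi>00 - 2 * K * sqrt (x1 - \<xi>00) \<le> rho C \<xi>00 y - 2 * K * sqrt (x1 - y)"
    proof (rule DERIV_nonneg_imp_nondecreasing[OF that(1)])
      fix t assume t: "\<xi>00 \<le> t" "t \<le> y"
      have lt: "0 < t" "t < x1"
        using t that \<xi>00_pos by auto
      have "((\<lambda>y. x1 - y) has_real_derivative -1) (at t)"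
        by (rule derivative_eq_intros refl)+ simp
      then have "((\<lambda>y. sqrt (x1 - y)) has_real_derivative inverse (sqrt (x1 - t)) / 2 * -1) (at t)"
        using lt by (intro DERIV_chain2[OF DERIV_real_sqrt]) auto
      from DERIV_diff[OF DERIV_rho[OF lt] DERIV_cmult[OF this, of "2 * K"]]
      have "((\<lambda>y. rho C \<xi>00 y - 2 * K * sqrt (x1 - y)) has_real_derivative
          - f t - 2 * K * (inverse (sqrt (x1 - t)) / 2 * -1)) (at t)" .
      moreover have "- f t - 2 * K * (inverse (sqrt (x1 - t)) / 2 * -1) \<ge> 0"
      proof -
        have "2 * K * (a / 2 * -1) = - (K * a)" for a
          by simp
        then show ?thesis
          using f_le[OF t(1) lt(2)] by (simp only: divide_inverse)
      qed
      ultimately show "\<exists>d. ((\<lambda>y. rho C \<xi>00 y - 2 * K * sqrt (x1 - y)) has_real_derivative d) (at t) \<and> 0 \<le> d"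
        by blast
    qed
    moreover have "2 * K * sqrt (x1 - y) \<ge> 0"
      using K that by simp
    ultimately show ?thesis
      by linarith
  qed
  have "rho C \<xi>00 \<xi>00 - 2 * K * sqrt (x1 - \<xi>00) \<le> rho C \<xi>00 y" if "0 < y" "y < x1" for y
    using b[of y] b[of \<xi>00] rho_less[of y \<xi>00] that \<xi>00_less by (cases "\<xi>00 \<le> y") auto
  then show ?thesis
    by blast
qed

text \<open>T is bounded above on the domain, so the integrand is at least c/y and \<rho> grows at
  least logarithmically at 0. This makes the profile available for every \<omega> > 0.\<close>

lemma rho_unbounded: "\<exists>y. 0 < y \<and> y < x1 \<and> r < rho C \<xi>00 y"
proof -
  define M where "M = \<bar>C\<bar> * x1\<^sup>2 + 3"
  have M: "M > 0"
    by (auto simp: M_def intro!: add_nonneg_pos)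
  define c where "c = sqrt (3 / M)"
  have c: "c > 0"
    using M by (simp add: c_def)
  have f_ge: "c / y \<le> f y" if "0 < y" "y < x1" for y
  proof -
    have "C * y\<^sup>2 \<le> \<bar>C\<bar> * x1\<^sup>2"
      using that by (intro mult_mono power_mono) auto
    then have "T C y \<le> M"
      using powr_ge_zero[of y "8/3"] unfolding T_def M_def by linarith
    then have "3 / (y\<^sup>2 * M) \<le> 3 / (y\<^sup>2 * T C y)"
      using that T_pos[of y] M by (intro divide_left_mono mult_left_mono mult_pos_pos) auto
    then have "sqrt (3 / (y\<^sup>2 * M)) \<le> f y"
      unfolding f_def by (rule real_sqrt_le_mono)
    moreover have "sqrt (3 / (y\<^sup>2 * M)) = c / y"
      using that by (simp add: c_def real_sqrt_divide real_sqrt_mult)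
    ultimately show ?thesis
      by simp
  qed
  define k where "k = rho C \<xi>00 \<xi>00 + c * ln \<xi>00"
  have b: "k - c * ln y \<le> rho C \<xi>00 y" if "0 < y" "y \<le> \<xi>00" for y
  proof -
    have "rho C \<xi>00 \<xi>00 + c * ln \<xi>00 \<le> rho C \<xi>00 y + c * ln y"
    proof (rule DERIV_nonpos_imp_nonincreasing[OF that(2)])
      fix t assume t: "y \<le> t" "t \<le> \<xi>00"
      then have lt: "0 < t" "t < x1"
        using that \<xi>00_less by auto
      have "((\<lambda>y. rho C \<xi>00 y + c * ln y) has_real_derivative - f t + c / t) (at t)"
        using DERIV_add[OF DERIV_rho[OF lt] DERIV_cmult[OF DERIV_ln_divide[OF lt(1)], of c]] by simp
      moreover have "- f t + c / t \<le> 0"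
        using f_ge[of t] t that \<xi>00_less by simp
      ultimately show "\<exists>d. ((\<lambda>y. rho C \<xi>00 y + c * ln y) has_real_derivative d) (at t) \<and> d \<le> 0"
        by blast
    qed
    then show ?thesis
      by (simp add: k_def)
  qed
  \<comment> \<open>The exponential solves k - c ln y = r + 1; the cap keeps \<open>y\<close> in the
    range of the logarithmic bound.\<close>
  define y where "y = min \<xi>00 (exp ((k - r - 1) / c))"
  have y: "0 < y" "y \<le> \<xi>00"
    using \<xi>00_pos by (auto simp: y_def)
  have "ln y \<le> ln (exp ((k - r - 1) / c))"
    using y(1) by (subst ln_le_cancel_iff) (auto simp: y_def)
  then have "c * ln y \<le> k - r - 1"
    using c by (simp add: field_simps)
  then have "r < rho C \<xi>00 y"
    using b[OF y] by linarith
  then show ?thesis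
    using y \<xi>00_less by (intro exI[of _ y]) auto
qed

text \<open>\<rho> is decreasing and bounded below, so its left limit at \<open>x1\<close> exists
  and is the infimum; only then does \<open>Lim\<close> have a meaning. The infimum is not attained,
  since the midpoint of \<open>y\<close> and \<open>x1\<close> gives a smaller value.\<close>

lemma rho1_less: "0 < y \<Longrightarrow> y < x1 \<Longrightarrow> rho1 C \<xi>00 < rho C \<xi>00 y"
  and rho_near_rho1: "rho1 C \<xi>00 < r \<Longrightarrow> \<exists>y. 0 < y \<and> y < x1 \<and> rho C \<xi>00 y < r"
proof -
  define A where "A = rho C \<xi>00 ` {0<..<x1}"
  have bdd: "bdd_below A"
    using rho_lower_bound unfolding A_def by (metis bdd_belowI2 greaterThanLessThan_iff)
  have ne: "A \<noteq> {}"
    using \<xi>00_pos \<xi>00_less by (auto simp: A_def)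
  have ge: "Inf A \<le> rho C \<xi>00 y" if "0 < y" "y < x1" for y
    using that bdd by (intro cInf_lower) (auto simp: A_def)
  have gt: "Inf A < rho C \<xi>00 y" if "0 < y" "y < x1" for y
    using ge[of "(y + x1) / 2"] rho_less[of y "(y + x1) / 2"] that by simp
  have near: "\<exists>y. 0 < y \<and> y < x1 \<and> rho C \<xi>00 y < r" if "Inf A < r" for r
    using cInf_lessD[OF ne that] by (auto simp: A_def)
  have "(rho C \<xi>00 \<longlongrightarrow> Inf A) (at_left x1)"
  proof (rule order_tendstoI)
    fix r assume "r < Inf A"
    then have "r < rho C \<xi>00 y" if "0 < y" "y < x1" for y
      using ge[OF that] by simp
    then show "\<forall>\<^sub>F y in at_left x1. r < rho C \<xi>00 y"
      using x1(1) by (auto simp: eventually_at_left intro!: exI[of _ 0])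
  next
    fix r assume "Inf A < r"
    then obtain y where y: "0 < y" "y < x1" "rho C \<xi>00 y < r"
      using near by blast
    then have "rho C \<xi>00 t < r" if "y < t" "t < x1" for t
      using rho_less[of y t] that by simp
    then show "\<forall>\<^sub>F y in at_left x1. rho C \<xi>00 y < r"
      using y by (auto simp: eventually_at_left intro!: exI[of _ y])
  qed
  then have "rho1 C \<xi>00 = Inf A"
    unfolding rho1_def by (intro tendsto_Lim) (auto simp: trivial_limit_at_left_real)
  then show "0 < y \<Longrightarrow> y < x1 \<Longrightarrow> rho1 C \<xi>00 < rho C \<xi>00 y"
    "rho1 C \<xi>00 < r \<Longrightarrow> \<exists>y. 0 < y \<and> y < x1 \<and> rho C \<xi>00 y < r"
    using gt near by auto
qed

section \<open>The inverse function of \<rho>\<close>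

lemma inj_on_rho: "inj_on (rho C \<xi>00) {0<..<x1}"
proof (rule inj_onI)
  fix x y assume "x \<in> {0<..<x1}" "y \<in> {0<..<x1}" "rho C \<xi>00 x = rho C \<xi>00 y"
  then show "x = y"
    using rho_less[of x y] rho_less[of y x] by (cases x y rule: linorder_cases) auto
qed

lemma xi_rho: "0 < y \<Longrightarrow> y < x1 \<Longrightarrow> xi C \<xi>00 (rho C \<xi>00 y) = y"
  unfolding xi_def by (rule the_inv_into_f_f[OF inj_on_rho]) simp

text \<open>The value of \<open>the_inv_into\<close> is meaningful only on the range of \<rho>. The
  intermediate value theorem, between a value just above \<open>rho1\<close> and an arbitrarily
  large one, shows that every \<open>r\<close> above \<open>rho1\<close> belongs to it.\<close>

lemma xi:
  assumes "rho1 C \<xi>00 < r"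
  shows "0 < xi C \<xi>00 r" "xi C \<xi>00 r < x1" "rho C \<xi>00 (xi C \<xi>00 r) = r"
proof -
  obtain a where a: "0 < a" "a < x1" "rho C \<xi>00 a < r"
    using rho_near_rho1[OF assms] by blast
  obtain b where b: "0 < b" "b < x1" "r < rho C \<xi>00 b"
    using rho_unbounded by blast
  have "b < a"
    using a b rho_less[of a b] by (cases a b rule: linorder_cases) auto
  have "\<exists>y\<ge>b. y \<le> a \<and> rho C \<xi>00 y = r"
    using a b \<open>b < a\<close> by (intro IVT2' continuous_at_imp_continuous_on ballI DERIV_isCont[OF DERIV_rho]) auto
  then obtain y where y: "b \<le> y" "y \<le> a" "rho C \<xi>00 y = r"
    by blast
  then have "0 < y" "y < x1"
    using a b by auto
  with y(3) show "0 < xi C \<xi>00 r" "xi C \<xi>00 r < x1" "rho C \<xi>00 (xi C \<xi>00 r) = r"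
    using xi_rho by auto
qed

lemma DERIV_xi:
  assumes "rho1 C \<xi>00 < r"
  shows "(xi C \<xi>00 has_real_derivative - (1 / f (xi C \<xi>00 r))) (at r)"
proof -
  note x = xi[OF assms]
  define a where "a = xi C \<xi>00 r / 2"
  define b where "b = (xi C \<xi>00 r + x1) / 2"
  have ab: "0 < a" "a < xi C \<xi>00 r" "xi C \<xi>00 r < b" "b < x1"
    using x by (auto simp: a_def b_def)
  have "isCont (xi C \<xi>00) (rho C \<xi>00 (xi C \<xi>00 r))"
  proof (rule isCont_inverse_function2[OF ab(2,3)])
    fix y assume "a \<le> y" "y \<le> b"
    then have "0 < y" "y < x1"
      using ab by auto
    then show "xi C \<xi>00 (rho C \<xi>00 y) = y" "isCont (rho C \<xi>00) y"
      by (rule xi_rho, rule DERIV_isCont[OF DERIV_rho])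
  qed
  then have c: "isCont (xi C \<xi>00) r"
    by (simp add: x)
  have "(xi C \<xi>00 has_real_derivative inverse (- f (xi C \<xi>00 r))) (at r)"
    by (rule DERIV_inverse_function[where f = "rho C \<xi>00" and a = "rho1 C \<xi>00" and b = "r + 1"])
      (use x f_pos[OF x(1,2)] assms c xi(3) in \<open>auto intro: DERIV_rho\<close>)
  then show ?thesis
    by (simp add: inverse_eq_divide)
qed

section \<open>The profile \<Gamma> and its differential equations\<close>

abbreviation "G \<equiv> Gam C \<xi>00"

definition z :: "real \<Rightarrow> real" where
  "z w = G w powr (- 1 / 3)"

text \<open>The first integral solved for \<Gamma>'^2, taken as a definition before
  differentiability of \<Gamma> is known.\<close>

definition Q :: "real \<Rightarrow> real" where
  "Q w = (G w)\<^sup>2 + C / 3 - (z w)\<^sup>2 / 3"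

text \<open>The root determines \<Gamma>' only up to sign; the even extension increases to the right
  of 0 and decreases to the left.\<close>

definition G1 :: "real \<Rightarrow> real" where
  "G1 w = sgn w * sqrt (Q w)"

lemma G_even: "G (- w) = G w"
  by (simp add: Gam_def)

lemma even_odd: "z (- w) = z w" "Q (- w) = Q w" "G1 (- w) = - G1 w"
  by (simp_all add: z_def Q_def G1_def G_even)

lemma G_pos: "G w > 0"
  using xi(1)[of "w + rho1 C \<xi>00"] xi(1)[of "- w + rho1 C \<xi>00"] x1 by (auto simp: Gam_def h_def)

lemma z_pos: "z w > 0"
  using G_pos[of w] by (simp add: z_def)

lemma G_z: "G w * z w ^ 3 = 1"
proof -
  have "z w ^ 3 = G w powr (- 1)"
    using G_pos[of w] by (simp add: z_def powr_power)
  then show ?thesis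
    using G_pos[of w] by (simp add: powr_minus)
qed

lemma Q_eq: "G w = 1 / y \<Longrightarrow> 0 < y \<Longrightarrow> Q w = S y / 3"
proof -
  assume y: "G w = 1 / y" "0 < y"
  have "(z w)\<^sup>2 = (1 / y) powr (- 2 / 3)"
    using y by (simp add: z_def powr_power)
  also have "\<dots> = y powr (2 / 3)"
    using y by (simp add: powr_divide powr_minus_divide)
  finally show ?thesis
    by (simp add: Q_def S_def y(1) power_divide diff_divide_distrib add_divide_distrib)
qed

lemma G_of_pos: "w > 0 \<Longrightarrow> G w = 1 / xi C \<xi>00 (w + rho1 C \<xi>00)"
  by (simp add: Gam_def h_def)

lemma Q_pos: "w \<noteq> 0 \<Longrightarrow> Q w > 0"
proof -
  have "Q w > 0" if "w > 0" for w
  proof -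
    have x: "0 < xi C \<xi>00 (w + rho1 C \<xi>00)" "xi C \<xi>00 (w + rho1 C \<xi>00) < x1"
      using xi[of "w + rho1 C \<xi>00"] that by auto
    show ?thesis
      using Q_eq[OF G_of_pos[OF that] x(1)] S_pos[OF x] by simp
  qed
  from this[of w] this[of "- w"] show "w \<noteq> 0 \<Longrightarrow> Q w > 0"
    by (cases "w > 0") (auto simp: even_odd)
qed

lemma Q_0: "Q 0 = 0"
  using Q_eq[of 0 x1] x1 by (simp add: Gam_def)

text \<open>The inverse function has derivative -1/f, so \<Gamma> = 1/\<xi> has derivative 1/(f
  \<xi>^2) = sqrt (S(\<xi>)/3), which is the root of \<open>Q\<close>.\<close>

lemma DERIV_G_pos:
  assumes "w > 0"
  shows "(G has_real_derivative G1 w) (at w)"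
proof -
  define r where "r = w + rho1 C \<xi>00"
  define y where "y = xi C \<xi>00 r"
  have r: "rho1 C \<xi>00 < r"
    using assms by (simp add: r_def)
  have y: "0 < y" "y < x1"
    using xi[OF r] by (auto simp: y_def)
  have "((\<lambda>w. xi C \<xi>00 (w + rho1 C \<xi>00)) has_real_derivative - (1 / f y)) (at w)"
    using DERIV_xi[OF r] by (simp add: DERIV_shift r_def y_def)
  then have "((\<lambda>w. 1 / xi C \<xi>00 (w + rho1 C \<xi>00)) has_real_derivative 1 / f y / y\<^sup>2) (at w)"
    using y by (auto intro!: derivative_eq_intros simp: y_def r_def power2_eq_square field_simps)
  moreover have "1 / f y / y\<^sup>2 = G1 w"
  proof -
    have "f y = sqrt 3 / (y\<^sup>2 * sqrt (S y))"
    proof -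
      have "f y = sqrt (3 / ((y\<^sup>2)\<^sup>2 * S y))"
        using y by (simp add: f_def T_eq power2_eq_square mult.assoc)
      also have "\<dots> = sqrt 3 / (y\<^sup>2 * sqrt (S y))"
        unfolding real_sqrt_divide real_sqrt_mult real_sqrt_abs by simp
      finally show ?thesis .
    qed
    then have "1 / f y / y\<^sup>2 = sqrt (S y) / sqrt 3"
      using y S_pos[OF y] by simp
    also have "\<dots> = sqrt (Q w)"
      using Q_eq[OF G_of_pos[OF assms, folded r_def, folded y_def] y(1)] by (simp only: real_sqrt_divide)
    finally show ?thesis
      using assms by (simp add: G1_def)
  qed
  ultimately have "((\<lambda>w. 1 / xi C \<xi>00 (w + rho1 C \<xi>00)) has_real_derivative G1 w) (at w)"
    by simp
  moreover have "open {0::real<..}" "w \<in> {0<..}"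
    using assms by auto
  ultimately show ?thesis
    by (rule has_field_derivative_transform_within_open) (simp_all add: G_of_pos)
qed

lemma DERIV_G_off: "w \<noteq> 0 \<Longrightarrow> (G has_real_derivative G1 w) (at w)"
proof (cases "w > 0")
  case False
  assume "w \<noteq> 0"
  with False have "- w > 0"
    by simp
  from DERIV_G_pos[OF this] have "((\<lambda>w. G (- w)) has_real_derivative - G1 (- w)) (at w)"
    by (simp add: DERIV_mirror)
  then show ?thesis
    by (simp add: G_even even_odd)
qed (rule DERIV_G_pos)

lemma isCont_G: "isCont G w"
proof (cases "w = 0")
  case True
  have "G \<midarrow>0\<rightarrow> 1 / x1"
  proof (rule order_tendstoI)
    have less: "1 / x1 < G w" if "w \<noteq> 0" for w
    proof -
      have "1 / x1 < G w" if "w > 0" for w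
        using xi[of "w + rho1 C \<xi>00"] that x1 by (simp add: G_of_pos frac_less2)
      from this[of w] this[of "- w"] show ?thesis
        using that by (cases "w > 0") (auto simp: G_even)
    qed
    fix a
    show "\<forall>\<^sub>F w in at 0. a < G w" if "a < 1 / x1"
      unfolding eventually_at using less that by (intro exI[of _ 1]) fastforce
    show "\<forall>\<^sub>F w in at 0. G w < a" if a: "1 / x1 < a"
    proof -
      \<comment> \<open>\<Gamma> < a means \<xi> > y, and since \<rho> decreases this holds as soon
        as \<omega> is below \<rho>(y) minus the limit \<open>rho1\<close>, the radius
        \<open>d\<close>.\<close>
      define y where "y = 1 / a"
      have "a > 0"
        using a x1 by (meson less_trans zero_less_divide_1_iff)
      then have y: "0 < y" "y < x1" "a = 1 / y"
        using a x1 by (auto simp: y_def field_simps)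
      define d where "d = rho C \<xi>00 y - rho1 C \<xi>00"
      have d: "d > 0"
        using rho1_less y by (simp add: d_def)
      have G: "G w < a" if "0 < w" "w < d" for w
      proof -
        note x = xi[of "w + rho1 C \<xi>00"]
        have "y < xi C \<xi>00 (w + rho1 C \<xi>00)"
        proof (rule ccontr)
          assume "\<not> ?thesis"
          then have "rho C \<xi>00 y \<le> rho C \<xi>00 (xi C \<xi>00 (w + rho1 C \<xi>00))"
            using rho_less[of "xi C \<xi>00 (w + rho1 C \<xi>00)" y] x that y
            by (cases "y = xi C \<xi>00 (w + rho1 C \<xi>00)") auto
          then show False
            using x that by (simp add: d_def)
        qed
        then show ?thesis
          using y that by (simp add: G_of_pos frac_less2)
      qed
      have "G w < a" if "w \<noteq> 0" "\<bar>w\<bar> < d" for w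
        using G[of w] G[of "- w"] that by (cases "w > 0") (auto simp: G_even)
      then show ?thesis
        unfolding eventually_at using d by (intro exI[of _ d]) auto
    qed
  qed
  then show ?thesis
    using True by (simp add: isCont_def Gam_def)
qed (auto intro: DERIV_isCont DERIV_G_off)

lemma isCont_z: "isCont z w"
  unfolding z_def[abs_def] using isCont_G[of w] G_pos[of w] by (intro continuous_intros) auto

text \<open>The jump of \<open>sgn\<close> is harmless because \<open>Q\<close> tends to 0: at
  \<omega> = 0 the value of \<xi> is the zero of T.\<close>

lemma isCont_G1_0: "isCont G1 0"
proof -
  have "isCont Q 0"
    unfolding Q_def[abs_def] by (intro continuous_intros isCont_G isCont_z) auto
  then have "isCont (\<lambda>w. sqrt (Q w)) 0"
    by (intro continuous_intros)
  then have "(\<lambda>w. sqrt (Q w)) \<midarrow>0\<rightarrow> 0"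
    by (simp add: isCont_def Q_0)
  then have "G1 \<midarrow>0\<rightarrow> 0"
    by (rule tendsto_0_le[where K = 1]) (auto simp: G1_def abs_mult sgn_if eventually_at_filter)
  then show ?thesis
    by (simp add: isCont_def G1_def)
qed

lemma DERIV_G: "(G has_real_derivative G1 w) (at w)"
  by (rule DERIV_at_0_extension[OF isCont_G isCont_G1_0 DERIV_G_off])

lemma DERIV_z: "(z has_real_derivative - (z w ^ 4 * G1 w / 3)) (at w)"
proof -
  have "(z has_real_derivative - 1 / 3 * G w powr (- 1 / 3 - 1) * G1 w) (at w)"
    unfolding z_def[abs_def] using DERIV_fun_powr[OF DERIV_G G_pos, of "- 1 / 3"] by simp
  moreover have "G w powr (- 1 / 3 - 1) = z w ^ 4"
    using G_pos[of w] by (simp add: z_def powr_power)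
  ultimately show ?thesis
    by simp
qed

text \<open>Differentiating the root of \<open>Q\<close> produces a quotient by \<open>G1\<close>,
  which is 0/0 at \<omega> = 0. Away from 0 the factor cancels, the resulting expression is
  continuous at 0, and the extension lemma gives the derivative there.\<close>

lemma DERIV_G1: "(G1 has_real_derivative G w + z w ^ 5 / 9) (at w)"
proof (rule DERIV_at_0_extension[OF isCont_G1_0])
  show "isCont (\<lambda>w. G w + z w ^ 5 / 9) 0"
    by (intro continuous_intros isCont_G isCont_z) auto
  have pos: "(G1 has_real_derivative G w + z w ^ 5 / 9) (at w)" if w: "w > 0" for w
  proof -
    have "(Q has_real_derivative 2 * G w * G1 w - 2 * z w * - (z w ^ 4 * G1 w / 3) / 3) (at w)"
      unfolding Q_def[abs_def] by (auto intro!: derivative_eq_intros DERIV_G DERIV_z)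
    moreover have "2 * G w * G1 w - 2 * z w * - (z w ^ 4 * G1 w / 3) / 3 = 2 * G1 w * (G w + z w ^ 5 / 9)"
      by (simp add: algebra_simps power_numeral_reduce)
    ultimately have "(Q has_real_derivative 2 * G1 w * (G w + z w ^ 5 / 9)) (at w)"
      by (simp only:)
    then have "((\<lambda>w. sqrt (Q w)) has_real_derivative
        inverse (sqrt (Q w)) / 2 * (2 * G1 w * (G w + z w ^ 5 / 9))) (at w)"
      using Q_pos[of w] w by (intro DERIV_chain2[OF DERIV_real_sqrt]) auto
    moreover have "inverse (sqrt (Q w)) / 2 * (2 * G1 w * (G w + z w ^ 5 / 9)) = G w + z w ^ 5 / 9"
      using Q_pos[of w] w by (simp add: G1_def)
    ultimately have "((\<lambda>w. sqrt (Q w)) has_real_derivative G w + z w ^ 5 / 9) (at w)"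
      by (simp only:)
    moreover have "open {0::real<..}" "w \<in> {0<..}"
      using w by auto
    ultimately show ?thesis
      by (rule has_field_derivative_transform_within_open) (simp_all add: G1_def)
  qed
  fix w :: real assume "w \<noteq> 0"
  show "(G1 has_real_derivative G w + z w ^ 5 / 9) (at w)"
  proof (cases "w > 0")
    case False
    with \<open>w \<noteq> 0\<close> have "- w > 0"
      by simp
    from pos[OF this] have "((\<lambda>w. G1 (- w)) has_real_derivative - (G (- w) + z (- w) ^ 5 / 9)) (at w)"
      by (simp add: DERIV_mirror)
    then have "((\<lambda>w. - G1 w) has_real_derivative - (G w + z w ^ 5 / 9)) (at w)"
      by (simp add: G_even even_odd)
    from DERIV_minus[OF this] show ?thesis
      by (simp add: add.commute)
  qed (rule pos)
qed

lemma warp_profile: "warp_profile C G G1 z"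
proof
  fix w
  have "Q w \<ge> 0"
    using Q_pos[of w] Q_0 by (cases "w = 0") auto
  then have "(G1 w)\<^sup>2 = Q w"
    using Q_0 by (cases "w = 0") (auto simp: G1_def power_mult_distrib sgn_if)
  then show "(G1 w)\<^sup>2 = (G w)\<^sup>2 + C / 3 - (z w)\<^sup>2 / 3"
    by (simp add: Q_def)
  show "0 < w * G1 w" if "w \<noteq> 0"
    using Q_pos[OF that] that by (cases "w > 0") (auto simp: G1_def mult_less_0_iff)
  show "G1 0 = 0"
    by (simp add: G1_def)
qed (fact DERIV_G DERIV_G1 DERIV_z G_z z_pos)+

end

theorem theorem3p10:
  fixes C \<xi>00 :: real
  assumes "0 < \<xi>00" and "\<xi>00 < xi01 C"
  shows "(\<exists>\<Phi>. biconservative_immersion (g_tilde C \<xi>00) \<Phi> \<and>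
            (\<forall>\<Psi>. biconservative_immersion (g_tilde C \<xi>00) \<Psi> \<longrightarrow>
               (\<exists>F. isometry_H3 F \<and> (\<forall>p. \<Psi> p = F (\<Phi> p)))))
       \<and> (\<forall>\<Phi>. biconservative_immersion (g_tilde C \<xi>00) \<Phi> \<longrightarrow>
            (\<exists>\<eta>. unit_normal_field \<Phi> \<eta>) \<and>
            (\<forall>\<eta> p. unit_normal_field \<Phi> \<eta> \<and> p $ 1 \<noteq> 0 \<longrightarrow>
               grad (g_tilde C \<xi>00) (mean_curvature (g_tilde C \<xi>00) \<Phi> \<eta>) p \<noteq> 0))"
proof -
  interpret profile_parameters C \<xi>00
    by unfold_locales (fact assms)+
  interpret W: warp_profile C G G1 z
    by (rule warp_profile)
  have "g_tilde C \<xi>00 = W.warped_metric"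
    by (simp add: fun_eq_iff g_tilde_def W.warped_metric_def)
  then show ?thesis
    using W.biconservative_immersion_unique_exists by simp
qed

end
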